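(* Let $B\in O_K$ be a singular semi-primary integer with $BO_K=\mathbf b^p$, where $Cl(\mathbf b)\in C_p^-$ has order $p$ and is annihilated by $\sigma-\mu$, with $\mu=u_{2m+1}$, $1\le m\le\frac{p-3}{2}$. Let $C=\frac{B}{\overline{B}}$ (a singular number). If $2m+1>\frac{p-1}{2}$, then there is $\delta\in\mathbb{Z}$ such that $$C\equiv 1-\delta\,\bigl(\zeta+\mu^{-1}\zeta^{u}+\dots+\mu^{-(p-2)}\zeta^{u_{p-2}}\bigr)\bmod \pi^{p-1},$$ where the sum is $\sum_{i=0}^{p-2}\mu^{-i}\zeta^{u_i}$, and $\delta$ is coprime with $p$ when $C$ is non-primary.
   Context: Let $p$ be an odd prime, $\zeta$ a primitive $p$-th root of unity, $K=\mathbb{Q}(\zeta)$, $O_K=\mathbb{Z}[\zeta]$, $\pi=(1-\zeta)O_K$ the prime ideal over $p$. Congruences modulo powers of $\pi$ are between $\pi$-integral elements of $K$ (so $\mu^{-i}$ may be read as any integer inverse of $\mu^i$ modulo $p$, since $pO_K=\pi^{p-1}$). Let $u$ be a primitive root mod $p$ and $\sigma$ the generator of $\mathrm{Gal}(K/\mathbb{Q})$ with $\sigma(\zeta)=\zeta^u$; $u_i$ denotes the integer with $u_i\equiv u^i \bmod p$, $1\le u_i\le p-1$. The bar is complex conjugation. A class $c$ is annihilated by $\sigma-\mu$ if $\sigma(c)=c^\mu$. $C_p$ is the subgroup of the class group of $K$ killed by $p$, and $C_p^-$ its minus part (classes $c\in C_p$ with $\overline{c}=c^{-1}$). A number $C\in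 K$ is singular if it is not a $p$-th power in $K$ and $CO_K=\mathbf c^p$ for some (fractional) ideal $\mathbf c$ of $K$. A singular number $C$ is primary if $C\equiv c^p \bmod \pi^p$ for some $c\in\mathbb{Z}$ with $c\not\equiv0\bmod p$, and semi-primary if $C\equiv c\bmod\pi^2$ for some $c\in\mathbb{Z}$ with $c\not\equiv 0\bmod p$. *)

theory Defs
  imports
    Complex_Main
    "HOL-Algebra.Algebra"
    "HOL-Algebra.Algebraic_Closure_Type"
    "HOL-Number_Theory.Residue_Primitive_Roots"
begin

text \<open>
  Everything takes place inside the complex numbers: \<open>z\<close> stands for a primitive
  \<open>p\<close>-th root of unity, the bar is \<^const>\<open>cnj\<close>.
\<close>

abbreviation CC :: "complex ring" where
  "CC \<equiv> ring_of_type_algebra"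

definition primitive_root_of_unity :: "nat \<Rightarrow> complex \<Rightarrow> bool" where
  "primitive_root_of_unity n z \<longleftrightarrow> 0 < n \<and> z ^ n = 1 \<and> (\<forall>k. 0 < k \<and> k < n \<longrightarrow> z ^ k \<noteq> 1)"

text \<open>The field $\mathbb{Q}(z)$ and the ring $\mathbb{Z}[z]$.\<close>

definition cyc_field :: "complex \<Rightarrow> complex set" where
  "cyc_field z = generate_field CC {z}"

definition cyc_int :: "complex \<Rightarrow> complex set" where
  "cyc_int z = generate_ring CC {z}"

definition cyc_field_ring :: "complex \<Rightarrow> complex ring" where
  "cyc_field_ring z = CC\<lparr>carrier := cyc_field z\<rparr>"

text \<open>The Galois group over the rationals: a ring automorphism of $\mathbb{Q}(z)$ fixes
  the prime field. Values outside \<^term>\<open>cyc_field z\<close> are irrelevant.\<close>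

definition Gal :: "complex \<Rightarrow> (complex \<Rightarrow> complex) set" where
  "Gal z = ring_iso (cyc_field_ring z) (cyc_field_ring z)"


definition fractional_ideal :: "complex \<Rightarrow> complex set \<Rightarrow> bool" where
  "fractional_ideal z I \<longleftrightarrow>
     I \<subseteq> cyc_field z \<and> additive_subgroup I CC \<and> (\<forall>a\<in>cyc_int z. \<forall>x\<in>I. a * x \<in> I) \<and>
     I \<noteq> {0} \<and> (\<exists>d\<in>cyc_int z - {0}. \<forall>x\<in>I. d * x \<in> cyc_int z)"

definition frac_ideals :: "complex \<Rightarrow> complex set monoid" where
  "frac_ideals z =
     \<lparr>carrier = {I. fractional_ideal z I}, monoid.mult = ideal_prod CC, one = cyc_int z\<rparr>"

definition principal :: "complex \<Rightarrow> complex \<Rightarrow> complex set" where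
  "principal z x = (\<lambda>a. x * a) ` cyc_int z"

definition principal_ideals :: "complex \<Rightarrow> complex set set" where
  "principal_ideals z = principal z ` (cyc_field z - {0})"

definition class_group :: "complex \<Rightarrow> complex set set monoid" where
  "class_group z = frac_ideals z Mod principal_ideals z"

definition ideal_class :: "complex \<Rightarrow> complex set \<Rightarrow> complex set set" where
  "ideal_class z I = principal_ideals z #>\<^bsub>frac_ideals z\<^esub> I"

text \<open>The action on classes of a map on \<^term>\<open>cyc_field z\<close> (used for \<^const>\<open>cnj\<close> and the
  elements of \<^term>\<open>Gal z\<close>).\<close>

definition class_map :: "(complex \<Rightarrow> complex) \<Rightarrow> complex set set \<Rightarrow> complex set set" where
  "class_map f c = (\<lambda>I. f ` I) ` c"

definition class_torsion :: "nat \<Rightarrow> complex \<Rightarrow> complex set set set" where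
  "class_torsion p z =
     {c \<in> carrier (class_group z). c [^]\<^bsub>class_group z\<^esub> p = \<one>\<^bsub>class_group z\<^esub>}"

definition class_torsion_minus :: "nat \<Rightarrow> complex \<Rightarrow> complex set set set" where
  "class_torsion_minus p z =
     {c \<in> class_torsion p z. class_map cnj c = inv\<^bsub>class_group z\<^esub> c}"

text \<open>The constant \<open>group.ord\<close> is specified only for structures already known to be
  groups; this is the same notion, stated without that proviso.\<close>

definition has_order :: "('a, 'b) monoid_scheme \<Rightarrow> 'a \<Rightarrow> nat \<Rightarrow> bool" where
  "has_order G x n \<longleftrightarrow>
     0 < n \<and> x [^]\<^bsub>G\<^esub> n = \<one>\<^bsub>G\<^esub> \<and> (\<forall>k. 0 < k \<and> k < n \<longrightarrow> x [^]\<^bsub>G\<^esub> k \<noteq> \<one>\<^bsub>G\<^esub>)"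


definition pi_ideal :: "complex \<Rightarrow> complex set" where
  "pi_ideal z = principal z (1 - z)"

definition pi_integral :: "complex \<Rightarrow> complex set" where
  "pi_integral z = {a / b | a b. a \<in> cyc_int z \<and> b \<in> cyc_int z - pi_ideal z}"

text \<open>Congruence modulo the \<open>k\<close>-th power of the prime above \<open>p\<close>, between elements of
  the local ring at that prime: the difference lies in the extension of that power of the
  prime to the local ring.\<close>

definition pi_cong :: "complex \<Rightarrow> nat \<Rightarrow> complex \<Rightarrow> complex \<Rightarrow> bool" where
  "pi_cong z k x y \<longleftrightarrow>
     x \<in> pi_integral z \<and> y \<in> pi_integral z \<and>
     (\<exists>a \<in> pi_ideal z [^]\<^bsub>frac_ideals z\<^esub> k. \<exists>b \<in> cyc_int z - pi_ideal z. x - y = a / b)"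

definition singular :: "nat \<Rightarrow> complex \<Rightarrow> complex \<Rightarrow> bool" where
  "singular p z C \<longleftrightarrow>
     C \<in> cyc_field z \<and> \<not> (\<exists>x\<in>cyc_field z. C = x ^ p) \<and>
     (\<exists>I \<in> carrier (frac_ideals z). principal z C = I [^]\<^bsub>frac_ideals z\<^esub> p)"

definition primary :: "nat \<Rightarrow> complex \<Rightarrow> complex \<Rightarrow> bool" where
  "primary p z C \<longleftrightarrow>
     singular p z C \<and> (\<exists>c::int. \<not> [c = 0] (mod int p) \<and> pi_cong z p C (of_int c ^ p))"

definition semi_primary :: "nat \<Rightarrow> complex \<Rightarrow> complex \<Rightarrow> bool" where
  "semi_primary p z C \<longleftrightarrow>
     singular p z C \<and> (\<exists>c::int. \<not> [c = 0] (mod int p) \<and> pi_cong z 2 C (of_int c))"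

text \<open>The residue of \<open>u ^ i\<close> in \<open>{1..p-1}\<close> (for \<open>u\<close> prime to \<open>p\<close>).\<close>

definition upow :: "nat \<Rightarrow> nat \<Rightarrow> nat \<Rightarrow> nat" where
  "upow p u i = u ^ i mod p"

end

theory Submission
  imports Defs
begin

text \<open>
  Write $\pi = 1 - \zeta$. From $\sigma(\mathbf b) = \alpha\,\mathbf b^\mu$ one gets
  $\sigma(B) = \alpha^p B^\mu \eta$ with a unit $\eta$, hence
  $\sigma(C) = \gamma^p C^\mu \eta / \overline{\eta}$ with $\gamma = \alpha / \overline{\alpha}$.
  Here $\eta / \overline{\eta}$ is $\pm$ a power of $\zeta$, and $\gamma \equiv \pm 1 \bmod \pi$ gives
  $\gamma^p \equiv \pm 1 \bmod \pi^p$. As $C \equiv 1 \bmod \pi^2$, sign and root of unity disappear, so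
  $\sigma(C) \equiv C^\mu \bmod \pi^p$.

  Put $D = C - 1$. Comparing leading terms in $\pi$, where $\sigma$ acts on $\pi^j$ by $u^j$, the
  $\pi$-adic valuation of $D$ is $2m + 1$ or at least $p$. Since $2(2m + 1) \ge p$, the congruence
  becomes linear, $\sigma(D) \equiv \mu D \bmod \pi^p$. The operator
  $\sum_i \mu^{-i} \sigma^i$ multiplies such a $D$ by $p - 1 \equiv -1$, and it sends every integer of the
  field to an integral multiple of $\sum_i \mu^{-i} \zeta^{u_i}$ modulo $p$, which yields $\delta$. If
  $p$ divides $\delta$, then the valuation of $D$ exceeds $2m + 1$, so $C$ is primary.

  No Dedekind theory is needed: $\mathbf b$ is invertible because its $p$-th power is principal.
  In place of integral closedness it suffices that $y^p \in \mathbb{Z}[\zeta]$ implies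
  $y \in \mathbb{Z}[\zeta]$ for $y$ in the field, and in place of Kronecker's lemma a trace estimate is
  used.
\<close>

subsection \<open>Subrings generated by one complex number\<close>

text \<open>The unit \<open>\<eta>\<close> that relates \<open>\<sigma> B\<close> to
  \<open>B ^ \<mu>\<close> is arbitrary, and this is the reason for passing from \<open>B\<close> to
  \<open>B / cnj B\<close>: the quotient of \<open>\<eta>\<close> by its conjugate has all its
  conjugates of modulus 1. Semi-primarity then gives exactly the precision that is required to see
  the remaining root of unity, since \<open>\<zeta> ^ k\<close> is \<open>1 - k * \<pi>\<close>
  modulo the square of the prime.

  Two precisions coexist. The integer \<open>\<mu>\<close> satisfies
  \<open>\<mu> ^ (p - 1) = 1\<close> only modulo \<open>p\<close>, so the sum in the theorem is an
  eigenvector of \<open>\<sigma>\<close> only modulo \<open>p\<close>, that is, modulo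
  \<open>\<pi> ^ (p - 1)\<close>; this limits the expansion. Being primary asks for one more power
  of \<open>\<pi>\<close>. It is gained from the congruence between \<open>\<sigma> C\<close> and
  \<open>C ^ \<mu>\<close>, which holds modulo \<open>\<pi> ^ p\<close>: at level
  \<open>p - 1\<close> the action of \<open>\<sigma>\<close> is by \<open>u ^ (p - 1)\<close>, which
  is 1 modulo \<open>p\<close> and therefore differs from \<open>\<mu>\<close>, because
  \<open>0 < 2 * m + 1 < p - 1\<close>.\<close>

locale unital_subring =
  fixes A :: "'a::comm_ring_1 set"
  assumes one_mem [simp]: "1 \<in> A"
    and add_mem [simp]: "x \<in> A \<Longrightarrow> y \<in> A \<Longrightarrow> x + y \<in> A"
    and uminus_mem [simp]: "x \<in> A \<Longrightarrow> - x \<in> A"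
    and mult_mem [simp]: "x \<in> A \<Longrightarrow> y \<in> A \<Longrightarrow> x * y \<in> A"
begin

lemma diff_mem [simp]: "x \<in> A \<Longrightarrow> y \<in> A \<Longrightarrow> x - y \<in> A"
  using add_mem[of x "- y"] by simp

lemma zero_mem [simp]: "0 \<in> A"
  using diff_mem[of 1 1] by simp

lemma power_mem [simp]: "x \<in> A \<Longrightarrow> x ^ n \<in> A"
  by (induction n) simp_all

lemma sum_mem: "(\<And>i. i \<in> I \<Longrightarrow> f i \<in> A) \<Longrightarrow> sum f I \<in> A"
  by (induction I rule: infinite_finite_induct) simp_all

lemma prod_mem: "(\<And>i. i \<in> I \<Longrightarrow> f i \<in> A) \<Longrightarrow> prod f I \<in> A"
  by (induction I rule: infinite_finite_induct) simp_all

lemma of_nat_mem [simp]: "of_nat n \<in> A"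
  by (induction n) simp_all

lemma of_int_mem [simp]: "of_int n \<in> A"
proof (cases n rule: int_cases2)
  case (nonneg m)
  then show ?thesis by simp
next
  case (nonpos m)
  then show ?thesis by simp
qed

text \<open>In the binomial expansion every mixed term is divisible by \<open>l * x * y\<close>; the
  one linear in \<open>y\<close> is split off. For \<open>x = 1\<close> the bracket becomes
  \<open>1 + y * e\<close>, which relates \<open>\<pi> ^ (p - 1)\<close> to \<open>p\<close>; in
  \<open>P_power_p\<close> the visible factor \<open>l * y\<close> supplies the extra power of the
  prime.\<close>

lemma add_power_prime:
  assumes "Factorial_Ring.prime l" "x \<in> A" "y \<in> A"
  shows "\<exists>e\<in>A. (x + y) ^ l = x ^ l + y ^ l + of_nat l * x * y * (x ^ (l - 2) + y * e)"
proof -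
  obtain n where n: "l = Suc (Suc n)"
    using prime_ge_2_nat[OF assms(1)] that[of "l - 2"] by simp
  define c where "c k = (l choose k) div l" for k
  have c: "l choose k = l * c k" if "0 < k" "k < l" for k
    using dvd_choose_prime[of k l] assms(1) that by (simp add: c_def)
  define e where "e = (\<Sum>k<n. of_nat (c (Suc k)) * x ^ k * y ^ (n - Suc k))"
  have summand: "of_nat (l choose Suc k) * x ^ Suc k * y ^ (l - Suc k)
      = of_nat l * x * y * y * (of_nat (c (Suc k)) * x ^ k * y ^ (n - Suc k))" if "k < n" for k
  proof -
    have "l - Suc k = Suc (Suc (n - Suc k))" using that n by simp
    moreover have "l choose Suc k = l * c (Suc k)" using that n by (intro c) auto
    ultimately show ?thesis by (simp add: algebra_simps)
  qed
  have "(x + y) ^ l = (\<Sum>k\<le>l. of_nat (l choose k) * x ^ k * y ^ (l - k))"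
    by (rule binomial_ring)
  also have "\<dots> = (\<Sum>k\<le>n. of_nat (l choose k) * x ^ k * y ^ (l - k))
      + of_nat l * x ^ Suc n * y + x ^ l"
    by (simp add: n)
  also have "(\<Sum>k\<le>n. of_nat (l choose k) * x ^ k * y ^ (l - k)) =
      y ^ l + (\<Sum>k<n. of_nat (l choose Suc k) * x ^ Suc k * y ^ (l - Suc k))"
    unfolding sum.atMost_shift by simp
  also have "(\<Sum>k<n. of_nat (l choose Suc k) * x ^ Suc k * y ^ (l - Suc k)) =
      of_nat l * x * y * y * e"
    unfolding e_def sum_distrib_left by (intro sum.cong refl summand) simp
  finally have "(x + y) ^ l = x ^ l + y ^ l + of_nat l * x * y * (x ^ (l - 2) + y * e)"
    by (simp add: n algebra_simps)
  moreover have "e \<in> A" unfolding e_def using assms by (intro sum_mem) simp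
  ultimately show ?thesis by blast
qed

lemma power_add_diff_linear:
  assumes "x \<in> A"
  shows "\<exists>e\<in>A. (1 + x) ^ n = 1 + of_nat n * x + x ^ 2 * e"
proof (induction n)
  case 0
  then show ?case by (intro bexI[of _ 0]) auto
next
  case (Suc n)
  then obtain e where e: "e \<in> A" "(1 + x) ^ n = 1 + of_nat n * x + x ^ 2 * e" by blast
  have "(1 + x) ^ Suc n = 1 + of_nat (Suc n) * x + x ^ 2 * (of_nat n + e + x * e)"
    unfolding power_Suc e(2) by (simp add: algebra_simps power2_eq_square)
  moreover have "of_nat n + e + x * e \<in> A" using e(1) assms by simp
  ultimately show ?case by blast
qed

end

lemma CC_simps [simp]:
  "carrier CC = UNIV" "x \<otimes>\<^bsub>CC\<^esub> y = x * y" "\<one>\<^bsub>CC\<^esub> = 1" "\<zero>\<^bsub>CC\<^esub> = 0" "x \<oplus>\<^bsub>CC\<^esub> y = x + y"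
  by (auto simp: ring_of_type_algebra_def)

lemma CC_a_inv [simp]: "\<ominus>\<^bsub>CC\<^esub> x = - x"
proof -
  interpret field CC by (rule field_from_type_algebra)
  show ?thesis by (rule minus_equality) auto
qed

lemma CC_m_inv [simp]:
  assumes "x \<noteq> 0"
  shows "inv\<^bsub>CC\<^esub> x = inverse x"
proof -
  have "comm_monoid CC"
    using cring_from_type_algebra cring_def by blast
  then show ?thesis
    by (rule comm_monoid.comm_inv_char) (simp_all add: assms)
qed

interpretation cyc_int: unital_subring "cyc_int z" for z
  unfolding cyc_int_def
  using generate_ring.one[of CC] generate_ring.eng_add[of _ CC] generate_ring.a_inv[of _ CC]
    generate_ring.eng_mult[of _ CC]
  by unfold_locales auto

interpretation cyc_field: unital_subring "cyc_field z" for z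
  unfolding cyc_field_def
  using generate_field.one[of CC] generate_field.eng_add[of _ CC] generate_field.a_inv[of _ CC]
    generate_field.eng_mult[of _ CC]
  by unfold_locales auto

lemma generator_mem_cyc_int [simp, intro]: "z \<in> cyc_int z"
  unfolding cyc_int_def by (rule generate_ring.incl) simp

lemma generator_mem_cyc_field [simp, intro]: "z \<in> cyc_field z"
  unfolding cyc_field_def by (rule generate_field.incl) simp

lemma inverse_mem_cyc_field [simp, intro]: "x \<in> cyc_field z \<Longrightarrow> inverse x \<in> cyc_field z"
  using generate_field.m_inv[of x CC "{z}"] cyc_field.zero_mem
  by (cases "x = 0") (simp_all add: cyc_field_def)

lemma divide_mem_cyc_field [simp, intro]: "x \<in> cyc_field z \<Longrightarrow> y \<in> cyc_field z \<Longrightarrow> x / y \<in> cyc_field z"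
  by (simp add: divide_inverse)

text \<open>Products of powers are powers, so closing the powers of \<open>z\<close> under sums and
  negation already gives the ring. The resulting induction on \<open>cyc_int z\<close> has no
  product case, which suits additive statements about traces, coordinates and residues.\<close>

inductive_set power_span :: "'a::comm_ring_1 \<Rightarrow> 'a set" for z where
  power: "z ^ k \<in> power_span z"
| add: "x \<in> power_span z \<Longrightarrow> y \<in> power_span z \<Longrightarrow> x + y \<in> power_span z"
| uminus: "x \<in> power_span z \<Longrightarrow> - x \<in> power_span z"

lemma power_span_mult:
  assumes "x \<in> power_span z" "y \<in> power_span z"
  shows "x * y \<in> power_span z"
  using assms(1)
proof induction
  case (power k)
  show ?case using assms(2)
  proof induction
    case (power j)
    then show ?case using power_span.power[of z "k + j"] by (simp add: power_add)
  qed (auto simp: distrib_left intro: power_span.intros)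
qed (auto simp: distrib_right intro: power_span.intros)

lemma cyc_int_eq_power_span: "cyc_int z = power_span z"
proof
  show "cyc_int z \<subseteq> power_span z"
  proof
    fix x assume "x \<in> cyc_int z"
    then show "x \<in> power_span z" unfolding cyc_int_def
    proof induction
      case one
      then show ?case using power_span.power[of z 0] by simp
    next
      case (incl h)
      then show ?case using power_span.power[of z 1] by simp
    qed (auto intro: power_span.intros power_span_mult)
  qed
  show "power_span z \<subseteq> cyc_int z"
  proof
    fix x assume "x \<in> power_span z"
    then show "x \<in> cyc_int z" by induction auto
  qed
qed

lemmas cyc_int_induct [consumes 1, case_names power add uminus] =
  power_span.induct[where z = z for z :: complex, folded cyc_int_eq_power_span]

lemma cyc_int_subset_cyc_field: "cyc_int z \<subseteq> cyc_field z"
proof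
  fix x assume "x \<in> cyc_int z"
  then show "x \<in> cyc_field z" by (induction rule: cyc_int_induct) auto
qed

lemma cyc_field_eq_fractions: "cyc_field z = {a / b |a b. a \<in> cyc_int z \<and> b \<in> cyc_int z \<and> b \<noteq> 0}"
  (is "_ = ?F")
proof
  have frac: "x \<in> ?F" if "x = a / b" "a \<in> cyc_int z" "b \<in> cyc_int z" "b \<noteq> 0" for x a b
    using that by blast
  show "cyc_field z \<subseteq> ?F"
  proof
    fix x assume "x \<in> cyc_field z"
    then show "x \<in> ?F" unfolding cyc_field_def
    proof induction
      case one
      show ?case by (rule frac[of _ 1 1]) auto
    next
      case (incl h)
      then show ?case by (intro frac[of _ z 1]) auto
    next
      case (a_inv h)
      then obtain a b where "h = a / b" "a \<in> cyc_int z" "b \<in> cyc_int z" "b \<noteq> 0" by blast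
      then show ?case by (intro frac[of _ "- a" b]) auto
    next
      case (m_inv h)
      then obtain a b where "h = a / b" "a \<in> cyc_int z" "b \<in> cyc_int z" "b \<noteq> 0" by blast
      then show ?case using m_inv by (intro frac[of _ b a]) auto
    next
      case (eng_add h1 h2)
      then obtain a b c d where "h1 = a / b" "a \<in> cyc_int z" "b \<in> cyc_int z" "b \<noteq> 0"
        "h2 = c / d" "c \<in> cyc_int z" "d \<in> cyc_int z" "d \<noteq> 0" by blast
      then show ?case by (intro frac[of _ "a * d + c * b" "b * d"]) (simp_all add: add_frac_eq)
    next
      case (eng_mult h1 h2)
      then obtain a b c d where "h1 = a / b" "a \<in> cyc_int z" "b \<in> cyc_int z" "b \<noteq> 0"
        "h2 = c / d" "c \<in> cyc_int z" "d \<in> cyc_int z" "d \<noteq> 0" by blast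
      then show ?case by (intro frac[of _ "a * c" "b * d"]) auto
    qed
  qed
  show "?F \<subseteq> cyc_field z"
  proof
    fix x assume "x \<in> ?F"
    then obtain a b where "x = a / b" "a \<in> cyc_int z" "b \<in> cyc_int z" by blast
    then show "x \<in> cyc_field z"
      using cyc_int_subset_cyc_field[of z] by (metis divide_mem_cyc_field subsetD)
  qed
qed

subsection \<open>Field homomorphisms and powers of the root of unity\<close>

text \<open>One interface for \<open>\<sigma>\<close>, its iterates and complex conjugation.
  Integrality is asked of the image of the generator alone, where it is visible because that image
  is a power of the root of unity; it spreads to the whole ring.\<close>

locale cyc_field_hom =
  fixes z :: complex and f :: "complex \<Rightarrow> complex"
  assumes closed [simp]: "x \<in> cyc_field z \<Longrightarrow> f x \<in> cyc_field z"
    and hom_add [simp]: "x \<in> cyc_field z \<Longrightarrow> y \<in> cyc_field z \<Longrightarrow> f (x + y) = f x + f y"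
    and hom_mult [simp]: "x \<in> cyc_field z \<Longrightarrow> y \<in> cyc_field z \<Longrightarrow> f (x * y) = f x * f y"
    and hom_one [simp]: "f 1 = 1"
    and integral_generator: "f z \<in> cyc_int z"
begin

lemma hom_zero [simp]: "f 0 = 0"
  using hom_add[of 0 0] by simp

lemma hom_uminus [simp]: "x \<in> cyc_field z \<Longrightarrow> f (- x) = - f x"
  using hom_add[of x "- x"] by (simp add: eq_neg_iff_add_eq_0 add.commute)

lemma hom_diff [simp]: "x \<in> cyc_field z \<Longrightarrow> y \<in> cyc_field z \<Longrightarrow> f (x - y) = f x - f y"
  using hom_add[of x "- y"] by simp

lemma hom_power [simp]: "x \<in> cyc_field z \<Longrightarrow> f (x ^ n) = f x ^ n"
  by (induction n) simp_all

lemma hom_of_nat [simp]: "f (of_nat n) = of_nat n"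
  by (induction n) simp_all

lemma hom_of_int [simp]: "f (of_int n) = of_int n"
  by (cases n rule: int_cases2) simp_all

lemma hom_sum: "(\<And>i. i \<in> I \<Longrightarrow> g i \<in> cyc_field z) \<Longrightarrow> f (sum g I) = (\<Sum>i\<in>I. f (g i))"
  by (induction I rule: infinite_finite_induct) (simp_all add: cyc_field.sum_mem)

lemma hom_inverse [simp]:
  assumes "x \<in> cyc_field z"
  shows "f (inverse x) = inverse (f x)"
proof (cases "x = 0")
  case False
  then have "f x * f (inverse x) = 1"
    using hom_mult[of x "inverse x"] assms by simp
  then show ?thesis by (simp add: inverse_unique)
qed simp

lemma hom_divide [simp]: "x \<in> cyc_field z \<Longrightarrow> y \<in> cyc_field z \<Longrightarrow> f (x / y) = f x / f y"
  by (simp add: divide_inverse)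

lemma hom_eq_0_iff [simp]: "x \<in> cyc_field z \<Longrightarrow> f x = 0 \<longleftrightarrow> x = 0"
  using hom_mult[of x "inverse x"] by (cases "x = 0") auto

lemma cyc_int_closed [simp]:
  assumes "x \<in> cyc_int z"
  shows "f x \<in> cyc_int z"
  using assms
proof (induction rule: cyc_int_induct)
  case (power k)
  then show ?case using integral_generator by simp
next
  case (add x y)
  then show ?case using cyc_int_subset_cyc_field[of z] by (simp add: subset_iff)
next
  case (uminus x)
  then show ?case using cyc_int_subset_cyc_field[of z] by (simp add: subset_iff)
qed

lemma cyc_field_hom_compose:
  assumes "cyc_field_hom z g"
  shows "cyc_field_hom z (\<lambda>x. g (f x))"
proof -
  interpret g: cyc_field_hom z g by fact
  show ?thesis by unfold_locales (simp_all add: integral_generator)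
qed

lemma cyc_field_hom_funpow: "cyc_field_hom z (f ^^ n)"
proof (induction n)
  case 0
  show ?case by unfold_locales simp_all
next
  case (Suc n)
  then interpret g: cyc_field_hom z "f ^^ n" .
  show ?case
    using g.cyc_field_hom_compose[OF cyc_field_hom_axioms] by (simp add: o_def)
qed

end

lemma cyc_field_hom_eqI:
  assumes "cyc_field_hom z f" "cyc_field_hom z g" "f z = g z" "x \<in> cyc_field z"
  shows "f x = g x"
proof -
  interpret f: cyc_field_hom z f by fact
  interpret g: cyc_field_hom z g by fact
  have int: "f y = g y" if "y \<in> cyc_int z" for y
    using that
  proof (induction rule: cyc_int_induct)
    case (power k)
    then show ?case using assms(3) by simp
  next
    case (add x y)
    then show ?case using cyc_int_subset_cyc_field[of z] by (simp add: subset_iff)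
  next
    case (uminus x)
    then show ?case using cyc_int_subset_cyc_field[of z] by (simp add: subset_iff)
  qed
  obtain a b where "x = a / b" "a \<in> cyc_int z" "b \<in> cyc_int z"
    using assms(4) unfolding cyc_field_eq_fractions by blast
  then show ?thesis
    using int cyc_int_subset_cyc_field[of z] by (simp add: subset_iff)
qed

section \<open>The root of unity, the element 1 - \<zeta> and its relation to p\<close>

locale cyclotomic =
  fixes p :: nat and \<zeta> :: complex
  assumes prime_p: "Factorial_Ring.prime p" and odd_p: "odd p"
    and root: "primitive_root_of_unity p \<zeta>"
begin

abbreviation O\<^sub>K :: "complex set" where "O\<^sub>K \<equiv> cyc_int \<zeta>"
abbreviation K :: "complex set" where "K \<equiv> cyc_field \<zeta>"
definition \<pi> :: complex where "\<pi> = 1 - \<zeta>"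

lemma p_ge_3: "p \<ge> 3"
  using prime_p odd_p prime_ge_2_nat[of p] by (cases "p = 2") auto

lemma O_imp_K [simp]: "x \<in> O\<^sub>K \<Longrightarrow> x \<in> K"
  using cyc_int_subset_cyc_field by blast

lemma zeta_power_p [simp]: "\<zeta> ^ p = 1"
  using root by (simp add: primitive_root_of_unity_def)

lemma zeta_nonzero [simp]: "\<zeta> \<noteq> 0"
  using zeta_power_p p_ge_3 by (metis power_0_left zero_neq_one not_numeral_le_zero)

lemma zeta_power_mod: "\<zeta> ^ (k mod p) = \<zeta> ^ k"
proof -
  have "\<zeta> ^ k = \<zeta> ^ (p * (k div p) + k mod p)" by simp
  also have "\<dots> = \<zeta> ^ (k mod p)" unfolding power_add power_mult by simp
  finally show ?thesis by simp
qed

lemma zeta_power_cong: "[a = b] (mod p) \<Longrightarrow> \<zeta> ^ a = \<zeta> ^ b"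
  by (metis zeta_power_mod cong_def)

lemma zeta_power_eq_1_iff: "\<zeta> ^ k = 1 \<longleftrightarrow> p dvd k"
proof
  assume "\<zeta> ^ k = 1"
  then have *: "\<zeta> ^ (k mod p) = 1" by (simp only: zeta_power_mod)
  have "\<forall>j. 0 < j \<and> j < p \<longrightarrow> \<zeta> ^ j \<noteq> 1"
    using root unfolding primitive_root_of_unity_def by (elim conjE)
  from spec[OF this, of "k mod p"] * have "\<not> (0 < k mod p \<and> k mod p < p)" by blast
  moreover have "k mod p < p" using p_ge_3 by simp
  ultimately show "p dvd k" by (simp add: mod_eq_0_iff_dvd)
next
  assume "p dvd k"
  then obtain j where "k = p * j" by (rule dvdE)
  then show "\<zeta> ^ k = 1" by (simp only: power_mult zeta_power_p power_one)
qed

lemma norm_zeta [simp]: "cmod \<zeta> = 1"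
  using power_eq_1_iff[OF zeta_power_p] p_ge_3 by simp

lemma cnj_zeta: "cnj \<zeta> = \<zeta> ^ (p - 1)"
proof -
  have "\<zeta> * cnj \<zeta> = 1" by (simp add: complex_norm_square[symmetric])
  moreover have "\<zeta> * \<zeta> ^ (p - 1) = 1"
    using zeta_power_p p_ge_3 by (metis power_eq_if not_numeral_le_zero)
  ultimately show ?thesis by (metis mult_left_cancel zeta_nonzero)
qed

sublocale cnj: cyc_field_hom \<zeta> cnj
proof
  show *: "cnj \<zeta> \<in> O\<^sub>K" by (simp add: cnj_zeta)
  have int: "cnj x \<in> O\<^sub>K" if "x \<in> O\<^sub>K" for x
    using that by (induction rule: cyc_int_induct) (simp_all add: *)
  show "cnj x \<in> K" if x: "x \<in> K" for x
  proof -
    obtain a b where "x = a / b" "a \<in> O\<^sub>K" "b \<in> O\<^sub>K"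
      using x unfolding cyc_field_eq_fractions by blast
    then show ?thesis using int by simp
  qed
qed simp_all

lemma pi_mem [simp]: "\<pi> \<in> O\<^sub>K"
  by (simp add: \<pi>_def)

lemma pi_nonzero [simp]: "\<pi> \<noteq> 0"
  using zeta_power_eq_1_iff[of 1] p_ge_3 by (auto simp: \<pi>_def)

lemma sum_zeta_powers: "(\<Sum>k<p. \<zeta> ^ (n * k)) = (if p dvd n then of_nat p else 0)"
proof (cases "p dvd n")
  case True
  then have "\<zeta> ^ (n * k) = 1" for k by (simp add: zeta_power_eq_1_iff)
  then show ?thesis using True by simp
next
  case False
  then have "\<zeta> ^ n \<noteq> 1" by (simp add: zeta_power_eq_1_iff)
  then have "(\<Sum>k<p. (\<zeta> ^ n) ^ k) = 0"
    using geometric_sum[of "\<zeta> ^ n" p]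
    by (simp add: power_mult[symmetric] mult.commute[of n p] power_mult[of \<zeta> p n])
  then show ?thesis using False by (simp only: power_mult if_False)
qed

text \<open>The cofactor is recorded to first order, as \<open>k\<close> modulo
  \<open>\<pi>\<close>. This is the source of \<open>\<sigma> \<pi> = u * \<pi>\<close> to leading
  order, and it later decides whether \<open>p\<close> divides an exponent.\<close>

lemma pi_dvd_1_minus_zeta_power: "\<exists>e\<in>O\<^sub>K. 1 - \<zeta> ^ k = \<pi> * e \<and> (\<exists>e'\<in>O\<^sub>K. e = of_nat k + \<pi> * e')"
proof (induction k)
  case 0
  then show ?case by (auto intro!: bexI[of _ 0])
next
  case (Suc k)
  then obtain e e' where e: "e \<in> O\<^sub>K" "1 - \<zeta> ^ k = \<pi> * e" "e' \<in> O\<^sub>K" "e = of_nat k + \<pi> * e'"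
    by blast
  have 1: "1 - \<zeta> ^ Suc k = \<pi> * (e + \<zeta> ^ k)"
    using e(2) by (simp add: \<pi>_def algebra_simps)
  have 2: "e + \<zeta> ^ k = of_nat (Suc k) + \<pi> * (e' - e)"
    using e(2,4) by (simp add: algebra_simps)
  show ?case
    by (rule bexI[of _ "e + \<zeta> ^ k"]) (use 1 2 e(1,3) in auto)
qed

text \<open>Powers of \<open>\<zeta>\<close> are 1 modulo \<open>\<pi>\<close>, so the residue ring
  is an image of the integers.\<close>

lemma residue_int:
  assumes "x \<in> O\<^sub>K"
  shows "\<exists>n::int. \<exists>e\<in>O\<^sub>K. x = of_int n + \<pi> * e"
  using assms
proof (induction rule: cyc_int_induct)
  case (power k)
  obtain e where "e \<in> O\<^sub>K" "1 - \<zeta> ^ k = \<pi> * e"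
    using pi_dvd_1_minus_zeta_power by blast
  then have "\<zeta> ^ k = of_int 1 + \<pi> * (- e)" "- e \<in> O\<^sub>K"
    by (simp_all add: algebra_simps)
  then show ?case by blast
next
  case (add x y)
  then obtain n m e e' where "x = of_int n + \<pi> * e" "y = of_int m + \<pi> * e'" "e \<in> O\<^sub>K" "e' \<in> O\<^sub>K"
    by blast
  then have "x + y = of_int (n + m) + \<pi> * (e + e')" "e + e' \<in> O\<^sub>K"
    by (simp_all add: algebra_simps)
  then show ?case by blast
next
  case (uminus x)
  then obtain n e where "x = of_int n + \<pi> * e" "e \<in> O\<^sub>K"
    by blast
  then have "- x = of_int (- n) + \<pi> * (- e)" "- e \<in> O\<^sub>K"
    by simp_all
  then show ?case by blast
qed

text \<open>Expanding \<open>(1 - \<pi>) ^ p = 1\<close> gives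
  \<open>\<pi> ^ (p - 1) = - p * (1 - \<pi> * e)\<close>, which settles the first claim.\<close>

lemma pi_power_dvd_p: "\<exists>e\<in>O\<^sub>K. \<pi> ^ (p - 1) = of_nat p * e"
  and p_dvd_pi_power: "\<exists>e\<in>O\<^sub>K. of_nat p = \<pi> ^ (p - 1) * e"
proof -
  obtain e where e: "e \<in> O\<^sub>K"
    "(1 + - \<pi>) ^ p = 1 ^ p + (- \<pi>) ^ p + of_nat p * 1 * (- \<pi>) * (1 ^ (p - 2) + (- \<pi>) * e)"
    using cyc_int.add_power_prime[OF prime_p, of 1 \<zeta> "- \<pi>"] by auto
  have "(1 + - \<pi>) ^ p = 1" by (simp add: \<pi>_def)
  moreover have "(- \<pi>) ^ p = - (\<pi> * \<pi> ^ (p - 1))"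
    using odd_p p_ge_3 by (cases p) auto
  ultimately have "\<pi> * (\<pi> ^ (p - 1) + of_nat p * (1 - \<pi> * e)) = 0"
    using e(2) by (simp add: algebra_simps)
  then have eq: "\<pi> ^ (p - 1) = - of_nat p * (1 - \<pi> * e)"
    by (simp add: eq_neg_iff_add_eq_0)
  show "\<exists>e\<in>O\<^sub>K. \<pi> ^ (p - 1) = of_nat p * e"
    using eq e(1) by (intro bexI[of _ "- (1 - \<pi> * e)"]) (simp_all add: algebra_simps)
  \<comment> \<open>Instead of inverting \<open>1 - \<pi> * e\<close>, multiply it by a geometric
    sum. It becomes \<open>1 - (\<pi> * e) ^ (p - 1)\<close>, and the subtracted power carries its
    own factor \<open>\<pi> ^ (p - 1)\<close>, so it can move to the other side.\<close>
  have "of_nat p * (1 - (\<pi> * e) ^ (p - 1)) = \<pi> ^ (p - 1) * (- (\<Sum>i<p - 1. (\<pi> * e) ^ i))"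
    unfolding one_diff_power_eq eq by (simp add: algebra_simps)
  then have "of_nat p = \<pi> ^ (p - 1) * (of_nat p * e ^ (p - 1) - (\<Sum>i<p - 1. (\<pi> * e) ^ i))"
    by (simp add: algebra_simps power_mult_distrib)
  moreover have "of_nat p * e ^ (p - 1) - (\<Sum>i<p - 1. (\<pi> * e) ^ i) \<in> O\<^sub>K"
    using e(1) by (simp add: cyc_int.sum_mem)
  ultimately show "\<exists>e\<in>O\<^sub>K. of_nat p = \<pi> ^ (p - 1) * e" by blast
qed

end

subsection \<open>Traces and coordinates\<close>

locale cyclotomic_galois = cyclotomic +
  fixes u :: nat and \<sigma> :: "complex \<Rightarrow> complex"
  assumes primroot_u: "residue_primroot p u"
    and sigma_Gal: "\<sigma> \<in> Gal \<zeta>" and sigma_zeta [simp]: "\<sigma> \<zeta> = \<zeta> ^ u"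
begin

sublocale \<sigma>: cyc_field_hom \<zeta> \<sigma>
proof -
  have hom: "\<sigma> \<in> ring_hom (cyc_field_ring \<zeta>) (cyc_field_ring \<zeta>)"
    using sigma_Gal unfolding Gal_def ring_iso_def by blast
  have "carrier (cyc_field_ring \<zeta>) = K" "\<one>\<^bsub>cyc_field_ring \<zeta>\<^esub> = 1"
    "x \<otimes>\<^bsub>cyc_field_ring \<zeta>\<^esub> y = x * y" "x \<oplus>\<^bsub>cyc_field_ring \<zeta>\<^esub> y = x + y" for x y
    by (simp_all add: cyc_field_ring_def ring_of_type_algebra_def)
  then show "cyc_field_hom \<zeta> \<sigma>"
    using ring_hom_closed[OF hom] ring_hom_add[OF hom] ring_hom_mult[OF hom] ring_hom_one[OF hom]
    by unfold_locales simp_all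
qed

sublocale \<sigma>_pow: cyc_field_hom \<zeta> "\<sigma> ^^ j" for j
  by (rule \<sigma>.cyc_field_hom_funpow)

lemma sigma_pow_zeta: "(\<sigma> ^^ j) \<zeta> = \<zeta> ^ (u ^ j)"
proof (induction j)
  case (Suc j)
  then show ?case by (simp add: power_mult[symmetric] mult.commute)
qed simp

lemma sigma_pow_cnj:
  assumes "x \<in> K"
  shows "(\<sigma> ^^ j) (cnj x) = cnj ((\<sigma> ^^ j) x)"
proof (rule cyc_field_hom_eqI[OF _ _ _ assms])
  show "cyc_field_hom \<zeta> (\<lambda>x. (\<sigma> ^^ j) (cnj x))"
    by (rule cnj.cyc_field_hom_compose) (rule \<sigma>_pow.cyc_field_hom_axioms)
  show "cyc_field_hom \<zeta> (\<lambda>x. cnj ((\<sigma> ^^ j) x))"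
    by (rule \<sigma>_pow.cyc_field_hom_compose) (rule cnj.cyc_field_hom_axioms)
  show "(\<sigma> ^^ j) (cnj \<zeta>) = cnj ((\<sigma> ^^ j) \<zeta>)"
    by (simp add: cnj_zeta sigma_pow_zeta power_mult[symmetric] mult.commute)
qed

lemma sigma_cnj: "x \<in> K \<Longrightarrow> \<sigma> (cnj x) = cnj (\<sigma> x)"
  using sigma_pow_cnj[of x 1] by simp

lemma bij_betw_u_power: "bij_betw (\<lambda>j. u ^ j mod p) {..<p - 1} {0<..<p}"
  using residue_primroot_is_generator[OF _ primroot_u] prime_p p_ge_3
  by (simp add: totient_prime totatives_prime)

definition Tr :: "complex \<Rightarrow> complex" where
  "Tr x = (\<Sum>j<p - 1. (\<sigma> ^^ j) x)"

lemma Tr_add: "x \<in> K \<Longrightarrow> y \<in> K \<Longrightarrow> Tr (x + y) = Tr x + Tr y"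
  by (simp add: Tr_def sum.distrib)

lemma Tr_uminus: "x \<in> K \<Longrightarrow> Tr (- x) = - Tr x"
  by (simp add: Tr_def sum_negf)

lemma Tr_zeta_power: "Tr (\<zeta> ^ n) = (if p dvd n then of_nat p else 0) - 1"
proof -
  have "Tr (\<zeta> ^ n) = (\<Sum>j<p - 1. \<zeta> ^ (n * (u ^ j mod p)))"
    unfolding Tr_def
  proof (rule sum.cong[OF refl])
    fix j
    have "(\<sigma> ^^ j) (\<zeta> ^ n) = \<zeta> ^ (n * u ^ j)"
      by (simp add: sigma_pow_zeta power_mult[symmetric] mult.commute)
    also have "\<dots> = \<zeta> ^ (n * (u ^ j mod p))"
      by (rule zeta_power_cong) (simp add: cong_def mod_mult_right_eq)
    finally show "(\<sigma> ^^ j) (\<zeta> ^ n) = \<zeta> ^ (n * (u ^ j mod p))" .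
  qed
  also have "\<dots> = (\<Sum>k\<in>{0<..<p}. \<zeta> ^ (n * k))"
    by (rule sum.reindex_bij_betw[OF bij_betw_u_power])
  also have "\<dots> = (\<Sum>k<p. \<zeta> ^ (n * k)) - 1"
  proof -
    have "{..<p} = insert 0 {0<..<p}" using p_ge_3 by auto
    then show ?thesis by simp
  qed
  finally show ?thesis by (simp only: sum_zeta_powers)
qed

text \<open>The coefficient of \<open>\<zeta> ^ j\<close> in the basis \<open>\<zeta>, \<dots>, \<zeta> ^ (p - 1)\<close>, as a difference of traces;
  \<open>\<zeta> ^ (j * (p - 1))\<close> is the inverse of \<open>\<zeta> ^ j\<close>.\<close>

definition coord :: "nat \<Rightarrow> complex \<Rightarrow> complex" where
  "coord j x = (Tr (x * \<zeta> ^ (j * (p - 1))) - Tr x) / of_nat p"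

lemma coord_add: "x \<in> K \<Longrightarrow> y \<in> K \<Longrightarrow> coord j (x + y) = coord j x + coord j y"
  by (simp add: coord_def Tr_add distrib_right add_divide_distrib diff_divide_distrib)

lemma coord_uminus: "x \<in> K \<Longrightarrow> coord j (- x) = - coord j x"
  by (simp add: coord_def Tr_uminus diff_divide_distrib)

lemma coord_of_nat_mult: "x \<in> K \<Longrightarrow> coord j (of_nat n * x) = of_nat n * coord j x"
  by (induction n) (simp_all add: coord_add distrib_right, simp add: coord_def Tr_def)

lemma coord_zeta_power:
  "coord j (\<zeta> ^ n) = (if [n = j] (mod p) then 1 else 0) - (if p dvd n then 1 else 0)"
proof -
  have "p dvd n + j * (p - 1) \<longleftrightarrow> [n = j] (mod p)"
  proof -
    have "[n + j * (p - 1) + j = n] (mod p)"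
    proof -
      have "n + j * (p - 1) + j = n + j * p" using p_ge_3 by (cases p) simp_all
      then show ?thesis unfolding cong_def by (simp only: mod_mult_self1)
    qed
    then have "[n = j] (mod p) \<longleftrightarrow> [n + j * (p - 1) + j = 0 + j] (mod p)"
      by (metis add_0 cong_sym cong_trans)
    also have "\<dots> \<longleftrightarrow> p dvd n + j * (p - 1)"
      unfolding cong_add_rcancel_nat by (simp add: cong_0_iff)
    finally show ?thesis by simp
  qed
  moreover have "\<zeta> ^ n * \<zeta> ^ (j * (p - 1)) = \<zeta> ^ (n + j * (p - 1))"
    by (simp only: power_add)
  moreover have "(of_nat p :: complex) \<noteq> 0" using p_ge_3 by simp
  ultimately show ?thesis by (simp add: coord_def Tr_zeta_power)
qed

lemma coord_Ints:
  assumes "x \<in> O\<^sub>K"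
  shows "coord j x \<in> \<int>"
  using assms
proof (induction rule: cyc_int_induct)
  case (power k)
  then show ?case by (simp add: coord_zeta_power)
qed (simp_all add: coord_add coord_uminus)

lemma zeta_basis:
  assumes "x \<in> O\<^sub>K"
  shows "x = (\<Sum>j\<in>{0<..<p}. coord j x * \<zeta> ^ j)"
  using assms
proof (induction rule: cyc_int_induct)
  case (power k)
  show ?case
  proof (cases "p dvd k")
    case True
    \<comment> \<open>Here \<open>\<zeta> ^ k\<close> is 1, whose coordinates in a basis that starts
      with \<open>\<zeta>\<close> are all \<open>- 1\<close>.\<close>
    have "(\<Sum>j\<in>{0<..<p}. coord j (\<zeta> ^ k) * \<zeta> ^ j) = (\<Sum>j\<in>{0<..<p}. - (\<zeta> ^ j))"
    proof (rule sum.cong[OF refl])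
      fix j assume "j \<in> {0<..<p}"
      then have "\<not> [k = j] (mod p)" using True by (auto simp: cong_def)
      then show "coord j (\<zeta> ^ k) * \<zeta> ^ j = - (\<zeta> ^ j)"
        using True by (simp add: coord_zeta_power)
    qed
    also have "\<dots> = 1"
    proof -
      have "{..<p} = insert 0 {0<..<p}" using p_ge_3 by auto
      then show ?thesis using sum_zeta_powers[of 1] p_ge_3
        by (simp add: sum_negf add_eq_0_iff)
    qed
    finally show ?thesis using True by (simp add: zeta_power_eq_1_iff)
  next
    case False
    have "(\<Sum>j\<in>{0<..<p}. coord j (\<zeta> ^ k) * \<zeta> ^ j) = (\<Sum>j\<in>{0<..<p}. if j = k mod p then \<zeta> ^ j else 0)"
    proof (rule sum.cong[OF refl])
      fix j assume "j \<in> {0<..<p}"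
      then have "[k = j] (mod p) \<longleftrightarrow> j = k mod p" by (auto simp: cong_def)
      then show "coord j (\<zeta> ^ k) * \<zeta> ^ j = (if j = k mod p then \<zeta> ^ j else 0)"
        using False by (simp add: coord_zeta_power)
    qed
    also have "\<dots> = \<zeta> ^ (k mod p)"
      using False p_ge_3 by (simp add: mod_greater_zero_iff_not_dvd)
    finally show ?thesis by (simp add: zeta_power_mod)
  qed
next
  case (add x y)
  then show ?case by (simp add: coord_add distrib_right sum.distrib)
next
  case (uminus x)
  then show ?case by (simp add: coord_uminus sum_negf)
qed

text \<open>A coordinate is a difference of two traces over \<open>p\<close>, hence involves
  \<open>2 * (p - 1)\<close> conjugates; multiplying by a root of unity does not change their
  moduli. As coordinates are integers on the ring, a small enough bound forces an element to
  vanish.\<close>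

lemma norm_coord_le:
  assumes "x \<in> K" and bound: "\<And>i. cmod ((\<sigma> ^^ i) x) \<le> M"
  shows "cmod (coord j x) \<le> 2 * real (p - 1) * M / real p"
proof -
  have Tr: "cmod (Tr y) \<le> real (p - 1) * M" if "\<And>i. cmod ((\<sigma> ^^ i) y) \<le> M" for y
    unfolding Tr_def using sum_norm_bound[of "{..<p - 1}" "\<lambda>i. (\<sigma> ^^ i) y" M] that by simp
  have "cmod (Tr (x * \<zeta> ^ (j * (p - 1)))) \<le> real (p - 1) * M"
    using assms by (intro Tr) (simp add: norm_mult norm_power sigma_pow_zeta)
  then have "cmod (Tr (x * \<zeta> ^ (j * (p - 1))) - Tr x) \<le> real (p - 1) * M + real (p - 1) * M"
    using norm_triangle_ineq4[of "Tr (x * \<zeta> ^ (j * (p - 1)))" "Tr x"] Tr[OF bound] by linarith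
  then have "cmod (Tr (x * \<zeta> ^ (j * (p - 1))) - Tr x) / real p \<le> 2 * real (p - 1) * M / real p"
    by (intro divide_right_mono) (simp_all add: mult_ac)
  then show ?thesis by (simp add: coord_def norm_divide)
qed

lemma cyc_int_eq_0I:
  assumes "x \<in> O\<^sub>K" "\<And>j. cmod (coord j x) < 1"
  shows "x = 0"
proof -
  have "coord j x = 0" for j
    using coord_Ints[OF assms(1), of j] assms(2)[of j] by (auto elim!: Ints_cases)
  then show ?thesis using zeta_basis[OF assms(1)] by simp
qed

subsection \<open>The prime above $p$ and Frobenius congruences\<close>

text \<open>Otherwise Bezout makes \<open>\<pi>\<close> a unit, and then \<open>p\<close> as well,
  because \<open>\<pi> ^ (p - 1)\<close> is a multiple of \<open>p\<close>. The coordinates of 1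
  forbid this: they are \<open>- 1\<close>, whereas those of a multiple of \<open>p\<close> are
  multiples of \<open>p\<close>.\<close>

lemma int_mem_pi_imp_dvd:
  assumes "of_int n = \<pi> * e" "e \<in> O\<^sub>K"
  shows "int p dvd n"
proof (rule ccontr)
  assume "\<not> int p dvd n"
  then have "coprime n (int p)"
    using prime_p prime_imp_coprime[of "int p" n] by (simp add: coprime_commute)
  then obtain a b where "a * n + b * int p = 1"
    using bezout_int[of n "int p"] by (auto simp: coprime_iff_gcd_eq_1)
  then have "(1::complex) = of_int (a * n + b * int p)" by simp
  also have "\<dots> = of_int a * (\<pi> * e) + of_int b * of_nat p"
    using assms(1) by simp
  also obtain w where w: "w \<in> O\<^sub>K" "of_nat p = \<pi> ^ (p - 1) * w"
    using p_dvd_pi_power by blast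
  have "\<pi> ^ (p - 1) = \<pi> * \<pi> ^ (p - 2)"
    using p_ge_3 by (simp flip: power_Suc add: Suc_diff_Suc numeral_2_eq_2)
  then have "of_int a * (\<pi> * e) + of_int b * of_nat p = \<pi> * (of_int a * e + of_int b * \<pi> ^ (p - 2) * w)"
    unfolding w(2) by (simp add: algebra_simps)
  finally have 1: "\<pi> * (of_int a * e + of_int b * \<pi> ^ (p - 2) * w) = 1" by simp
  define f where "f = of_int a * e + of_int b * \<pi> ^ (p - 2) * w"
  have f: "f \<in> O\<^sub>K" using assms w by (simp add: f_def)
  obtain v where v: "v \<in> O\<^sub>K" "\<pi> ^ (p - 1) = of_nat p * v"
    using pi_power_dvd_p by blast
  have "(\<pi> * f) ^ (p - 1) = 1" using 1 by (simp add: f_def)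
  then have "of_nat p * (v * f ^ (p - 1)) = 1"
    using v by (simp add: power_mult_distrib mult.assoc)
  then have "coord 1 (of_nat p * (v * f ^ (p - 1))) = coord 1 (\<zeta> ^ 0)" by simp
  then have eq: "of_nat p * coord 1 (v * f ^ (p - 1)) = -1"
    using v f p_ge_3 unfolding coord_zeta_power by (simp add: coord_of_nat_mult cong_def)
  obtain c where "coord 1 (v * f ^ (p - 1)) = of_int c"
    using coord_Ints[of "v * f ^ (p - 1)" 1] v f by (auto elim: Ints_cases)
  with eq have "complex_of_int (int p * c) = of_int (-1)" by simp
  then have "int p * c = -1" unfolding of_int_eq_iff .
  then have "int p dvd 1" by (metis dvd_minus_iff dvd_triv_left)
  then show False using p_ge_3 by simp
qed

lemma dvd_imp_int_mem_pi:
  assumes "int p dvd n"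
  shows "\<exists>e\<in>O\<^sub>K. of_int n = \<pi> * e"
proof -
  obtain m where m: "n = int p * m" using assms by blast
  obtain w where w: "w \<in> O\<^sub>K" "of_nat p = \<pi> ^ (p - 1) * w"
    using p_dvd_pi_power by blast
  have "\<pi> ^ (p - 1) = \<pi> * \<pi> ^ (p - 2)"
    using p_ge_3 by (simp flip: power_Suc add: Suc_diff_Suc numeral_2_eq_2)
  then have "of_int n = \<pi> * (\<pi> ^ (p - 2) * w * of_int m)" using w m by simp
  then show ?thesis using w by (intro bexI[of _ "\<pi> ^ (p - 2) * w * of_int m"]) simp_all
qed

text \<open>Residues are integers modulo \<open>p\<close>, where Euclid's lemma applies.\<close>

lemma pi_prime:
  assumes "x \<in> O\<^sub>K" "y \<in> O\<^sub>K" "e \<in> O\<^sub>K" "x * y = \<pi> * e"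
  shows "(\<exists>x'\<in>O\<^sub>K. x = \<pi> * x') \<or> (\<exists>y'\<in>O\<^sub>K. y = \<pi> * y')"
proof -
  have lift: "\<exists>x'\<in>O\<^sub>K. x = \<pi> * x'" if "x = of_int n + \<pi> * a" "a \<in> O\<^sub>K" "int p dvd n" for x n a
  proof -
    obtain b where "b \<in> O\<^sub>K" "of_int n = \<pi> * b" using dvd_imp_int_mem_pi[OF \<open>int p dvd n\<close>] by blast
    then show ?thesis using that by (intro bexI[of _ "b + a"]) (simp_all add: distrib_left)
  qed
  obtain n a m b where nm: "x = of_int n + \<pi> * a" "a \<in> O\<^sub>K" "y = of_int m + \<pi> * b" "b \<in> O\<^sub>K"
    using residue_int assms(1,2) by meson
  have "of_int (n * m) = \<pi> * (e - of_int n * b - a * y)"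
    using assms(4) unfolding nm(1,3) by (simp add: algebra_simps)
  then have "int p dvd n * m"
    by (rule int_mem_pi_imp_dvd) (use assms nm in simp)
  then have "int p dvd n \<or> int p dvd m"
    using prime_p by (simp add: prime_dvd_mult_iff)
  then show ?thesis using lift nm by blast
qed

lemma pi_prime_power:
  assumes "x \<in> O\<^sub>K" "e \<in> O\<^sub>K" "x ^ n = \<pi> * e"
  shows "\<exists>x'\<in>O\<^sub>K. x = \<pi> * x'"
  using assms(2,3)
proof (induction n arbitrary: e)
  case 0
  then have "of_int 1 = \<pi> * e" by simp
  from int_mem_pi_imp_dvd[OF this 0(1)] show ?case using p_ge_3 by simp
next
  case (Suc n)
  then show ?case using pi_prime[of x "x ^ n" e] assms(1) by auto
qed

text \<open>If division by \<open>\<pi>\<close> never stopped, \<open>c\<close> would be divisible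
  by \<open>p ^ n\<close> for every \<open>n\<close>, and a nonzero integer coordinate of
  \<open>c\<close> would have modulus at least \<open>p ^ n\<close> for every
  \<open>n\<close>.\<close>

lemma pi_adic_decomposition:
  assumes "c \<in> O\<^sub>K" "c \<noteq> 0"
  shows "\<exists>v c'. c = \<pi> ^ v * c' \<and> c' \<in> O\<^sub>K \<and> \<not> (\<exists>e\<in>O\<^sub>K. c' = \<pi> * e)"
proof (rule ccontr)
  assume contr: "\<not> ?thesis"
  have div: "\<exists>c'\<in>O\<^sub>K. c = \<pi> ^ v * c'" for v
  proof (induction v)
    case 0
    then show ?case using assms by simp
  next
    case (Suc v)
    then obtain c' where c': "c' \<in> O\<^sub>K" "c = \<pi> ^ v * c'" by blast
    then obtain e where "e \<in> O\<^sub>K" "c' = \<pi> * e" using contr by blast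
    then show ?case using c' by (intro bexI[of _ e]) simp_all
  qed
  obtain j where j: "coord j c \<noteq> 0"
    using zeta_basis[OF assms(1)] assms(2) by (metis (no_types, lifting) mult_zero_left sum.neutral)
  obtain n where n: "cmod (coord j c) < real p ^ n"
    using real_arch_pow[of "real p"] p_ge_3 by auto
  obtain y where y: "y \<in> O\<^sub>K" "c = \<pi> ^ ((p - 1) * n) * y" using div by blast
  obtain w where w: "w \<in> O\<^sub>K" "\<pi> ^ (p - 1) = of_nat p * w" using pi_power_dvd_p by blast
  have "c = of_nat (p ^ n) * (w ^ n * y)"
    unfolding y(2) power_mult w(2) power_mult_distrib of_nat_power by (simp only: mult.assoc)
  then have eq: "coord j c = of_nat (p ^ n) * coord j (w ^ n * y)"
    using w y by (simp only: coord_of_nat_mult O_imp_K cyc_int.mult_mem cyc_int.power_mem)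
  obtain k where k: "coord j (w ^ n * y) = of_int k"
    using coord_Ints[of "w ^ n * y" j] w y by (auto elim: Ints_cases)
  have "k \<noteq> 0" using j eq k by auto
  then have "real p ^ n * 1 \<le> real p ^ n * \<bar>real_of_int k\<bar>"
    by (intro mult_left_mono) simp_all
  also have "\<dots> = cmod (coord j c)" unfolding eq k by (simp add: norm_mult norm_power)
  finally show False using n by simp
qed

lemma sigma_pow_period: "x \<in> K \<Longrightarrow> (\<sigma> ^^ (p - 1)) x = x"
proof (rule cyc_field_hom_eqI[of \<zeta> _ "\<lambda>x. x"])
  have "\<not> p dvd u"
    using primroot_u prime_p by (auto simp: residue_primroot_def coprime_commute dest: coprime_common_divisor_nat[of p u p])
  then have "[u ^ (p - 1) = 1] (mod p)"
    using fermat_theorem prime_p by blast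
  then show "(\<sigma> ^^ (p - 1)) \<zeta> = \<zeta>"
    unfolding sigma_pow_zeta using zeta_power_cong[of "u ^ (p - 1)" 1] by simp
  show "cyc_field_hom \<zeta> (\<lambda>x. x)" by unfold_locales simp_all
qed (rule \<sigma>_pow.cyc_field_hom_axioms)

lemma Tr_Ints: "x \<in> O\<^sub>K \<Longrightarrow> Tr x \<in> \<int>"
  by (induction rule: cyc_int_induct) (simp_all add: Tr_zeta_power Tr_add Tr_uminus)

text \<open>The denominator is multiplied by the product of its other conjugates. The norm
  \<open>b * b'\<close> is fixed by \<open>\<sigma>\<close>, so its trace is \<open>p - 1\<close>
  times itself; traces of ring elements are integers, hence so is \<open>(p - 1) * b * b'\<close>,
  and this multiple of the norm serves as the new denominator.\<close>

lemma integer_denominator: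
  assumes "y \<in> K"
  shows "\<exists>x\<in>O\<^sub>K. \<exists>N::nat. N > 0 \<and> of_nat N * y = x"
proof -
  obtain a b where ab: "y = a / b" "a \<in> O\<^sub>K" "b \<in> O\<^sub>K" "b \<noteq> 0"
    using assms unfolding cyc_field_eq_fractions by blast
  define b' where "b' = (\<Prod>j<p - 2. (\<sigma> ^^ Suc j) b)"
  have b': "b' \<in> O\<^sub>K" unfolding b'_def using ab
    by (intro cyc_int.prod_mem) (simp only: \<sigma>_pow.cyc_int_closed)
  have p1: "p - 1 = Suc (p - 2)" using p_ge_3 by simp
  have norm: "b * b' = (\<Prod>j<p - 1. (\<sigma> ^^ j) b)"
    unfolding p1 prod.lessThan_Suc_shift b'_def by simp
  have "\<sigma> (b * b') = b * b'"
  proof -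
    have "\<sigma> (\<Prod>j<n. (\<sigma> ^^ j) b) = (\<Prod>j<n. (\<sigma> ^^ Suc j) b)" for n
      using ab by (induction n) (simp_all add: cyc_int.prod_mem)
    then have "\<sigma> (b * b') = (\<Prod>j<p - 1. (\<sigma> ^^ Suc j) b)" by (simp only: norm)
    also have "\<dots> = b' * (\<sigma> ^^ (p - 1)) b"
      unfolding p1 prod.lessThan_Suc b'_def by simp
    finally show ?thesis using ab sigma_pow_period[of b] by simp
  qed
  then have "(\<sigma> ^^ j) (b * b') = b * b'" for j by (induction j) simp_all
  then have Tr: "Tr (b * b') = of_nat (p - 1) * (b * b')" by (simp add: Tr_def)
  obtain t where t: "Tr (b * b') = of_int t" using Tr_Ints[of "b * b'"] ab b' by (auto elim: Ints_cases)
  have "b' \<noteq> 0" unfolding b'_def using ab \<sigma>_pow.hom_eq_0_iff[of b] by (simp add: prod_zero_iff del: funpow.simps)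
  then have "t \<noteq> 0" using t Tr ab p_ge_3 by auto
  define s where "s = of_nat (p - 1) * (a * b')"
  have "of_int t * y = s"
    using Tr ab unfolding t s_def by (simp add: field_simps)
  then have "of_nat (nat \<bar>t\<bar>) * y = (if t > 0 then s else - s)"
    using \<open>t \<noteq> 0\<close> by (auto simp: abs_if)
  moreover have "(if t > 0 then s else - s) \<in> O\<^sub>K" using ab b' by (simp add: s_def)
  moreover have "nat \<bar>t\<bar> > 0" using \<open>t \<noteq> 0\<close> by simp
  ultimately show ?thesis by blast
qed

lemma frobenius_power:
  assumes "Factorial_Ring.prime l" "x \<in> O\<^sub>K" "y \<in> O\<^sub>K"
  shows "\<exists>e\<in>O\<^sub>K. (x + y) ^ (l ^ n) = x ^ (l ^ n) + y ^ (l ^ n) + of_nat l * e"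
proof (induction n)
  case 0
  show ?case by (intro bexI[of _ 0]) simp_all
next
  case (Suc n)
  then obtain e where e: "e \<in> O\<^sub>K" "(x + y) ^ (l ^ n) = x ^ (l ^ n) + y ^ (l ^ n) + of_nat l * e"
    by blast
  have step: "\<exists>f\<in>O\<^sub>K. (a + b) ^ l = a ^ l + b ^ l + of_nat l * f" if ab: "a \<in> O\<^sub>K" "b \<in> O\<^sub>K" for a b
  proof -
    obtain f where f: "f \<in> O\<^sub>K" "(a + b) ^ l = a ^ l + b ^ l + of_nat l * a * b * (a ^ (l - 2) + b * f)"
      using cyc_int.add_power_prime[OF assms(1) ab] by (elim bexE)
    have "(a + b) ^ l = a ^ l + b ^ l + of_nat l * (a * b * (a ^ (l - 2) + b * f))"
      using f(2) by (simp only: mult.assoc)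
    moreover have "a * b * (a ^ (l - 2) + b * f) \<in> O\<^sub>K" using ab f(1) by simp
    ultimately show ?thesis by (rule bexI)
  qed
  define xn yn where "xn = x ^ (l ^ n)" and "yn = y ^ (l ^ n)"
  have xyn: "xn \<in> O\<^sub>K" "yn \<in> O\<^sub>K" using assms by (simp_all add: xn_def yn_def)
  have S: "a ^ (l ^ Suc n) = (a ^ (l ^ n)) ^ l" for a :: complex
    by (simp only: power_Suc2 power_mult)
  obtain f where f: "f \<in> O\<^sub>K" "(xn + yn + of_nat l * e) ^ l = (xn + yn) ^ l + (of_nat l * e) ^ l + of_nat l * f"
    using step[of "xn + yn" "of_nat l * e"] e(1) xyn by (simp only: cyc_int.add_mem cyc_int.mult_mem cyc_int.of_nat_mem) blast
  obtain g where g: "g \<in> O\<^sub>K" "(xn + yn) ^ l = xn ^ l + yn ^ l + of_nat l * g"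
    using step[OF xyn] by blast
  obtain k where k: "l = Suc k" using prime_gt_0_nat[OF assms(1)] gr0_implies_Suc by blast
  have "(of_nat l * e) ^ l = of_nat l * (e * (of_nat l * e) ^ k)"
    using power_Suc[of "of_nat l * e" k, folded k] by (simp only: mult.assoc)
  then have "(x + y) ^ (l ^ Suc n) =
      x ^ (l ^ Suc n) + y ^ (l ^ Suc n) + of_nat l * (g + e * (of_nat l * e) ^ k + f)"
    unfolding S e(2) xn_def[symmetric] yn_def[symmetric] f(2) g(2) by (simp only: distrib_left add_ac)
  moreover have "g + e * (of_nat l * e) ^ k + f \<in> O\<^sub>K" using e(1) f(1) g(1) by simp
  ultimately show ?case by (rule bexI)
qed

text \<open>Frobenius is additive modulo \<open>l\<close>, so powers of \<open>\<zeta>\<close>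
  decide, and they are fixed because \<open>l ^ n\<close> is 1 modulo \<open>p\<close>.\<close>

lemma power_eq_self_mod_prime:
  assumes l: "Factorial_Ring.prime l" "[l ^ n = 1] (mod p)" and x: "x \<in> O\<^sub>K"
  shows "\<exists>e\<in>O\<^sub>K. x ^ (l ^ n) = x + of_nat l * e"
  using x
proof (induction rule: cyc_int_induct)
  case (power k)
  have "[k * l ^ n = k * 1] (mod p)" using l(2) by (rule cong_scalar_left)
  then have "(\<zeta> ^ k) ^ (l ^ n) = \<zeta> ^ k"
    unfolding power_mult[symmetric] using zeta_power_cong by fastforce
  then show ?case by (intro bexI[of _ 0]) simp_all
next
  case (add x y)
  then obtain a b where ab: "x ^ (l ^ n) = x + of_nat l * a" "y ^ (l ^ n) = y + of_nat l * b"
    "a \<in> O\<^sub>K" "b \<in> O\<^sub>K" by blast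
  obtain e where e: "e \<in> O\<^sub>K" "(x + y) ^ (l ^ n) = x ^ (l ^ n) + y ^ (l ^ n) + of_nat l * e"
    using frobenius_power[OF l(1) add(1,2)] by blast
  have "(x + y) ^ (l ^ n) = (x + y) + of_nat l * (a + b + e)"
    unfolding e(2) ab(1,2) by (simp only: distrib_left add_ac)
  moreover have "a + b + e \<in> O\<^sub>K" using ab e by simp
  ultimately show ?case by (rule bexI)
next
  case (uminus x)
  then obtain a where a: "x ^ (l ^ n) = x + of_nat l * a" "a \<in> O\<^sub>K" by blast
  \<comment> \<open>Additivity applied to \<open>x\<close> and \<open>- x\<close> treats negation
    uniformly, with no separate discussion of signs for \<open>l = 2\<close>.\<close>
  obtain e where e: "e \<in> O\<^sub>K" "(x + - x) ^ (l ^ n) = x ^ (l ^ n) + (- x) ^ (l ^ n) + of_nat l * e"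
    using frobenius_power[OF l(1), of x "- x"] uminus by auto
  have "(x + - x) ^ (l ^ n) = 0" using prime_gt_0_nat[OF l(1)] by simp
  then have 0: "x + of_nat l * a + (- x) ^ (l ^ n) + of_nat l * e = 0"
    unfolding e(2) a(1) .
  have "(- x) ^ (l ^ n) = (x + of_nat l * a + (- x) ^ (l ^ n) + of_nat l * e) - x - of_nat l * a - of_nat l * e"
    by simp
  then have "(- x) ^ (l ^ n) = - x + of_nat l * (- a - e)"
    unfolding 0 by (simp add: right_diff_distrib)
  moreover have "- a - e \<in> O\<^sub>K" using a e by simp
  ultimately show ?case by (rule bexI)
qed

subsection \<open>Roots in $\mathbb{Z}[\zeta]$\<close>

text \<open>For a prime \<open>l \<noteq> p\<close> the ring modulo \<open>l\<close> is reduced, since \<open>x ^ (l ^ (p - 1))\<close> is congruent to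
  \<open>x\<close>. Modulo \<open>p\<close> it is not, which is why the hypothesis has \<open>l ^ p\<close> and not just \<open>l\<close>.\<close>

lemma prime_dvd_of_power_dvd:
  assumes l: "Factorial_Ring.prime l" and x: "x \<in> O\<^sub>K" "v \<in> O\<^sub>K" and eq: "x ^ p = of_nat l ^ p * v"
  shows "\<exists>w\<in>O\<^sub>K. x = of_nat l * w"
proof (cases "l = p")
  case False
  have "\<not> l dvd p" "\<not> p dvd l" using l prime_p False primes_dvd_imp_eq by blast+
  then have "[l ^ (p - 1) = 1] (mod p)" using fermat_theorem prime_p by blast
  then obtain e where e: "e \<in> O\<^sub>K" "x ^ (l ^ (p - 1)) = x + of_nat l * e"
    using power_eq_self_mod_prime[OF l _ x(1)] by blast
  \<comment> \<open>The exponent \<open>l ^ (p - 1)\<close> must reach \<open>p\<close>, so that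
    \<open>x ^ p\<close>, which is known to be divisible by \<open>l\<close>, splits off.\<close>
  have "p \<le> 2 ^ (p - 1)"
    using p_ge_3 less_exp[of "p - 1"] by linarith
  also have "\<dots> \<le> l ^ (p - 1)" using prime_ge_2_nat[OF l] by (rule power_mono) simp
  finally have "l ^ (p - 1) = p + (l ^ (p - 1) - p)" by simp
  then have "x ^ (l ^ (p - 1)) = x ^ p * x ^ (l ^ (p - 1) - p)"
    by (metis power_add)
  also obtain k where k: "p = Suc k" using p_ge_3 by (cases p) simp_all
  have "of_nat l ^ p = (of_nat l :: complex) * of_nat l ^ k" unfolding k by simp
  then have "x ^ p * x ^ (l ^ (p - 1) - p) = of_nat l * (of_nat l ^ k * v * x ^ (l ^ (p - 1) - p))"
    unfolding eq by (simp only: mult.assoc)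
  finally have "x + of_nat l * e = of_nat l * (of_nat l ^ k * v * x ^ (l ^ (p - 1) - p))"
    unfolding e(2) .
  then have "x = of_nat l * (of_nat l ^ k * v * x ^ (l ^ (p - 1) - p) - e)"
    unfolding right_diff_distrib by (simp only: eq_diff_eq)
  moreover have "of_nat l ^ k * v * x ^ (l ^ (p - 1) - p) - e \<in> O\<^sub>K" using x e(1) by simp
  ultimately show ?thesis by (rule bexI)
next
  case True
  obtain w where w: "w \<in> O\<^sub>K" "of_nat p = \<pi> ^ (p - 1) * w" using p_dvd_pi_power by blast
  \<comment> \<open>Factors \<open>\<pi>\<close> are extracted one at a time: as long as
    \<open>k < p - 1\<close>, cancelling \<open>(\<pi> ^ k) ^ p\<close> leaves a factor
    \<open>\<pi>\<close> in \<open>y ^ p\<close>, and primality passes it on to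
    \<open>y\<close>.\<close>
  have "\<exists>y\<in>O\<^sub>K. x = \<pi> ^ k * y" if "k \<le> p - 1" for k
    using that
  proof (induction k)
    case 0
    show ?case using x by simp
  next
    case (Suc k)
    then obtain y where y: "y \<in> O\<^sub>K" "x = \<pi> ^ k * y" by auto
    obtain d where d: "p - 1 = k + Suc d" using Suc.prems by (metis add_Suc_right add_Suc le_Suc_ex)
    have p: "p = Suc (p - 1)" using p_ge_3 by simp
    have "(\<pi> ^ k) ^ p * y ^ p = (\<pi> ^ k) ^ p * ((\<pi> ^ Suc d) ^ p * (w ^ p * v))"
      using eq unfolding y(2) True w(2) d power_add by (simp only: power_mult_distrib mult.assoc)
    then have "y ^ p = (\<pi> ^ Suc d) ^ p * (w ^ p * v)" by simp
    also have "\<dots> = \<pi> * (\<pi> ^ d * (\<pi> ^ Suc d) ^ (p - 1) * (w ^ p * v))"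
      using power_Suc[of "\<pi> ^ Suc d" "p - 1", folded p] by (simp only: power_Suc mult.assoc)
    finally have "\<exists>y'\<in>O\<^sub>K. y = \<pi> * y'"
      using y(1) w(1) x by (intro pi_prime_power) simp_all
    then show ?case unfolding y(2) by (auto simp: mult.assoc)
  qed
  from this[of "p - 1"] obtain y where y: "y \<in> O\<^sub>K" "x = \<pi> ^ (p - 1) * y" by blast
  obtain w' where "w' \<in> O\<^sub>K" "\<pi> ^ (p - 1) = of_nat p * w'" using pi_power_dvd_p by blast
  then have "x = of_nat p * (w' * y)" "w' * y \<in> O\<^sub>K" using y by simp_all
  then show ?thesis unfolding True by (rule bexI)
qed

text \<open>The prime factors of a denominator \<open>N\<close> are cancelled one by one: since
  \<open>y ^ p\<close> is integral, \<open>(N * y) ^ p\<close> is divisible by \<open>l ^ p\<close>,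
  hence \<open>N * y\<close> by \<open>l\<close>.\<close>

lemma p_root_integral:
  assumes "y \<in> K" "y ^ p \<in> O\<^sub>K"
  shows "y \<in> O\<^sub>K"
proof -
  have main: "y \<in> O\<^sub>K" if "N > 0" "of_nat N * y \<in> O\<^sub>K" for N :: nat
    using that
  proof (induction N rule: less_induct)
    case (less N)
    show ?case
    proof (cases "N = 1")
      case True
      then show ?thesis using less by simp
    next
      case False
      then obtain l M where l: "Factorial_Ring.prime l" "N = l * M"
        using prime_factor_nat by (metis dvdE)
      have "(of_nat N * y) ^ p = of_nat l ^ p * (of_nat M ^ p * y ^ p)"
        unfolding l(2) by (simp add: power_mult_distrib mult.assoc)
      then obtain w where w: "w \<in> O\<^sub>K" "of_nat N * y = of_nat l * w"
        using prime_dvd_of_power_dvd[OF l(1) less.prems(2)] assms(2)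
        by (metis cyc_int.mult_mem cyc_int.of_nat_mem cyc_int.power_mem)
      have "of_nat M * y = w"
        using w(2) prime_gt_0_nat[OF l(1)] unfolding l(2) by simp
      moreover have "M < N" "M > 0" using l less.prems prime_gt_1_nat[OF l(1)] by auto
      ultimately show ?thesis using less.IH w(1) by simp
    qed
  qed
  then show ?thesis using integer_denominator[OF assms(1)] by blast
qed

lemma p_root_of_unity:
  assumes "w ^ p = 1"
  shows "\<exists>k. w = \<zeta> ^ k"
proof -
  have inj: "inj_on (\<lambda>k. \<zeta> ^ k) {..<p}"
  proof (rule linorder_inj_onI')
    fix i j assume ij: "i \<in> {..<p}" "j \<in> {..<p}" "i < j"
    show "\<zeta> ^ i \<noteq> \<zeta> ^ j"
    proof
      assume "\<zeta> ^ i = \<zeta> ^ j"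
      also have "\<zeta> ^ j = \<zeta> ^ i * \<zeta> ^ (j - i)" using ij by (simp flip: power_add)
      finally have "p dvd j - i" by (simp add: zeta_power_eq_1_iff[symmetric])
      then show False using ij by (auto dest: dvd_imp_le)
    qed
  qed
  have "(\<lambda>k. \<zeta> ^ k) ` {..<p} = {z. z ^ p = 1}"
  proof (rule card_subset_eq)
    show "finite {z::complex. z ^ p = 1}" using p_ge_3 by (intro finite_roots_unity) simp
    show "(\<lambda>k. \<zeta> ^ k) ` {..<p} \<subseteq> {z. z ^ p = 1}"
      by (auto simp: power_mult[symmetric] zeta_power_eq_1_iff)
    show "card ((\<lambda>k. \<zeta> ^ k) ` {..<p}) = card {z::complex. z ^ p = 1}"
      using p_ge_3 by (simp add: card_image inj card_roots_unity_eq)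
  qed
  then show ?thesis using assms by blast
qed

text \<open>Frobenius with \<open>l = p\<close>: the powers of \<open>\<zeta>\<close> all have
  \<open>p\<close>-th power 1, so an integer is reached modulo \<open>p\<close> and not merely
  modulo \<open>\<pi>\<close>.\<close>

lemma power_p_int_mod_p:
  assumes "x \<in> O\<^sub>K"
  shows "\<exists>a::int. \<exists>w\<in>O\<^sub>K. x ^ p = of_int a + of_nat p * w"
  using assms
proof (induction rule: cyc_int_induct)
  case (power k)
  have "(\<zeta> ^ k) ^ p = of_int 1 + of_nat p * 0"
    by (simp add: power_mult[symmetric] zeta_power_eq_1_iff)
  then show ?case by (meson cyc_int.zero_mem)
next
  case (add x y)
  then obtain a v b w where ab: "x ^ p = of_int a + of_nat p * v" "v \<in> O\<^sub>K"
    "y ^ p = of_int b + of_nat p * w" "w \<in> O\<^sub>K" by blast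
  obtain e where e: "e \<in> O\<^sub>K" "(x + y) ^ (p ^ 1) = x ^ (p ^ 1) + y ^ (p ^ 1) + of_nat p * e"
    using frobenius_power[OF prime_p add(1,2)] by blast
  have "(x + y) ^ p = of_int (a + b) + of_nat p * (v + w + e)"
    using e(2) ab by (simp add: algebra_simps)
  moreover have "v + w + e \<in> O\<^sub>K" using ab e by simp
  ultimately show ?case by blast
next
  case (uminus x)
  then obtain a v where "x ^ p = of_int a + of_nat p * v" "v \<in> O\<^sub>K" by blast
  then have "(- x) ^ p = of_int (- a) + of_nat p * (- v)" "- v \<in> O\<^sub>K"
    using odd_p by simp_all
  then show ?case by blast
qed

text \<open>Instead of Kronecker's lemma: \<open>\<epsilon> ^ p\<close> is congruent to an integer \<open>a\<close> modulo \<open>p\<close>, and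
  \<open>\<epsilon> * cnj \<epsilon> = 1\<close> forces \<open>a\<close> to be \<open>1\<close> or \<open>- 1\<close> modulo \<open>p\<close>. All conjugates of
  \<open>(\<plusminus>\<epsilon> ^ p - 1) / p\<close> have modulus at most \<open>2 / p\<close>, which is too small for a nonzero integer.\<close>

lemma unit_quotient_root_of_unity:
  assumes eps: "\<epsilon> \<in> O\<^sub>K" "\<epsilon> * cnj \<epsilon> = 1"
  shows "\<exists>s k. (s = 1 \<or> s = -1) \<and> \<epsilon> = s * \<zeta> ^ k"
proof -
  have norm1: "cmod ((\<sigma> ^^ i) \<epsilon>) = 1" for i
  proof -
    have "(\<sigma> ^^ i) \<epsilon> * cnj ((\<sigma> ^^ i) \<epsilon>) = (\<sigma> ^^ i) (\<epsilon> * cnj \<epsilon>)"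
      using eps(1) by (simp add: sigma_pow_cnj)
    also have "\<dots> = 1" by (simp only: eps(2) \<sigma>_pow.hom_one)
    finally have "complex_of_real ((cmod ((\<sigma> ^^ i) \<epsilon>))\<^sup>2) = 1"
      by (simp only: complex_norm_square)
    then have "(cmod ((\<sigma> ^^ i) \<epsilon>))\<^sup>2 = 1" by (simp only: of_real_eq_1_iff)
    then show ?thesis using norm_ge_zero[of "(\<sigma> ^^ i) \<epsilon>"] unfolding power2_eq_1_iff by linarith
  qed
  obtain a w where w: "w \<in> O\<^sub>K" "\<epsilon> ^ p = of_int a + of_nat p * w"
    using power_p_int_mod_p[OF eps(1)] by blast
  have "1 = \<epsilon> ^ p * cnj (\<epsilon> ^ p)"
    using eps(2) by (simp flip: power_mult_distrib)
  also have "\<dots> = (of_int a + of_nat p * w) * (of_int a + of_nat p * cnj w)"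
    unfolding w(2) by simp
  finally have "complex_of_int (1 - a * a) = of_nat p * (of_int a * cnj w + w * (of_int a + of_nat p * cnj w))"
    by (simp add: algebra_simps)
  also obtain v where v: "v \<in> O\<^sub>K" "of_int (int p) = \<pi> * v"
    using dvd_imp_int_mem_pi[of "int p"] by auto
  have "of_nat p * (of_int a * cnj w + w * (of_int a + of_nat p * cnj w))
      = \<pi> * (v * (of_int a * cnj w + w * (of_int a + of_nat p * cnj w)))"
    using v(2) by simp
  finally have "int p dvd 1 - a * a"
    by (rule int_mem_pi_imp_dvd) (use v w in simp)
  then have "int p dvd (1 - a) * (1 + a)" by (simp add: algebra_simps)
  then have "int p dvd 1 - a \<or> int p dvd 1 + a"
    using prime_p by (simp add: prime_dvd_mult_iff)
  \<comment> \<open>The sign is moved into \<open>s\<close>, so that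
    \<open>s * \<epsilon> ^ p\<close> is 1 modulo \<open>p\<close>.\<close>
  then obtain s :: int where s: "s = 1 \<or> s = -1" "int p dvd s * a - 1"
    by (metis dvd_minus_iff minus_diff_eq mult_1 mult_minus1 diff_minus_eq_add add.commute uminus_add_conv_diff)
  then obtain t where t: "s * a = 1 + int p * t" by (auto simp: dvd_def algebra_simps)
  define x where "x = of_int t + of_int s * w"
  have x: "x \<in> O\<^sub>K" using w by (simp add: x_def)
  have "of_int s * \<epsilon> ^ p = of_int (s * a) + of_nat p * (of_int s * w)"
    unfolding w(2) by (simp add: algebra_simps)
  then have px: "of_nat p * x = of_int s * \<epsilon> ^ p - 1"
    unfolding t x_def by (simp add: algebra_simps)
  have "x = 0"
  proof -
    have bound: "cmod ((\<sigma> ^^ i) x) \<le> 2 / real p" for i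
    proof -
      have "of_nat p * (\<sigma> ^^ i) x = (\<sigma> ^^ i) (of_int s * \<epsilon> ^ p - 1)"
        unfolding px[symmetric] using x by simp
      also have "\<dots> = of_int s * ((\<sigma> ^^ i) \<epsilon>) ^ p - 1" using eps(1) by simp
      finally have "real p * cmod ((\<sigma> ^^ i) x) = cmod (of_int s * ((\<sigma> ^^ i) \<epsilon>) ^ p - 1)"
        by (metis norm_mult norm_of_nat)
      also have "\<dots> \<le> cmod (of_int s * ((\<sigma> ^^ i) \<epsilon>) ^ p) + cmod 1" by (rule norm_triangle_ineq4)
      also have "\<dots> = 2" using s(1) by (auto simp: norm_mult norm_power norm1)
      finally show ?thesis using p_ge_3 by (simp add: field_simps)
    qed
    have "cmod (coord j x) < 1" for j
    proof -
      have "cmod (coord j x) \<le> 2 * real (p - 1) * (2 / real p) / real p"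
        by (rule norm_coord_le[OF _ bound]) (use x in simp)
      \<comment> \<open>The bound is \<open>4 * (p - 1) / p ^ 2\<close>, strictly below 1 because
        \<open>(p - 2) ^ 2\<close> is positive.\<close>
      also have "\<dots> < 1"
      proof -
        have "4 * real (p - 1) < real p * real p"
        proof -
          have "0 < (real p - 2)\<^sup>2" using p_ge_3 by simp
          then show ?thesis using p_ge_3 by (simp add: of_nat_diff power2_eq_square algebra_simps)
        qed
        then show ?thesis using p_ge_3 by (simp add: divide_simps)
      qed
      finally show ?thesis .
    qed
    then show ?thesis by (rule cyc_int_eq_0I[OF x])
  qed
  then have "of_int s * \<epsilon> ^ p = 1" using px by simp
  \<comment> \<open>For odd \<open>p\<close> the sign passes through the power, so
    \<open>s * \<epsilon>\<close> is itself a \<open>p\<close>-th root of unity.\<close>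
  moreover have "(of_int s * \<epsilon>) ^ p = of_int s * \<epsilon> ^ p"
    using s(1) odd_p by (auto simp: power_mult_distrib)
  ultimately obtain k where k: "of_int s * \<epsilon> = \<zeta> ^ k" using p_root_of_unity by metis
  have "\<epsilon> = of_int s * \<zeta> ^ k" using s(1) unfolding k[symmetric] by auto
  moreover have "of_int s = (1::complex) \<or> of_int s = (-1::complex)" using s(1) by auto
  ultimately show ?thesis by blast
qed

subsection \<open>The local ring at the prime above $p$\<close>

abbreviation R :: "complex set" where "R \<equiv> pi_integral \<zeta>"

lemma mem_pi_ideal_iff: "x \<in> pi_ideal \<zeta> \<longleftrightarrow> (\<exists>e\<in>O\<^sub>K. x = \<pi> * e)"
  by (auto simp: pi_ideal_def principal_def \<pi>_def)

lemma one_notin_pi_ideal: "1 \<notin> pi_ideal \<zeta>"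
proof
  assume "1 \<in> pi_ideal \<zeta>"
  then obtain e where e: "e \<in> O\<^sub>K" "1 = \<pi> * e" unfolding mem_pi_ideal_iff by blast
  then have "of_int 1 = \<pi> * e" by simp
  from int_mem_pi_imp_dvd[OF this e(1)] show False using p_ge_3 by simp
qed

lemma mult_notin_pi_ideal:
  assumes "x \<in> O\<^sub>K - pi_ideal \<zeta>" "y \<in> O\<^sub>K - pi_ideal \<zeta>"
  shows "x * y \<in> O\<^sub>K - pi_ideal \<zeta>"
  using assms pi_prime[of x y] by (auto simp: mem_pi_ideal_iff)

lemma zero_mem_pi_ideal: "0 \<in> pi_ideal \<zeta>"
  unfolding mem_pi_ideal_iff by (rule bexI[of _ 0]) simp_all

lemma R_I: "a \<in> O\<^sub>K \<Longrightarrow> b \<in> O\<^sub>K - pi_ideal \<zeta> \<Longrightarrow> a / b \<in> R"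
  unfolding pi_integral_def by blast

lemma R_E:
  assumes "x \<in> R"
  obtains a b where "x = a / b" "a \<in> O\<^sub>K" "b \<in> O\<^sub>K - pi_ideal \<zeta>" "b \<noteq> 0"
  using assms zero_mem_pi_ideal unfolding pi_integral_def by blast

sublocale R: unital_subring R
proof
  show "1 \<in> R" using R_I[of 1 1] one_notin_pi_ideal by simp
next
  fix x y assume "x \<in> R" "y \<in> R"
  then obtain a b c d where 1: "x = a / b" "a \<in> O\<^sub>K" "b \<in> O\<^sub>K - pi_ideal \<zeta>" "b \<noteq> 0"
      "y = c / d" "c \<in> O\<^sub>K" "d \<in> O\<^sub>K - pi_ideal \<zeta>" "d \<noteq> 0"
    by (elim R_E)
  have "x + y = (a * d + c * b) / (b * d)" using 1 by (simp add: add_frac_eq)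
  then show "x + y \<in> R" using R_I[OF _ mult_notin_pi_ideal[of b d]] 1 by simp
  have "x * y = (a * c) / (b * d)" using 1 by simp
  then show "x * y \<in> R" using R_I[OF _ mult_notin_pi_ideal[of b d]] 1 by simp
next
  fix x assume "x \<in> R"
  then obtain a b where "x = a / b" "a \<in> O\<^sub>K" "b \<in> O\<^sub>K - pi_ideal \<zeta>" by (elim R_E)
  then show "- x \<in> R" using R_I[of "- a" b] by simp
qed

lemma O_imp_R [simp]: "x \<in> O\<^sub>K \<Longrightarrow> x \<in> R"
  using R_I[of x 1] one_notin_pi_ideal by simp

lemma R_imp_K [simp]: "x \<in> R \<Longrightarrow> x \<in> K"
  by (elim R_E) simp

lemma inverse_mem_R: "b \<in> O\<^sub>K - pi_ideal \<zeta> \<Longrightarrow> inverse b \<in> R"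
  using R_I[of 1 b] by (simp add: inverse_eq_divide)

text \<open>This filtration of the local ring stands in for a valuation; \<open>pi_cong_iff\<close>
  translates \<open>pi_cong\<close> into it.\<close>

definition P :: "nat \<Rightarrow> complex set" where "P k = (\<lambda>r. \<pi> ^ k * r) ` R"

lemma P_I: "r \<in> R \<Longrightarrow> \<pi> ^ k * r \<in> P k"
  by (auto simp: P_def)

lemma P_E: assumes "x \<in> P k" obtains r where "r \<in> R" "x = \<pi> ^ k * r"
  using assms by (auto simp: P_def)

lemma P_imp_R: "x \<in> P k \<Longrightarrow> x \<in> R"
  by (elim P_E) simp

lemma P_0 [simp]: "P 0 = R"
  by (auto simp: P_def)

lemma P_add: "x \<in> P k \<Longrightarrow> y \<in> P k \<Longrightarrow> x + y \<in> P k"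
  by (elim P_E) (simp add: P_I flip: distrib_left)

lemma P_uminus: "x \<in> P k \<Longrightarrow> - x \<in> P k"
  by (elim P_E) (simp add: P_I flip: mult_minus_right)

lemma P_diff: "x \<in> P k \<Longrightarrow> y \<in> P k \<Longrightarrow> x - y \<in> P k"
  by (elim P_E) (simp add: P_I flip: right_diff_distrib)

lemma P_zero: "0 \<in> P k"
  using P_I[of 0 k] by simp

lemma P_sum: "(\<And>i. i \<in> I \<Longrightarrow> f i \<in> P k) \<Longrightarrow> sum f I \<in> P k"
  by (induction I rule: infinite_finite_induct) (simp_all add: P_zero P_add)

lemma P_mult: "x \<in> P j \<Longrightarrow> y \<in> P k \<Longrightarrow> x * y \<in> P (j + k)"
proof (elim P_E)
  fix r s assume "r \<in> R" "s \<in> R" "x = \<pi> ^ j * r" "y = \<pi> ^ k * s"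
  then have "x * y = \<pi> ^ (j + k) * (r * s)" by (simp add: power_add)
  then show "x * y \<in> P (j + k)" using \<open>r \<in> R\<close> \<open>s \<in> R\<close> by (simp only: P_I R.mult_mem)
qed

lemma P_mult_R: "x \<in> P k \<Longrightarrow> r \<in> R \<Longrightarrow> x * r \<in> P k"
  using P_mult[of x k r 0] by simp

lemma R_mult_P: "r \<in> R \<Longrightarrow> x \<in> P k \<Longrightarrow> r * x \<in> P k"
  using P_mult[of r 0 x k] by simp

lemma P_mono: "x \<in> P k \<Longrightarrow> j \<le> k \<Longrightarrow> x \<in> P j"
proof (elim P_E)
  fix r assume "j \<le> k" "r \<in> R" "x = \<pi> ^ k * r"
  then have "x = \<pi> ^ j * (\<pi> ^ (k - j) * r)" by (simp flip: power_add mult.assoc)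
  then show "x \<in> P j" using \<open>r \<in> R\<close> by (simp only: P_I R.mult_mem R.power_mem O_imp_R pi_mem)
qed

lemma pi_power_mult_mem_P_iff: "\<pi> ^ j * x \<in> P (j + k) \<longleftrightarrow> x \<in> P k"
proof
  assume "\<pi> ^ j * x \<in> P (j + k)"
  then obtain r where "r \<in> R" "\<pi> ^ j * x = \<pi> ^ (j + k) * r" by (elim P_E)
  then have "\<pi> ^ j * x = \<pi> ^ j * (\<pi> ^ k * r)" by (simp add: power_add)
  then have "x = \<pi> ^ k * r" by simp
  then show "x \<in> P k" using \<open>r \<in> R\<close> by (simp only: P_I)
next
  assume "x \<in> P k"
  then show "\<pi> ^ j * x \<in> P (j + k)"
    using P_mult[of "\<pi> ^ j" j x k] P_I[of 1 j] by simp
qed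

lemma p_mem_P: "of_nat p \<in> P (p - 1)"
proof -
  obtain w where "w \<in> O\<^sub>K" "of_nat p = \<pi> ^ (p - 1) * w" using p_dvd_pi_power by blast
  then show ?thesis by (simp only: P_I O_imp_R)
qed

lemma O_mem_P1_iff: "x \<in> O\<^sub>K \<Longrightarrow> x \<in> P 1 \<longleftrightarrow> x \<in> pi_ideal \<zeta>"
proof
  assume x: "x \<in> O\<^sub>K" "x \<in> P 1"
  then obtain r where "r \<in> R" "x = \<pi> * r" by (elim P_E) simp
  then obtain a b where ab: "x = \<pi> * (a / b)" "a \<in> O\<^sub>K" "b \<in> O\<^sub>K - pi_ideal \<zeta>" "b \<noteq> 0"
    by (elim R_E) blast
  then have "x * b = \<pi> * a" by simp
  then show "x \<in> pi_ideal \<zeta>"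
    using pi_prime[of x b a] x ab by (auto simp: mem_pi_ideal_iff)
next
  assume "x \<in> pi_ideal \<zeta>"
  then show "x \<in> P 1" unfolding mem_pi_ideal_iff using P_I[of _ 1] by auto
qed

lemma int_mem_P1_iff: "of_int n \<in> P 1 \<longleftrightarrow> int p dvd n"
  using O_mem_P1_iff[of "of_int n"] int_mem_pi_imp_dvd dvd_imp_int_mem_pi
  by (auto simp: mem_pi_ideal_iff)

text \<open>Localising does not enlarge the residue field: the denominator has an integer residue
  prime to \<open>p\<close>, which is inverted modulo \<open>p\<close>.\<close>

lemma residue_R:
  assumes "x \<in> R"
  shows "\<exists>n::int. x - of_int n \<in> P 1"
proof -
  obtain a b where ab: "x = a / b" "a \<in> O\<^sub>K" "b \<in> O\<^sub>K - pi_ideal \<zeta>" "b \<noteq> 0"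
    using assms by (elim R_E)
  obtain n e m f where nm: "a = of_int n + \<pi> * e" "b = of_int m + \<pi> * f" "e \<in> O\<^sub>K" "f \<in> O\<^sub>K"
    using residue_int[of a] residue_int[of b] ab by blast
  have "\<not> int p dvd m"
  proof
    assume "int p dvd m"
    then have "of_int m \<in> P 1" by (simp only: int_mem_P1_iff)
    then have "of_int m + \<pi> ^ 1 * f \<in> P 1" using nm by (intro P_add P_I) simp_all
    then have "b \<in> P 1" by (simp only: nm(2) power_one_right)
    then show False using O_mem_P1_iff[of b] ab by simp
  qed
  then have "coprime m (int p)"
    using prime_p prime_imp_coprime[of "int p" m] by (simp add: coprime_commute)
  then obtain m' where "[m * m' = 1] (mod int p)" by (meson cong_solve_coprime_int)
  then have "int p dvd n - n * m' * m"
    unfolding cong_iff_dvd_diff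
    by (metis dvd_mult dvd_minus_iff minus_diff_eq mult.assoc mult.commute mult.right_neutral right_diff_distrib')
  then have "of_int (n - n * m' * m) \<in> P 1" by (simp only: int_mem_P1_iff)
  then have "of_int (n - n * m' * m) + \<pi> ^ 1 * (e - of_int (n * m') * f) \<in> P 1"
    using nm by (intro P_add P_I) simp_all
  then have "(a - of_int (n * m') * b) * inverse b \<in> P 1"
    using ab(3) nm by (intro P_mult_R inverse_mem_R) (simp_all add: algebra_simps)
  moreover have "(a - of_int (n * m') * b) * inverse b = x - of_int (n * m')"
    using ab by (simp add: field_simps)
  ultimately show ?thesis by metis
qed

lemma P1_prime: "x \<in> R \<Longrightarrow> y \<in> R \<Longrightarrow> x * y \<in> P 1 \<Longrightarrow> x \<in> P 1 \<or> y \<in> P 1"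
proof -
  assume x: "x \<in> R" and y: "y \<in> R" and xy: "x * y \<in> P 1"
  obtain n m where nm: "x - of_int n \<in> P 1" "y - of_int m \<in> P 1" using residue_R x y by meson
  have "x * y - ((x - of_int n) * y + of_int n * (y - of_int m)) \<in> P 1"
    by (intro P_diff P_add P_mult_R R_mult_P xy nm y) simp
  then have "of_int (n * m) \<in> P 1" by (simp add: algebra_simps)
  then have "int p dvd n \<or> int p dvd m"
    using prime_p unfolding int_mem_P1_iff by (simp add: prime_dvd_mult_iff)
  then show ?thesis
    using P_add[OF nm(1), of "of_int n"] P_add[OF nm(2), of "of_int m"]
    unfolding int_mem_P1_iff[symmetric] by auto
qed

lemma P_power_diff:
  assumes "x \<in> R" "y \<in> R" "x - y \<in> P k"
  shows "x ^ n - y ^ n \<in> P k"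
proof (induction n)
  case (Suc n)
  have "x ^ Suc n - y ^ Suc n = (x - y) * x ^ n + y * (x ^ n - y ^ n)"
    by (simp add: algebra_simps)
  then show ?case
    using Suc assms by (simp only: P_add P_mult_R R_mult_P R.power_mem)
qed (simp add: P_zero)

text \<open>With \<open>t = x - s\<close>, both \<open>t ^ p\<close> and the mixed terms, which
  contain \<open>p * t\<close>, lie in \<open>P p\<close>. A factor known only up to first order
  thus has a \<open>p\<close>-th power known up to order \<open>p\<close>.\<close>

lemma P_power_p:
  assumes "s \<in> R" "x - s \<in> P 1"
  shows "x ^ p - s ^ p \<in> P p"
proof -
  define t where "t = x - s"
  have t: "t \<in> P 1" "t \<in> R" using assms P_imp_R by (simp_all add: t_def)
  obtain e where e: "e \<in> R" "(s + t) ^ p = s ^ p + t ^ p + of_nat p * s * t * (s ^ (p - 2) + t * e)"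
    using R.add_power_prime[OF prime_p assms(1) t(2)] by blast
  have "t ^ n \<in> P n" for n
    using P_mult[OF t(1)] by (induction n) simp_all
  moreover have "of_nat p * t * (s * (s ^ (p - 2) + t * e)) \<in> P (p - 1 + 1)"
    by (intro P_mult_R P_mult p_mem_P t(1)) (use e t assms in simp)
  ultimately have "t ^ p + of_nat p * t * (s * (s ^ (p - 2) + t * e)) \<in> P p"
    using p_ge_3 by (intro P_add) simp_all
  moreover have "x ^ p - s ^ p = t ^ p + of_nat p * t * (s * (s ^ (p - 2) + t * e))"
    using e(2) by (simp add: t_def mult_ac)
  ultimately show ?thesis by simp
qed

text \<open>One \<open>\<pi>\<close>-adic digit is read off at a time, each of them an integer. This
  carries results proved through integer coordinates, which belong to the ring, over to the
  localisation.\<close>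

lemma O_approximates_R:
  assumes "x \<in> R"
  shows "\<exists>y\<in>O\<^sub>K. x - y \<in> P k"
  using assms
proof (induction k arbitrary: x)
  case 0
  then show ?case by (intro bexI[of _ 0]) simp_all
next
  case (Suc k)
  obtain n where "x - of_int n \<in> P 1" using residue_R Suc.prems by blast
  then obtain r where r: "r \<in> R" "x - of_int n = \<pi> * r" by (elim P_E) simp
  obtain y where y: "y \<in> O\<^sub>K" "r - y \<in> P k" using Suc.IH r by blast
  have "\<pi> ^ 1 * (r - y) \<in> P (1 + k)" using y(2) unfolding pi_power_mult_mem_P_iff .
  moreover have "x - (of_int n + \<pi> * y) = \<pi> ^ 1 * (r - y)"
    using r(2) by (simp add: right_diff_distrib diff_diff_eq[symmetric])
  ultimately have "x - (of_int n + \<pi> * y) \<in> P (Suc k)" by simp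
  moreover have "of_int n + \<pi> * y \<in> O\<^sub>K" using y by simp
  ultimately show ?case by blast
qed

end

section \<open>Automorphisms acting on the \<pi>-adic filtration\<close>

locale cyclotomic_auto = cyclotomic_galois + f: cyc_field_hom \<zeta> f for f +
  fixes k :: nat
  assumes f_zeta: "f \<zeta> = \<zeta> ^ k"
begin

lemma f_pi: "\<exists>e\<in>O\<^sub>K. f \<pi> = \<pi> * (of_nat k + \<pi> * e)"
  using pi_dvd_1_minus_zeta_power[of k] f_zeta by (auto simp: \<pi>_def)

lemma f_pi_ideal: "x \<in> O\<^sub>K \<Longrightarrow> f x - x \<in> pi_ideal \<zeta>"
proof -
  assume x: "x \<in> O\<^sub>K"
  obtain n e where e: "x = of_int n + \<pi> * e" "e \<in> O\<^sub>K" using residue_int[OF x] by blast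
  obtain e' where e': "e' \<in> O\<^sub>K" "f \<pi> = \<pi> * (of_nat k + \<pi> * e')" using f_pi by blast
  have "f x - x = \<pi> * ((of_nat k + \<pi> * e') * f e - e)"
    using e e' by (simp add: algebra_simps)
  then show ?thesis unfolding mem_pi_ideal_iff
    using e e' by (intro bexI[of _ "(of_nat k + \<pi> * e') * f e - e"]) simp_all
qed

lemma f_notin_pi_ideal: "x \<in> O\<^sub>K - pi_ideal \<zeta> \<Longrightarrow> f x \<in> O\<^sub>K - pi_ideal \<zeta>"
proof -
  assume x: "x \<in> O\<^sub>K - pi_ideal \<zeta>"
  then have "f x - x \<in> P 1" using f_pi_ideal[of x] O_mem_P1_iff[of "f x - x"] by simp
  then have "f x \<in> P 1 \<Longrightarrow> x \<in> P 1" using P_diff[of "f x" 1 "f x - x"] by simp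
  then show ?thesis using x O_mem_P1_iff[of x] O_mem_P1_iff[of "f x"] by auto
qed

lemma f_R: "x \<in> R \<Longrightarrow> f x \<in> R"
proof (elim R_E)
  fix a b assume "x = a / b" "a \<in> O\<^sub>K" "b \<in> O\<^sub>K - pi_ideal \<zeta>"
  then show "f x \<in> R" using R_I[of "f a" "f b"] f_notin_pi_ideal[of b] by simp
qed

lemma f_P: "x \<in> P j \<Longrightarrow> f x \<in> P j"
proof (elim P_E)
  fix r assume r: "r \<in> R" "x = \<pi> ^ j * r"
  obtain e where e: "e \<in> O\<^sub>K" "f \<pi> = \<pi> * (of_nat k + \<pi> * e)" using f_pi by blast
  have "f x = \<pi> ^ j * ((of_nat k + \<pi> * e) ^ j * f r)"
    using r by (simp add: e(2) power_mult_distrib[symmetric] mult.assoc[symmetric])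
  moreover have "(of_nat k + \<pi> * e) ^ j * f r \<in> R" using r(1) e(1) f_R by simp
  ultimately show "f x \<in> P j" by (simp only: P_I)
qed

lemma f_residue: "x \<in> R \<Longrightarrow> f x - x \<in> P 1"
proof -
  assume x: "x \<in> R"
  obtain n where n: "x - of_int n \<in> P 1" using residue_R[OF x] by blast
  have "f (x - of_int n) - (x - of_int n) \<in> P 1" using P_diff[OF f_P[OF n] n] .
  then show ?thesis using x by simp
qed

text \<open>On the quotient of \<open>P j\<close> by \<open>P (j + 1)\<close> the map is
  multiplication by \<open>k ^ j\<close>: each of the \<open>j\<close> factors \<open>\<pi>\<close>
  contributes \<open>k\<close>, and the residue of \<open>r\<close> is fixed, being that of an
  integer.\<close>

lemma f_leading_term:
  assumes "r \<in> R"
  shows "\<exists>w\<in>R. f (\<pi> ^ j * r) = \<pi> ^ j * w \<and> w - of_nat k ^ j * r \<in> P 1"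
proof -
  obtain e where e: "e \<in> O\<^sub>K" "f \<pi> = \<pi> * (of_nat k + \<pi> * e)" using f_pi by blast
  define g where "g = of_nat k + \<pi> * e"
  have g: "g \<in> R" "g - of_nat k \<in> P 1" using e P_I[of e 1] by (simp_all add: g_def)
  have "f (\<pi> ^ j * r) = \<pi> ^ j * (g ^ j * f r)"
    using assms by (simp add: e(2) g_def power_mult_distrib[symmetric] mult.assoc[symmetric])
  moreover have "(g ^ j - of_nat k ^ j) * f r + of_nat k ^ j * (f r - r) \<in> P 1"
    by (intro P_add P_mult_R R_mult_P P_power_diff f_residue f_R g assms) simp_all
  then have "g ^ j * f r - of_nat k ^ j * r \<in> P 1" by (simp add: algebra_simps)
  moreover have "g ^ j * f r \<in> R" using g f_R assms by simp
  ultimately show ?thesis by blast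
qed

end

context cyclotomic_galois
begin

sublocale \<sigma>': cyclotomic_auto p \<zeta> u \<sigma> \<sigma> u
  by unfold_locales simp

sublocale cnj': cyclotomic_auto p \<zeta> u \<sigma> cnj "p - 1"
  by unfold_locales (simp add: cnj_zeta)

subsection \<open>Eigenvectors of $\sigma$ modulo $p$\<close>

lemma sigma_pow_P: "x \<in> P k \<Longrightarrow> (\<sigma> ^^ i) x \<in> P k"
  by (induction i) (simp_all add: \<sigma>'.f_P)

lemma sigma_pow_R: "x \<in> R \<Longrightarrow> (\<sigma> ^^ i) x \<in> R"
  using sigma_pow_P[of x 0] by simp

lemma int_mem_P_if_dvd:
  assumes "int p dvd n"
  shows "of_int n \<in> P (p - 1)"
proof -
  obtain k where "n = int p * k" using assms by (rule dvdE)
  then have "of_int n = (of_nat p * of_int k :: complex)" by simp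
  moreover have "of_nat p * of_int k \<in> P (p - 1)" by (intro P_mult_R p_mem_P) simp
  ultimately show ?thesis by simp
qed

lemma not_p_dvd_u: "\<not> p dvd u"
  using primroot_u prime_p
  by (auto simp: residue_primroot_def coprime_commute dest: coprime_common_divisor_nat[of p u p])

lemma cong_u_power_imp_eq:
  assumes "[u ^ i = u ^ j] (mod p)" "0 < i" "i < p - 1" "0 < j" "j < p"
  shows "i = j"
proof -
  have "coprime p u" "ord p u = p - 1"
    using primroot_u prime_p by (simp_all add: residue_primroot_def totient_prime)
  then have "[i = j] (mod p - 1)"
    using assms(1) order_divides_expdiff[of p u i j] by simp
  moreover have "j < p - 1 \<or> j = p - 1" using assms by linarith
  ultimately show ?thesis using assms by (auto simp: cong_def)
qed

text \<open>If the leading term of \<open>D\<close> is \<open>d * \<pi> ^ j\<close>, that of \<open>\<sigma> D\<close> is \<open>d * u ^ j * \<pi> ^ j\<close>, because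
  \<open>\<sigma> \<pi>\<close> is \<open>u * \<pi>\<close> to first order.\<close>

lemma eigen_coefficient_vanishes:
  assumes "D \<in> P j" "0 < j" "j < p" and eig: "\<sigma> D - of_nat \<mu> * D \<in> P (j + 1)"
    and \<mu>: "\<mu> = u ^ i mod p" "0 < i" "i < p - 1" "i \<noteq> j"
  shows "D \<in> P (j + 1)"
proof -
  obtain r where r: "r \<in> R" "D = \<pi> ^ j * r" using assms(1) by (elim P_E)
  obtain w where w: "w \<in> R" "\<sigma> D = \<pi> ^ j * w" "w - of_nat u ^ j * r \<in> P 1"
    using \<sigma>'.f_leading_term[OF r(1)] r(2) by blast
  have "\<sigma> D - of_nat \<mu> * D = \<pi> ^ j * (w - of_nat \<mu> * r)"
    by (subst w(2), subst r(2)) (simp add: right_diff_distrib)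
  with eig have "\<pi> ^ j * (w - of_nat \<mu> * r) \<in> P (j + 1)" by (simp only:)
  then have "w - of_nat \<mu> * r \<in> P 1" unfolding pi_power_mult_mem_P_iff .
  from P_diff[OF this w(3)] have "(of_nat u ^ j - of_nat \<mu>) * r \<in> P 1"
    by (simp add: algebra_simps)
  then consider "of_nat u ^ j - of_nat \<mu> \<in> P 1" | "r \<in> P 1"
    using P1_prime[of "of_nat u ^ j - of_nat \<mu>" r] r by auto
  then show ?thesis
  proof cases
    case 1
    then have "of_int (int (u ^ j) - int \<mu>) \<in> P 1" by simp
    then have "int p dvd int (u ^ j) - int \<mu>" by (simp only: int_mem_P1_iff)
    then have "[u ^ j = \<mu>] (mod p)"
      by (simp only: cong_iff_dvd_diff flip: cong_int_iff)
    then have "[u ^ i = u ^ j] (mod p)" unfolding \<mu>(1) cong_def by simp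
    then show ?thesis using cong_u_power_imp_eq[of i j] \<mu> assms(2,3) by simp
  next
    case 2
    then show ?thesis unfolding r(2) pi_power_mult_mem_P_iff .
  qed
qed

text \<open>The analogue modulo \<open>p\<close> of a Gauss sum, for the character that sends
  \<open>u\<close> to the inverse of \<open>\<mu>\<close>.\<close>

definition eigen_sum :: "nat \<Rightarrow> complex" where
  "eigen_sum \<mu> = (\<Sum>i = 0..p - 2. \<zeta> ^ upow p u i / of_nat \<mu> ^ i)"

definition eigen_proj :: "nat \<Rightarrow> complex \<Rightarrow> complex" where
  "eigen_proj \<mu> x = (\<Sum>i<p - 1. inverse (of_nat \<mu>) ^ i * (\<sigma> ^^ i) x)"

lemma inverse_of_nat_mem_R:
  assumes "\<not> p dvd \<mu>"
  shows "inverse (of_nat \<mu>) \<in> R"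
proof (rule inverse_mem_R)
  have "\<not> int p dvd int \<mu>" using assms by simp
  then have "of_int (int \<mu>) \<notin> P 1" by (simp only: int_mem_P1_iff not_False_eq_True)
  then show "of_nat \<mu> \<in> O\<^sub>K - pi_ideal \<zeta>"
    using O_mem_P1_iff[of "of_nat \<mu>"] by simp
qed

lemma eigen_proj_zeta: "eigen_proj \<mu> \<zeta> = eigen_sum \<mu>"
proof -
  have "{..<p - 1} = {0..p - 2}" using p_ge_3 by auto
  moreover have "inverse (of_nat \<mu>) ^ i * (\<sigma> ^^ i) \<zeta> = \<zeta> ^ upow p u i / of_nat \<mu> ^ i" for i
    unfolding sigma_pow_zeta upow_def zeta_power_mod divide_inverse power_inverse by (rule mult.commute)
  ultimately show ?thesis unfolding eigen_proj_def eigen_sum_def by simp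
qed

lemma eigen_proj_R: "\<not> p dvd \<mu> \<Longrightarrow> x \<in> R \<Longrightarrow> eigen_proj \<mu> x \<in> R"
  unfolding eigen_proj_def by (intro R.sum_mem R.mult_mem R.power_mem inverse_of_nat_mem_R sigma_pow_R)

lemma eigen_proj_P: "\<not> p dvd \<mu> \<Longrightarrow> x \<in> P k \<Longrightarrow> eigen_proj \<mu> x \<in> P k"
  unfolding eigen_proj_def by (intro P_sum R_mult_P R.power_mem inverse_of_nat_mem_R sigma_pow_P)

lemma eigen_proj_diff: "x \<in> K \<Longrightarrow> y \<in> K \<Longrightarrow> eigen_proj \<mu> (x - y) = eigen_proj \<mu> x - eigen_proj \<mu> y"
  by (simp add: eigen_proj_def right_diff_distrib sum_subtractf)

lemma eigen_proj_of_int_sum: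
  assumes "\<And>j. j \<in> J \<Longrightarrow> x j \<in> K"
  shows "eigen_proj \<mu> (\<Sum>j\<in>J. of_int (c j) * x j) = (\<Sum>j\<in>J. of_int (c j) * eigen_proj \<mu> (x j))"
proof -
  have "(\<sigma> ^^ i) (\<Sum>j\<in>J. of_int (c j) * x j) = (\<Sum>j\<in>J. of_int (c j) * (\<sigma> ^^ i) (x j))" for i
    using assms by (subst \<sigma>_pow.hom_sum) simp_all
  then show ?thesis
    unfolding eigen_proj_def by (simp add: sum_distrib_left mult_ac sum.swap[of _ J])
qed

lemma eigen_sum_R: "\<not> p dvd \<mu> \<Longrightarrow> eigen_sum \<mu> \<in> R"
  unfolding eigen_proj_zeta[symmetric] by (rule eigen_proj_R) simp_all

text \<open>Applying \<open>\<sigma>\<close> shifts the summands and multiplies them by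
  \<open>\<mu>\<close>, so the difference telescopes to two end terms. These agree modulo
  \<open>p\<close> by Fermat's theorem for \<open>\<mu>\<close>.\<close>

lemma sigma_eigen_sum:
  assumes \<mu>: "\<not> p dvd \<mu>"
  shows "\<sigma> (eigen_sum \<mu>) - of_nat \<mu> * eigen_sum \<mu> \<in> P (p - 1)"
proof -
  define v :: complex where "v = inverse (of_nat \<mu>)"
  have v: "of_nat \<mu> * v = 1" "v \<in> R"
    using \<mu> inverse_of_nat_mem_R[OF \<mu>] by (cases "\<mu> = 0", simp_all add: v_def)
  \<comment> \<open>Exponents stay unreduced, unlike in \<open>upow\<close>, so that the shift from
    \<open>f i\<close> to \<open>f (Suc i)\<close> is an exact identity.\<close>
  define f where "f i = v ^ i * \<zeta> ^ (u ^ i)" for i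
  have S: "eigen_sum \<mu> = (\<Sum>i<p - 1. f i)"
    unfolding eigen_proj_zeta[symmetric] eigen_proj_def f_def v_def sigma_pow_zeta ..
  have \<sigma>v: "\<sigma> v = v" by (simp add: v_def)
  have f: "\<sigma> (f i) = of_nat \<mu> * f (Suc i)" for i
  proof -
    have "\<sigma> (f i) = \<sigma> v ^ i * (\<sigma> \<zeta>) ^ (u ^ i)"
      unfolding f_def using v(2) by (simp only: \<sigma>.hom_mult \<sigma>.hom_power R_imp_K R.power_mem
          O_imp_R generator_mem_cyc_int)
    also have "\<dots> = v ^ i * \<zeta> ^ (u ^ Suc i)"
      by (simp only: \<sigma>v sigma_zeta power_mult[symmetric] power_Suc)
    also have "\<dots> = (of_nat \<mu> * v) * (v ^ i * \<zeta> ^ (u ^ Suc i))" by (simp only: v(1) mult_1)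
    finally show ?thesis by (simp only: f_def power_Suc mult.assoc)
  qed
  have fK: "f i \<in> K" for i using v(2) by (simp add: f_def)
  have "\<sigma> (eigen_sum \<mu>) = (\<Sum>i<p - 1. \<sigma> (f i))"
    unfolding S using fK by (rule \<sigma>.hom_sum)
  then have "\<sigma> (eigen_sum \<mu>) - of_nat \<mu> * eigen_sum \<mu> = of_nat \<mu> * (\<Sum>i<p - 1. f (Suc i) - f i)"
    unfolding S f by (simp add: sum_distrib_left sum_subtractf right_diff_distrib)
  also have "(\<Sum>i<p - 1. f (Suc i) - f i) = f (p - 1) - f 0"
    by (rule sum_lessThan_telescope)
  also have "f (p - 1) = v ^ (p - 1) * \<zeta>"
  proof -
    have "[u ^ (p - 1) = 1] (mod p)" using fermat_theorem prime_p not_p_dvd_u by blast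
    then have "\<zeta> ^ (u ^ (p - 1)) = \<zeta> ^ 1" by (rule zeta_power_cong)
    then show ?thesis by (simp add: f_def)
  qed
  also have "v ^ (p - 1) * \<zeta> - f 0 = v ^ (p - 1) * (1 - of_nat \<mu> ^ (p - 1)) * \<zeta>"
  proof -
    have "v ^ (p - 1) * of_nat \<mu> ^ (p - 1) = 1"
      using v(1) by (simp only: power_mult_distrib[symmetric] mult.commute[of v] power_one)
    then show ?thesis
      by (simp only: f_def left_diff_distrib right_diff_distrib mult_1 mult_1_right power_0 power_one_right)
  qed
  finally have eq: "\<sigma> (eigen_sum \<mu>) - of_nat \<mu> * eigen_sum \<mu>
      = of_nat \<mu> * (v ^ (p - 1) * (1 - of_nat \<mu> ^ (p - 1)) * \<zeta>)" .
  have "[\<mu> ^ (p - 1) = 1] (mod p)" using fermat_theorem prime_p \<mu> by blast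
  then have "int p dvd 1 - int \<mu> ^ (p - 1)"
    by (metis cong_iff_dvd_diff cong_int_iff cong_sym of_nat_1 of_nat_power)
  then have "of_int (1 - int \<mu> ^ (p - 1)) \<in> P (p - 1)" by (rule int_mem_P_if_dvd)
  then have "1 - of_nat \<mu> ^ (p - 1) \<in> P (p - 1)" by simp
  then show ?thesis unfolding eq
    by (intro R_mult_P P_mult_R R.power_mem v(2)) simp_all
qed

lemma sigma_pow_eigen:
  assumes "x \<in> R" "\<sigma> x - of_nat \<mu> * x \<in> P k"
  shows "(\<sigma> ^^ i) x - of_nat \<mu> ^ i * x \<in> P k"
proof (induction i)
  case (Suc i)
  have "\<sigma> ((\<sigma> ^^ i) x - of_nat \<mu> ^ i * x) + of_nat \<mu> ^ i * (\<sigma> x - of_nat \<mu> * x) \<in> P k"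
    by (intro P_add R_mult_P \<sigma>'.f_P Suc assms(2)) simp
  moreover have "\<sigma> ((\<sigma> ^^ i) x - of_nat \<mu> ^ i * x) = (\<sigma> ^^ Suc i) x - of_nat \<mu> ^ i * \<sigma> x"
    using assms(1) by simp
  ultimately show ?case by (simp add: algebra_simps)
qed (simp add: P_zero)

text \<open>The operator commutes with \<open>\<sigma> ^^ k\<close>, so it sends the basis element
  \<open>\<zeta> ^ (u ^ k)\<close> to the image of \<open>eigen_sum \<mu>\<close> under
  \<open>\<sigma> ^^ k\<close>, which modulo \<open>p\<close> is \<open>\<mu> ^ k\<close> times
  \<open>eigen_sum \<mu>\<close>. Integer coordinates then combine to an integer multiple.\<close>

lemma eigen_proj_cyc_int:
  assumes \<mu>: "\<not> p dvd \<mu>" and x: "x \<in> O\<^sub>K"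
  shows "\<exists>n::int. eigen_proj \<mu> x - of_int n * eigen_sum \<mu> \<in> P (p - 1)"
proof -
  have "\<exists>n::int. eigen_proj \<mu> (\<zeta> ^ j) - of_int n * eigen_sum \<mu> \<in> P (p - 1)" if j: "j \<in> {0<..<p}" for j
  proof -
    have "j \<in> (\<lambda>k. u ^ k mod p) ` {..<p - 1}"
      using bij_betw_imp_surj_on[OF bij_betw_u_power] j by (simp only:)
    then obtain k where k: "j = u ^ k mod p" by (rule imageE)
    have "eigen_proj \<mu> (\<zeta> ^ j) = (\<sigma> ^^ k) (eigen_sum \<mu>)"
    proof -
      have "(\<sigma> ^^ k) (eigen_sum \<mu>) = (\<Sum>i<p - 1. (\<sigma> ^^ k) (inverse (of_nat \<mu>) ^ i * (\<sigma> ^^ i) \<zeta>))"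
        unfolding eigen_proj_zeta[symmetric] eigen_proj_def by (rule \<sigma>_pow.hom_sum) simp
      also have "\<dots> = eigen_proj \<mu> (\<zeta> ^ (u ^ k))"
        unfolding eigen_proj_def by (simp add: sigma_pow_zeta power_mult[symmetric] mult.commute)
      finally show ?thesis unfolding k zeta_power_mod by simp
    qed
    moreover have "(\<sigma> ^^ k) (eigen_sum \<mu>) - of_nat \<mu> ^ k * eigen_sum \<mu> \<in> P (p - 1)"
      by (intro sigma_pow_eigen eigen_sum_R sigma_eigen_sum \<mu>)
    ultimately show ?thesis by (intro exI[of _ "int \<mu> ^ k"]) simp
  qed
  then obtain n :: "nat \<Rightarrow> int" where
    n: "\<And>j. j \<in> {0<..<p} \<Longrightarrow> eigen_proj \<mu> (\<zeta> ^ j) - of_int (n j) * eigen_sum \<mu> \<in> P (p - 1)"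
    by metis
  have "\<exists>c::int. coord j x = of_int c" for j
    using coord_Ints[OF x, of j] by (auto elim: Ints_cases)
  then obtain c :: "nat \<Rightarrow> int" where c: "\<And>j. coord j x = of_int (c j)" by metis
  have "x = (\<Sum>j\<in>{0<..<p}. of_int (c j) * \<zeta> ^ j)"
    using zeta_basis[OF x] unfolding c .
  then have "eigen_proj \<mu> x = (\<Sum>j\<in>{0<..<p}. of_int (c j) * eigen_proj \<mu> (\<zeta> ^ j))"
    using eigen_proj_of_int_sum[of "{0<..<p}" "\<lambda>j. \<zeta> ^ j" \<mu> c] by simp
  then have "eigen_proj \<mu> x - of_int (\<Sum>j\<in>{0<..<p}. c j * n j) * eigen_sum \<mu>
      = (\<Sum>j\<in>{0<..<p}. of_int (c j) * (eigen_proj \<mu> (\<zeta> ^ j) - of_int (n j) * eigen_sum \<mu>))"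
    by (simp add: right_diff_distrib sum_subtractf sum_distrib_right mult.assoc)
  moreover have "\<dots> \<in> P (p - 1)" by (intro P_sum R_mult_P n) simp_all
  ultimately show ?thesis by metis
qed

lemma eigen_congruence:
  assumes \<mu>: "\<not> p dvd \<mu>" and D: "D \<in> R" "\<sigma> D - of_nat \<mu> * D \<in> P (p - 1)"
  shows "\<exists>n::int. D + of_int n * eigen_sum \<mu> \<in> P (p - 1)"
proof -
  have 1: "eigen_proj \<mu> D + D \<in> P (p - 1)"
  proof -
    have v: "inverse (of_nat \<mu>) ^ i * of_nat \<mu> ^ i = (1::complex)" for i
      using \<mu> by (metis dvd_0_right left_inverse of_nat_eq_0_iff power_mult_distrib power_one)
    have "(\<Sum>i<p - 1. inverse (of_nat \<mu>) ^ i * ((\<sigma> ^^ i) D - of_nat \<mu> ^ i * D)) \<in> P (p - 1)"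
      by (intro P_sum R_mult_P R.power_mem inverse_of_nat_mem_R \<mu> sigma_pow_eigen D)
    moreover have "(\<Sum>i<p - 1. inverse (of_nat \<mu>) ^ i * ((\<sigma> ^^ i) D - of_nat \<mu> ^ i * D))
        = eigen_proj \<mu> D - of_nat (p - 1) * D"
      by (simp add: eigen_proj_def right_diff_distrib sum_subtractf v mult.assoc[symmetric])
    \<comment> \<open>Adding \<open>p * D\<close> changes the factor \<open>p - 1\<close> into
      \<open>- 1\<close>; this sign is why \<open>\<delta>\<close> enters the expansion with a
      minus.\<close>
    ultimately have "eigen_proj \<mu> D - of_nat (p - 1) * D + of_nat p * D \<in> P (p - 1)"
      using P_add P_mult_R[OF p_mem_P D(1)] by metis
    moreover have "eigen_proj \<mu> D - of_nat (p - 1) * D + of_nat p * D = eigen_proj \<mu> D + D"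
      using p_ge_3 by (simp add: of_nat_diff algebra_simps)
    ultimately show ?thesis by (simp only:)
  qed
  obtain E where E: "E \<in> O\<^sub>K" "D - E \<in> P (p - 1)" using O_approximates_R[OF D(1)] by blast
  from eigen_proj_P[OF \<mu> E(2)] have 2: "eigen_proj \<mu> D - eigen_proj \<mu> E \<in> P (p - 1)"
    using eigen_proj_diff[of D E] D E by simp
  obtain n where 3: "eigen_proj \<mu> E - of_int n * eigen_sum \<mu> \<in> P (p - 1)"
    using eigen_proj_cyc_int[OF \<mu> E(1)] by blast
  from P_diff[OF P_diff[OF 1 2] 3]
  have "D + of_int n * eigen_sum \<mu> \<in> P (p - 1)" by (simp add: algebra_simps)
  then show ?thesis by blast
qed

lemma eigen_expansion:
  assumes C: "C \<in> R" "C - 1 \<in> P 2" "\<sigma> C - C ^ \<mu> \<in> P p"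
    and \<mu>: "\<mu> = upow p u (2 * m + 1)" and m: "1 \<le> m" "m \<le> (p - 3) div 2" "(p - 1) div 2 < 2 * m + 1"
  shows "\<exists>\<delta>::int. C - (1 - of_int \<delta> * eigen_sum \<mu>) \<in> P (p - 1) \<and> (int p dvd \<delta> \<longrightarrow> C - 1 \<in> P p)"
proof -
  define D where "D = C - 1"
  have D: "D \<in> R" using C by (simp add: D_def)
  obtain q where q: "p = 2 * q + 1" using odd_p by (rule oddE)
  have "(p - 3) div 2 = q - 1" "(p - 1) div 2 = q" unfolding q by simp_all
  with m have "m \<le> q - 1" "q < 2 * m + 1" by (simp_all only:)
  \<comment> \<open>The first bound keeps the exceptional exponent away from \<open>p - 1\<close>;
    the second makes the quadratic error negligible.\<close>
  then have mp: "2 * m + 1 < p - 1" "p \<le> 2 * (2 * m + 1)" unfolding q using m(1) by simp_all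
  have nd: "\<not> p dvd \<mu>"
  proof
    assume "p dvd \<mu>"
    then have "p dvd u ^ (2 * m + 1)"
      unfolding \<mu> upow_def by (simp only: dvd_mod_iff dvd_refl)
    then show False using prime_dvd_power[OF prime_p] not_p_dvd_u by blast
  qed
  obtain e where e: "e \<in> R" "(1 + D) ^ \<mu> = 1 + of_nat \<mu> * D + D ^ 2 * e"
    using R.power_add_diff_linear[OF D] by blast
  have eq: "\<sigma> D - of_nat \<mu> * D = (\<sigma> C - C ^ \<mu>) + D * D * e"
    using e(2) C(1) by (simp add: D_def power2_eq_square)
  \<comment> \<open>Linearising \<open>C ^ \<mu>\<close> costs a multiple of \<open>D ^ 2\<close>,
    so precision \<open>k \<le> 2 * j\<close> is available once \<open>D\<close> lies in
    \<open>P j\<close>.\<close>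
  have eig: "\<sigma> D - of_nat \<mu> * D \<in> P k" if "D \<in> P j" "k \<le> 2 * j" "k \<le> p" for j k
  proof -
    have "D * D * e \<in> P (j + j)" by (intro P_mult_R P_mult that e)
    then have "D * D * e \<in> P k" using that by (elim P_mono) simp
    moreover have "\<sigma> C - C ^ \<mu> \<in> P k" using C(3) that(3) by (rule P_mono)
    ultimately show ?thesis unfolding eq by (intro P_add)
  qed
  have step: "D \<in> P (j + 1)" if "D \<in> P j" "2 \<le> j" "j < p" "j \<noteq> 2 * m + 1" for j
    using that \<mu> mp by (intro eigen_coefficient_vanishes[of D j \<mu> "2 * m + 1"] eig[of j]) (simp_all add: upow_def)
  \<comment> \<open>Climbs one level at a time through any range that avoids the exceptional
    exponent: once from 2 up to \<open>2 * m + 1\<close>, and once from \<open>p - 1\<close> to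
    \<open>p\<close>.\<close>
  have raise: "D \<in> P b" if "a \<le> b" "D \<in> P a" "2 \<le> a" "b \<le> p" "\<And>j. a \<le> j \<Longrightarrow> j < b \<Longrightarrow> j \<noteq> 2 * m + 1" for a b
    using that
  proof (induction b rule: dec_induct)
    case (step b)
    then show ?case using \<open>\<And>j. D \<in> P j \<Longrightarrow> 2 \<le> j \<Longrightarrow> j < p \<Longrightarrow> j \<noteq> 2 * m + 1 \<Longrightarrow> D \<in> P (j + 1)\<close>[of b]
      by simp
  qed
  have "D \<in> P (2 * m + 1)"
    by (rule raise[of 2]) (use C(2) mp m in \<open>simp_all add: D_def\<close>)
  then have "\<sigma> D - of_nat \<mu> * D \<in> P (p - 1)" using mp by (intro eig[of "2 * m + 1"]) simp_all
  then obtain n :: int where n: "D + of_int n * eigen_sum \<mu> \<in> P (p - 1)"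
    using eigen_congruence[OF nd D] by blast
  have "D \<in> P p" if "int p dvd n"
  proof -
    have "of_int n * eigen_sum \<mu> \<in> P (p - 1)"
      by (intro P_mult_R int_mem_P_if_dvd that eigen_sum_R nd)
    from P_diff[OF n this] have "D \<in> P (p - 1)" by (simp only: add_diff_cancel_right')
    show ?thesis by (rule raise[of "p - 1" p]) (use mp \<open>D \<in> P (p - 1)\<close> in simp_all)
  qed
  moreover have "C - (1 - of_int n * eigen_sum \<mu>) = D + of_int n * eigen_sum \<mu>"
    by (simp add: D_def)
  ultimately show ?thesis using n unfolding D_def by (metis (no_types))
qed

end

subsection \<open>Fractional ideals and classes\<close>

text \<open>Fractional ideals enter as a commutative monoid, and inverses are supplied for the
  principal ones. The quotient is therefore built for a submonoid of invertible elements; its powers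
  and inverses are computed on representatives.\<close>

locale invertible_submonoid = comm_monoid G for G (structure) +
  fixes H
  assumes H_subset: "H \<subseteq> carrier G"
    and H_one: "\<one> \<in> H"
    and H_mult: "h \<in> H \<Longrightarrow> k \<in> H \<Longrightarrow> h \<otimes> k \<in> H"
    and H_inv: "h \<in> H \<Longrightarrow> \<exists>k\<in>H. k \<otimes> h = \<one>"
begin

lemma H_carrier: "h \<in> H \<Longrightarrow> h \<in> carrier G"
  using H_subset by blast

lemma mem_coset_iff: "x \<in> H #> a \<longleftrightarrow> (\<exists>h\<in>H. x = h \<otimes> a)"
  by (auto simp: r_coset_def)

lemma coset_one: "H #> \<one> = H"
proof -
  have "h \<otimes> \<one> = h" if "h \<in> H" for h using that by (simp add: H_carrier)
  then show ?thesis unfolding r_coset_def by auto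
qed

lemma coset_mult:
  assumes "a \<in> carrier G" "b \<in> carrier G"
  shows "(H #> a) <#> (H #> b) = H #> (a \<otimes> b)"
proof (intro equalityI subsetI)
  fix x assume "x \<in> (H #> a) <#> (H #> b)"
  then obtain h k where hk: "h \<in> H" "k \<in> H" "x = (h \<otimes> a) \<otimes> (k \<otimes> b)"
    unfolding set_mult_def r_coset_def by blast
  then have "x = (h \<otimes> k) \<otimes> (a \<otimes> b)" using assms by (simp add: H_carrier m_ac)
  then show "x \<in> H #> (a \<otimes> b)" unfolding mem_coset_iff using hk H_mult by blast
next
  fix x assume "x \<in> H #> (a \<otimes> b)"
  then obtain h where h: "h \<in> H" "x = h \<otimes> (a \<otimes> b)" unfolding mem_coset_iff by blast
  then have "x = (h \<otimes> a) \<otimes> (\<one> \<otimes> b)" using assms by (simp add: H_carrier m_ac)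
  then show "x \<in> (H #> a) <#> (H #> b)"
    unfolding set_mult_def r_coset_def using h H_one by blast
qed

lemma FactGroup_simps:
  "carrier (G Mod H) = (\<lambda>a. H #> a) ` carrier G" "\<one>\<^bsub>G Mod H\<^esub> = H" "monoid.mult (G Mod H) = (<#>)"
  by (auto simp: FactGroup_def RCOSETS_def)

lemma FactGroup_E:
  assumes "x \<in> carrier (G Mod H)"
  obtains a where "a \<in> carrier G" "x = H #> a"
  using assms unfolding FactGroup_simps(1) by (rule imageE)

lemma FactGroup_comm_monoid: "comm_monoid (G Mod H)"
proof (rule comm_monoidI)
  fix x y assume "x \<in> carrier (G Mod H)" "y \<in> carrier (G Mod H)"
  then obtain a b where ab: "a \<in> carrier G" "b \<in> carrier G" and xy: "x = H #> a" "y = H #> b"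
    by (elim FactGroup_E)
  show "x \<otimes>\<^bsub>G Mod H\<^esub> y \<in> carrier (G Mod H)"
    unfolding FactGroup_simps xy coset_mult[OF ab] by (intro imageI m_closed ab)
  show "x \<otimes>\<^bsub>G Mod H\<^esub> y = y \<otimes>\<^bsub>G Mod H\<^esub> x"
    unfolding FactGroup_simps xy coset_mult[OF ab] coset_mult[OF ab(2,1)] m_comm[OF ab] ..
next
  show "\<one>\<^bsub>G Mod H\<^esub> \<in> carrier (G Mod H)"
    unfolding FactGroup_simps using imageI[OF one_closed, of "\<lambda>a. H #> a"] unfolding coset_one .
next
  fix x y z assume "x \<in> carrier (G Mod H)" "y \<in> carrier (G Mod H)" "z \<in> carrier (G Mod H)"
  then obtain a b c where abc: "a \<in> carrier G" "b \<in> carrier G" "c \<in> carrier G"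
    and xyz: "x = H #> a" "y = H #> b" "z = H #> c"
    by (elim FactGroup_E)
  show "(x \<otimes>\<^bsub>G Mod H\<^esub> y) \<otimes>\<^bsub>G Mod H\<^esub> z = x \<otimes>\<^bsub>G Mod H\<^esub> (y \<otimes>\<^bsub>G Mod H\<^esub> z)"
    unfolding FactGroup_simps xyz using abc by (simp only: coset_mult m_closed m_assoc)
next
  fix x assume "x \<in> carrier (G Mod H)"
  then obtain a where a: "a \<in> carrier G" "x = H #> a"
    by (elim FactGroup_E)
  show "\<one>\<^bsub>G Mod H\<^esub> \<otimes>\<^bsub>G Mod H\<^esub> x = x"
    unfolding FactGroup_simps a(2) using coset_mult[OF one_closed a(1)] a(1) by (simp only: coset_one l_one)
qed

lemma coset_pow:
  assumes "a \<in> carrier G"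
  shows "(H #> a) [^]\<^bsub>G Mod H\<^esub> (n::nat) = H #> (a [^] n)"
proof (induction n)
  case 0
  show ?case by (simp only: Group.nat_pow_0 FactGroup_simps coset_one)
next
  case (Suc n)
  then show ?case using assms by (simp only: Group.nat_pow_Suc FactGroup_simps coset_mult nat_pow_closed)
qed

lemma coset_eq_H: "h \<in> H \<Longrightarrow> H #> h = H"
proof (intro equalityI subsetI)
  fix x assume "h \<in> H" "x \<in> H #> h"
  then show "x \<in> H" unfolding mem_coset_iff using H_mult by blast
next
  fix x assume h: "h \<in> H" "x \<in> H"
  obtain k where k: "k \<in> H" "k \<otimes> h = \<one>" using H_inv h by blast
  have "x = (x \<otimes> k) \<otimes> h" using k h by (simp add: H_carrier m_assoc)
  then show "x \<in> H #> h" unfolding mem_coset_iff using H_mult[OF h(2) k(1)] by blast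
qed

lemma self_mem_coset: "a \<in> carrier G \<Longrightarrow> a \<in> H #> a"
  unfolding mem_coset_iff using H_one by (intro bexI[of _ \<one>]) simp_all

lemma inv_coset:
  assumes "a \<in> carrier G" "b \<in> carrier G" "a \<otimes> b = \<one>"
  shows "inv\<^bsub>G Mod H\<^esub> (H #> a) = H #> b"
proof (rule comm_monoid.comm_inv_char[OF FactGroup_comm_monoid])
  show "H #> a \<in> carrier (G Mod H)" "H #> b \<in> carrier (G Mod H)"
    unfolding FactGroup_simps using assms by simp_all
  show "(H #> a) \<otimes>\<^bsub>G Mod H\<^esub> (H #> b) = \<one>\<^bsub>G Mod H\<^esub>"
    unfolding FactGroup_simps using assms by (simp add: coset_mult coset_one)
qed

end

section \<open>Products of fractional ideals and principal ideals\<close>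

lemma ideal_prod_CC_induct [consumes 1, case_names prod sum]:
  assumes "x \<in> ideal_prod CC I J"
    and "\<And>i j. i \<in> I \<Longrightarrow> j \<in> J \<Longrightarrow> Q (i * j)"
    and "\<And>x y. x \<in> ideal_prod CC I J \<Longrightarrow> y \<in> ideal_prod CC I J \<Longrightarrow> Q x \<Longrightarrow> Q y \<Longrightarrow> Q (x + y)"
  shows "Q x"
  using assms(1)
proof (induction rule: ideal_prod.induct)
  case (prod i j)
  then show ?case using assms(2) by simp
next
  case (sum s1 s2)
  then show ?case using assms(3) by simp
qed

lemma ideal_prod_CC_prod: "i \<in> I \<Longrightarrow> j \<in> J \<Longrightarrow> i * j \<in> ideal_prod CC I J"
  using ideal_prod.prod[of i I j J CC] by simp

lemma ideal_prod_CC_add: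
  "x \<in> ideal_prod CC I J \<Longrightarrow> y \<in> ideal_prod CC I J \<Longrightarrow> x + y \<in> ideal_prod CC I J"
  using ideal_prod.sum[of x CC I J y] by simp

lemma ideal_prod_CC_comm: "ideal_prod CC I J = ideal_prod CC J I"
proof -
  have "ideal_prod CC I J \<subseteq> ideal_prod CC J I" for I J
  proof
    fix x assume "x \<in> ideal_prod CC I J"
    then show "x \<in> ideal_prod CC J I"
    proof (induction rule: ideal_prod_CC_induct)
      case (prod i j)
      then show ?case using ideal_prod_CC_prod[of j J i I] by (simp add: mult.commute)
    qed (rule ideal_prod_CC_add)
  qed
  then show ?thesis by blast
qed

lemma ideal_prod_CC_assoc: "ideal_prod CC (ideal_prod CC I J) L = ideal_prod CC I (ideal_prod CC J L)"
proof -
  have "ideal_prod CC (ideal_prod CC I J) L \<subseteq> ideal_prod CC I (ideal_prod CC J L)" for I J L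
  proof
    fix x assume "x \<in> ideal_prod CC (ideal_prod CC I J) L"
    then show "x \<in> ideal_prod CC I (ideal_prod CC J L)"
    proof (induction rule: ideal_prod_CC_induct)
      case (prod y l)
      from prod(1) show ?case
      proof (induction rule: ideal_prod_CC_induct)
        case (prod i j)
        then show ?case
          using ideal_prod_CC_prod[OF _ ideal_prod_CC_prod[OF _ \<open>l \<in> L\<close>], of i I j J]
          by (simp add: mult.assoc)
      next
        case (sum y y')
        then show ?case using ideal_prod_CC_add by (simp add: distrib_right)
      qed
    qed (rule ideal_prod_CC_add)
  qed
  \<comment> \<open>The opposite inclusion is the same one read backwards through
    commutativity.\<close>
  note subset = this
  have "ideal_prod CC I (ideal_prod CC J L) = ideal_prod CC (ideal_prod CC L J) I"
    unfolding ideal_prod_CC_comm[of L J] by (rule ideal_prod_CC_comm)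
  also have "\<dots> \<subseteq> ideal_prod CC L (ideal_prod CC J I)" by (rule subset)
  also have "\<dots> = ideal_prod CC (ideal_prod CC I J) L"
    unfolding ideal_prod_CC_comm[of J I] by (rule ideal_prod_CC_comm)
  finally show ?thesis using subset by (rule subset_antisym[rotated])
qed

lemma additive_subgroup_CC_iff:
  "additive_subgroup I CC \<longleftrightarrow> 0 \<in> I \<and> (\<forall>x\<in>I. \<forall>y\<in>I. x + y \<in> I) \<and> (\<forall>x\<in>I. - x \<in> I)"
proof -
  have "inv\<^bsub>add_monoid CC\<^esub> x = - x" for x :: complex
    using CC_a_inv[of x] unfolding a_inv_def .
  then show ?thesis
    unfolding additive_subgroup_def subgroup_def by auto
qed

lemma fractional_idealI:
  assumes "I \<subseteq> cyc_field z"
    and add: "\<And>x y. x \<in> I \<Longrightarrow> y \<in> I \<Longrightarrow> x + y \<in> I"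
    and mult: "\<And>a x. a \<in> cyc_int z \<Longrightarrow> x \<in> I \<Longrightarrow> a * x \<in> I"
    and "x0 \<in> I" "x0 \<noteq> 0"
    and "d \<in> cyc_int z" "d \<noteq> 0" "\<And>x. x \<in> I \<Longrightarrow> d * x \<in> cyc_int z"
  shows "fractional_ideal z I"
proof -
  have "0 \<in> I" using mult[of 0 x0] assms(4) by simp
  moreover have "- x \<in> I" if "x \<in> I" for x using mult[of "- 1" x] that by simp
  moreover have "I \<noteq> {0}" using assms(4,5) by blast
  moreover have "\<exists>d\<in>cyc_int z - {0}. \<forall>x\<in>I. d * x \<in> cyc_int z"
    using assms(6-8) by (intro bexI[of _ d] ballI) simp_all
  ultimately show ?thesis
    unfolding fractional_ideal_def additive_subgroup_CC_iff
    using assms(1) add mult by (intro conjI ballI)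
qed

lemma fractional_idealD:
  assumes "fractional_ideal z I"
  shows "I \<subseteq> cyc_field z" "\<And>x y. x \<in> I \<Longrightarrow> y \<in> I \<Longrightarrow> x + y \<in> I"
    "\<And>a x. a \<in> cyc_int z \<Longrightarrow> x \<in> I \<Longrightarrow> a * x \<in> I"
    "\<exists>x\<in>I. x \<noteq> 0" "\<exists>d\<in>cyc_int z. d \<noteq> 0 \<and> (\<forall>x\<in>I. d * x \<in> cyc_int z)"
  using assms unfolding fractional_ideal_def additive_subgroup_CC_iff by blast+

lemma ideal_prod_CC_subset:
  assumes "\<And>i j. i \<in> I \<Longrightarrow> j \<in> J \<Longrightarrow> i * j \<in> L" "\<And>x y. x \<in> L \<Longrightarrow> y \<in> L \<Longrightarrow> x + y \<in> L"
  shows "ideal_prod CC I J \<subseteq> L"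
proof
  fix x assume "x \<in> ideal_prod CC I J"
  then show "x \<in> L" by (induction rule: ideal_prod_CC_induct) (use assms in auto)
qed

lemma fractional_ideal_prod:
  assumes I: "fractional_ideal z I" and J: "fractional_ideal z J"
  shows "fractional_ideal z (ideal_prod CC I J)"
proof -
  obtain x y where xy: "x \<in> I" "x \<noteq> 0" "y \<in> J" "y \<noteq> 0"
    using fractional_idealD(4)[OF I] fractional_idealD(4)[OF J] by blast
  obtain d d' where d: "d \<in> cyc_int z" "d \<noteq> 0" "\<And>x. x \<in> I \<Longrightarrow> d * x \<in> cyc_int z"
    "d' \<in> cyc_int z" "d' \<noteq> 0" "\<And>x. x \<in> J \<Longrightarrow> d' * x \<in> cyc_int z"
    using fractional_idealD(5)[OF I] fractional_idealD(5)[OF J] by blast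
  show ?thesis
  proof (rule fractional_idealI)
    show "ideal_prod CC I J \<subseteq> cyc_field z"
      using fractional_idealD(1)[OF I] fractional_idealD(1)[OF J]
      by (intro ideal_prod_CC_subset cyc_field.mult_mem cyc_field.add_mem) blast+
    show "a * x \<in> ideal_prod CC I J" if "a \<in> cyc_int z" "x \<in> ideal_prod CC I J" for a x
      using that(2)
    proof (induction rule: ideal_prod_CC_induct)
      case (prod i j)
      then show ?case
        using ideal_prod_CC_prod[OF fractional_idealD(3)[OF I that(1)]] by (simp flip: mult.assoc)
    next
      case (sum x y)
      then show ?case by (simp add: distrib_left ideal_prod_CC_add)
    qed
    show "x * y \<in> ideal_prod CC I J" using xy by (simp add: ideal_prod_CC_prod)
    show "x * y \<noteq> 0" using xy by simp
    show "d * d' \<in> cyc_int z" "d * d' \<noteq> 0" using d by simp_all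
    show "d * d' * x \<in> cyc_int z" if "x \<in> ideal_prod CC I J" for x
      using that
    proof (induction rule: ideal_prod_CC_induct)
      case (prod i j)
      have "d * d' * (i * j) = (d * i) * (d' * j)" by (simp only: mult_ac)
      then show ?case using d(3)[OF prod(1)] d(6)[OF prod(2)] by (simp only: cyc_int.mult_mem)
    next
      case (sum x y)
      then show ?case by (simp add: distrib_left)
    qed
  qed (rule ideal_prod_CC_add)
qed

lemma fractional_ideal_cyc_int: "fractional_ideal z (cyc_int z)"
  by (rule fractional_idealI[of _ _ 1 1]) (simp_all add: cyc_int_subset_cyc_field)

lemma ideal_prod_cyc_int:
  assumes I: "fractional_ideal z I"
  shows "ideal_prod CC (cyc_int z) I = I"
proof
  show "ideal_prod CC (cyc_int z) I \<subseteq> I"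
    by (intro ideal_prod_CC_subset fractional_idealD[OF I])
  show "I \<subseteq> ideal_prod CC (cyc_int z) I"
    using ideal_prod_CC_prod[of 1 "cyc_int z" _ I] by auto
qed

lemma frac_ideals_simps:
  "carrier (frac_ideals z) = {I. fractional_ideal z I}" "\<one>\<^bsub>frac_ideals z\<^esub> = cyc_int z"
  "I \<otimes>\<^bsub>frac_ideals z\<^esub> J = ideal_prod CC I J"
  by (simp_all add: frac_ideals_def)

interpretation frac_ideals: comm_monoid "frac_ideals z" for z
proof (rule comm_monoidI)
  fix x y assume "x \<in> carrier (frac_ideals z)" "y \<in> carrier (frac_ideals z)"
  then show "x \<otimes>\<^bsub>frac_ideals z\<^esub> y \<in> carrier (frac_ideals z)"
    by (simp add: frac_ideals_simps fractional_ideal_prod)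
  show "x \<otimes>\<^bsub>frac_ideals z\<^esub> y = y \<otimes>\<^bsub>frac_ideals z\<^esub> x"
    unfolding frac_ideals_simps by (rule ideal_prod_CC_comm)
next
  fix x y w
  show "(x \<otimes>\<^bsub>frac_ideals z\<^esub> y) \<otimes>\<^bsub>frac_ideals z\<^esub> w = x \<otimes>\<^bsub>frac_ideals z\<^esub> (y \<otimes>\<^bsub>frac_ideals z\<^esub> w)"
    unfolding frac_ideals_simps by (rule ideal_prod_CC_assoc)
qed (simp_all add: frac_ideals_simps fractional_ideal_cyc_int ideal_prod_cyc_int)

lemma mem_principal_iff: "y \<in> principal z x \<longleftrightarrow> (\<exists>a\<in>cyc_int z. y = x * a)"
  by (auto simp: principal_def)

lemma self_mem_principal: "x \<in> principal z x"
  unfolding mem_principal_iff by (rule bexI[of _ 1]) simp_all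

lemma principal_one: "principal z 1 = cyc_int z"
  by (simp add: principal_def)

lemma fractional_ideal_principal:
  assumes "x \<in> cyc_field z" "x \<noteq> 0"
  shows "fractional_ideal z (principal z x)"
proof -
  obtain a b where ab: "x = a / b" "a \<in> cyc_int z" "b \<in> cyc_int z" "b \<noteq> 0"
    using assms(1) unfolding cyc_field_eq_fractions by blast
  show ?thesis
  proof (rule fractional_idealI[of _ _ x b])
    show "principal z x \<subseteq> cyc_field z"
      using assms(1)
      by (auto simp: mem_principal_iff intro!: cyc_field.mult_mem dest: subsetD[OF cyc_int_subset_cyc_field])
    fix y w assume "y \<in> principal z x" "w \<in> principal z x"
    then obtain r s where "r \<in> cyc_int z" "s \<in> cyc_int z" "y = x * r" "w = x * s"
      unfolding mem_principal_iff by blast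
    then have "y + w = x * (r + s)" "r + s \<in> cyc_int z" by (simp_all add: distrib_left)
    then show "y + w \<in> principal z x" unfolding mem_principal_iff by blast
  next
    fix r y assume "r \<in> cyc_int z" "y \<in> principal z x"
    then obtain s where "r \<in> cyc_int z" "s \<in> cyc_int z" "y = x * s"
      unfolding mem_principal_iff by blast
    then have "r * y = x * (r * s)" "r * s \<in> cyc_int z" by simp_all
    then show "r * y \<in> principal z x" unfolding mem_principal_iff by blast
  next
    show "b * y \<in> cyc_int z" if "y \<in> principal z x" for y
      using that ab by (auto simp: mem_principal_iff)
  qed (use ab assms self_mem_principal in simp_all)
qed

lemma principal_mult: "ideal_prod CC (principal z x) (principal z y) = principal z (x * y)"
proof
  show "ideal_prod CC (principal z x) (principal z y) \<subseteq> principal z (x * y)"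
  proof (rule ideal_prod_CC_subset)
    fix i j assume "i \<in> principal z x" "j \<in> principal z y"
    then obtain a b where "a \<in> cyc_int z" "b \<in> cyc_int z" "i = x * a" "j = y * b"
      unfolding mem_principal_iff by blast
    then have "i * j = (x * y) * (a * b)" "a * b \<in> cyc_int z" by simp_all
    then show "i * j \<in> principal z (x * y)" unfolding mem_principal_iff by blast
  next
    fix i j assume "i \<in> principal z (x * y)" "j \<in> principal z (x * y)"
    then obtain a b where "a \<in> cyc_int z" "b \<in> cyc_int z" "i = x * y * a" "j = x * y * b"
      unfolding mem_principal_iff by blast
    then have "i + j = (x * y) * (a + b)" "a + b \<in> cyc_int z" by (simp_all add: distrib_left)
    then show "i + j \<in> principal z (x * y)" unfolding mem_principal_iff by blast
  qed
  show "principal z (x * y) \<subseteq> ideal_prod CC (principal z x) (principal z y)"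
  proof
    fix w assume "w \<in> principal z (x * y)"
    then obtain a where a: "a \<in> cyc_int z" "w = x * (y * a)" unfolding mem_principal_iff by (auto simp: mult.assoc)
    have "y * a \<in> principal z y" unfolding mem_principal_iff using a(1) by blast
    then show "w \<in> ideal_prod CC (principal z x) (principal z y)"
      unfolding a(2) by (intro ideal_prod_CC_prod self_mem_principal)
  qed
qed

lemma principal_power: "principal z x [^]\<^bsub>frac_ideals z\<^esub> (n::nat) = principal z (x ^ n)"
proof (induction n)
  case 0
  show ?case by (simp only: Group.nat_pow_0 frac_ideals_simps power_0 principal_one)
next
  case (Suc n)
  then show ?case by (simp only: Group.nat_pow_Suc frac_ideals_simps power_Suc2 principal_mult)
qed

lemma principal_carrier [simp]:
  "x \<in> cyc_field z \<Longrightarrow> x \<noteq> 0 \<Longrightarrow> principal z x \<in> carrier (frac_ideals z)"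
  by (simp add: frac_ideals_simps fractional_ideal_principal)

lemma principal_eq_imp_associated:
  assumes "principal z x = principal z y" "y \<noteq> 0"
  shows "\<exists>e\<in>cyc_int z. \<exists>e'\<in>cyc_int z. x = y * e \<and> e * e' = 1"
proof -
  obtain e where e: "e \<in> cyc_int z" "x = y * e"
    using self_mem_principal[of x z] unfolding assms(1) mem_principal_iff by blast
  obtain e' where e': "e' \<in> cyc_int z" "y = x * e'"
    using self_mem_principal[of y z] unfolding assms(1)[symmetric] mem_principal_iff by blast
  have "y * (e * e') = y" using e(2) e'(2) by (simp only: mult.assoc[symmetric])
  then have "e * e' = 1" using assms(2) by simp
  then show ?thesis using e e' by blast
qed

interpretation principal_ideals: invertible_submonoid "frac_ideals z" "principal_ideals z" for z
proof
  show "principal_ideals z \<subseteq> carrier (frac_ideals z)"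
    unfolding principal_ideals_def by (rule image_subsetI) simp
  show "\<one>\<^bsub>frac_ideals z\<^esub> \<in> principal_ideals z"
    unfolding frac_ideals_simps principal_ideals_def
    by (rule image_eqI[of _ _ 1]) (simp_all add: principal_one)
next
  fix h k assume "h \<in> principal_ideals z" "k \<in> principal_ideals z"
  then obtain x y where "x \<in> cyc_field z - {0}" "y \<in> cyc_field z - {0}" "h = principal z x" "k = principal z y"
    unfolding principal_ideals_def by blast
  then show "h \<otimes>\<^bsub>frac_ideals z\<^esub> k \<in> principal_ideals z"
    unfolding frac_ideals_simps principal_ideals_def
    by (intro image_eqI[of _ _ "x * y"]) (simp_all add: principal_mult)
next
  fix h assume "h \<in> principal_ideals z"
  then obtain x where x: "x \<in> cyc_field z - {0}" "h = principal z x"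
    unfolding principal_ideals_def by blast
  then have "principal z (inverse x) \<otimes>\<^bsub>frac_ideals z\<^esub> h = \<one>\<^bsub>frac_ideals z\<^esub>"
    unfolding frac_ideals_simps by (simp add: principal_mult principal_one)
  moreover have "principal z (inverse x) \<in> principal_ideals z"
    using x unfolding principal_ideals_def by (intro imageI) simp
  ultimately show "\<exists>k\<in>principal_ideals z. k \<otimes>\<^bsub>frac_ideals z\<^esub> h = \<one>\<^bsub>frac_ideals z\<^esub>" by blast
qed

section \<open>Images of ideals under field homomorphisms\<close>

context cyc_field_hom
begin

lemma image_ideal_prod:
  assumes "I \<subseteq> cyc_field z" "J \<subseteq> cyc_field z"
  shows "f ` ideal_prod CC I J = ideal_prod CC (f ` I) (f ` J)"
proof -
  have 1: "x \<in> cyc_field z \<and> f x \<in> ideal_prod CC (f ` I) (f ` J)" if "x \<in> ideal_prod CC I J" for x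
    using that
  proof (induction rule: ideal_prod_CC_induct)
    case (prod i j)
    then have "i \<in> cyc_field z" "j \<in> cyc_field z" using assms by blast+
    then show ?case using ideal_prod_CC_prod[of "f i" "f ` I" "f j" "f ` J"] prod by simp
  next
    case (sum x y)
    then show ?case by (simp add: ideal_prod_CC_add)
  qed
  show ?thesis
  proof
    show "f ` ideal_prod CC I J \<subseteq> ideal_prod CC (f ` I) (f ` J)" using 1 by blast
    show "ideal_prod CC (f ` I) (f ` J) \<subseteq> f ` ideal_prod CC I J"
    proof (rule ideal_prod_CC_subset)
      fix x y assume "x \<in> f ` I" "y \<in> f ` J"
      then obtain i j where ij: "i \<in> I" "j \<in> J" "x = f i" "y = f j" by blast
      then have "i \<in> cyc_field z" "j \<in> cyc_field z" using assms by blast+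
      then have "x * y = f (i * j)" using ij by simp
      then show "x * y \<in> f ` ideal_prod CC I J" using ij ideal_prod_CC_prod by blast
    next
      fix x y assume "x \<in> f ` ideal_prod CC I J" "y \<in> f ` ideal_prod CC I J"
      then obtain i j where ij: "i \<in> ideal_prod CC I J" "j \<in> ideal_prod CC I J" "x = f i" "y = f j" by blast
      then have "x + y = f (i + j)" using 1 by simp
      then show "x + y \<in> f ` ideal_prod CC I J" using ij ideal_prod_CC_add by blast
    qed
  qed
qed

lemma image_ideal_power:
  assumes "f ` cyc_int z = cyc_int z" "I \<in> carrier (frac_ideals z)"
  shows "f ` (I [^]\<^bsub>frac_ideals z\<^esub> (n::nat)) = (f ` I) [^]\<^bsub>frac_ideals z\<^esub> n"
proof (induction n)
  case 0
  show ?case by (simp only: Group.nat_pow_0 frac_ideals_simps assms(1))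
next
  case (Suc n)
  have "J \<subseteq> cyc_field z" if "J \<in> carrier (frac_ideals z)" for J
    using that fractional_idealD(1) by (simp add: frac_ideals_simps)
  then have "f ` ideal_prod CC (I [^]\<^bsub>frac_ideals z\<^esub> n) I
      = ideal_prod CC (f ` (I [^]\<^bsub>frac_ideals z\<^esub> n)) (f ` I)"
    using assms(2) by (intro image_ideal_prod) simp_all
  then show ?case by (simp only: Group.nat_pow_Suc frac_ideals_simps Suc)
qed

lemma image_principal:
  assumes "f ` cyc_int z = cyc_int z" "x \<in> cyc_field z"
  shows "f ` principal z x = principal z (f x)"
proof -
  have "f ` principal z x = (\<lambda>a. f x * f a) ` cyc_int z"
    unfolding principal_def image_image
    by (rule image_cong[OF refl]) (use assms cyc_int_subset_cyc_field[of z] in \<open>simp add: subset_iff\<close>)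
  also have "\<dots> = (\<lambda>a. f x * a) ` f ` cyc_int z" by (simp only: image_image)
  finally show ?thesis by (simp only: assms(1) principal_def)
qed

end

subsection \<open>The quotient of a singular number by its conjugate\<close>

context cyclotomic_galois
begin

abbreviation F :: "complex set monoid" where "F \<equiv> frac_ideals \<zeta>"

text \<open>Surjectivity comes from finite order: \<open>\<sigma>\<close> undoes its own iterate
  \<open>\<sigma> ^^ (p - 2)\<close>.\<close>

lemma sigma_image_cyc_int: "\<sigma> ` O\<^sub>K = O\<^sub>K"
proof (intro equalityI subsetI)
  fix x assume x: "x \<in> O\<^sub>K"
  have "p - 1 = Suc (p - 2)" using p_ge_3 by simp
  then have "x = \<sigma> ((\<sigma> ^^ (p - 2)) x)" using sigma_pow_period[of x] x by simp
  then show "x \<in> \<sigma> ` O\<^sub>K" using \<sigma>_pow.cyc_int_closed[OF x] by (rule image_eqI)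
qed auto

lemma cnj_image_cyc_int: "cnj ` O\<^sub>K = O\<^sub>K"
proof (intro equalityI subsetI)
  fix x assume x: "x \<in> O\<^sub>K"
  have "x = cnj (cnj x)" by simp
  then show "x \<in> cnj ` O\<^sub>K" using cnj.cyc_int_closed[OF x] by (rule image_eqI)
qed auto

lemma pi_ideal_power: "pi_ideal \<zeta> [^]\<^bsub>F\<^esub> (k::nat) = principal \<zeta> (\<pi> ^ k)"
  unfolding pi_ideal_def \<pi>_def by (rule principal_power)

lemma pi_cong_iff: "pi_cong \<zeta> k x y \<longleftrightarrow> x \<in> R \<and> y \<in> R \<and> x - y \<in> P k"
proof -
  have "(\<exists>a\<in>principal \<zeta> (\<pi> ^ k). \<exists>b\<in>O\<^sub>K - pi_ideal \<zeta>. x - y = a / b) \<longleftrightarrow> x - y \<in> P k"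
  proof
    assume "\<exists>a\<in>principal \<zeta> (\<pi> ^ k). \<exists>b\<in>O\<^sub>K - pi_ideal \<zeta>. x - y = a / b"
    then obtain a b where ab: "a \<in> O\<^sub>K" "b \<in> O\<^sub>K - pi_ideal \<zeta>" "x - y = \<pi> ^ k * a / b"
      unfolding principal_def by blast
    then have "x - y = \<pi> ^ k * (a / b)" by simp
    then show "x - y \<in> P k" using P_I[OF R_I[OF ab(1,2)]] by (simp only:)
  next
    assume "x - y \<in> P k"
    then obtain r where "r \<in> R" "x - y = \<pi> ^ k * r" by (elim P_E)
    then obtain a b where "a \<in> O\<^sub>K" "b \<in> O\<^sub>K - pi_ideal \<zeta>" "x - y = \<pi> ^ k * (a / b)" by (elim R_E) simp
    then show "\<exists>a\<in>principal \<zeta> (\<pi> ^ k). \<exists>b\<in>O\<^sub>K - pi_ideal \<zeta>. x - y = a / b"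
      unfolding principal_def by (intro bexI[of _ "\<pi> ^ k * a"] bexI[of _ b] imageI) simp_all
  qed
  then show ?thesis unfolding pi_cong_def pi_ideal_power by (simp only:)
qed

text \<open>Up to a factor \<open>b * cnj b\<close>, which cancels in the ratio,
  \<open>\<alpha>\<close> is \<open>\<pi> ^ v * d\<close> with \<open>d\<close> outside the prime.
  Conjugation fixes residues, so \<open>d / cnj d\<close> is 1 modulo \<open>\<pi>\<close>, while
  \<open>\<pi> / cnj \<pi> = - \<zeta>\<close> is \<open>- 1\<close>; the sign is
  \<open>(- 1) ^ v\<close>.\<close>

lemma conjugate_ratio:
  assumes "\<alpha> \<in> K" "\<alpha> \<noteq> 0"
  shows "\<exists>s. (s = 1 \<or> s = -1) \<and> \<alpha> / cnj \<alpha> - s \<in> P 1"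
proof -
  obtain a b where ab: "\<alpha> = a / b" "a \<in> O\<^sub>K" "b \<in> O\<^sub>K" "b \<noteq> 0"
    using assms(1) unfolding cyc_field_eq_fractions by blast
  define c where "c = a * cnj b"
  have c: "c \<in> O\<^sub>K" "c \<noteq> 0" "\<alpha> / cnj \<alpha> = c / cnj c"
    using ab assms(2) by (auto simp: c_def)
  obtain v d where d: "c = \<pi> ^ v * d" "d \<in> O\<^sub>K - pi_ideal \<zeta>"
    using pi_adic_decomposition[OF c(1,2)] mem_pi_ideal_iff by blast
  have cd: "cnj d \<in> O\<^sub>K - pi_ideal \<zeta>" by (rule cnj'.f_notin_pi_ideal[OF d(2)])
  then have d0: "cnj d \<noteq> 0" using zero_mem_pi_ideal by auto
  have "\<zeta> * \<zeta> ^ (p - 1) = 1"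
    using power_Suc[of \<zeta> "p - 1"] p_ge_3 by simp
  then have pi: "cnj \<pi> * (- \<zeta>) = \<pi>" by (simp add: \<pi>_def cnj_zeta algebra_simps)
  have "c / cnj c = (- \<zeta>) ^ v * (d * inverse (cnj d))"
  proof -
    have "cnj c * ((- \<zeta>) ^ v * (d * inverse (cnj d))) = (cnj \<pi> * (- \<zeta>)) ^ v * d * (cnj d * inverse (cnj d))"
      unfolding d(1) power_mult_distrib by simp
    also have "\<dots> = c" using d0 unfolding pi d(1) by simp
    finally show ?thesis using c(2) by (simp add: field_simps)
  qed
  moreover have "(- \<zeta>) ^ v - (- 1) ^ v \<in> P 1"
    using P_I[of 1 1] by (intro P_power_diff) (simp_all add: \<pi>_def)
  moreover have "d * inverse (cnj d) - 1 \<in> P 1"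
  proof -
    have "- (cnj d - d) * inverse (cnj d) \<in> P 1"
      using d(2) by (intro P_mult_R P_uminus cnj'.f_residue inverse_mem_R cd) simp
    moreover have "- (cnj d - d) * inverse (cnj d) = d * inverse (cnj d) - 1"
      using d0 by (simp add: left_diff_distrib)
    ultimately show ?thesis by (simp only:)
  qed
  ultimately have "((- \<zeta>) ^ v - (- 1) ^ v) * (d * inverse (cnj d)) + (- 1) ^ v * (d * inverse (cnj d) - 1) \<in> P 1"
    using d(2) inverse_mem_R[OF cd] by (intro P_add P_mult_R R_mult_P) simp_all
  then have "\<alpha> / cnj \<alpha> - (- 1) ^ v \<in> P 1"
    unfolding c(3) \<open>c / cnj c = _\<close> left_diff_distrib right_diff_distrib by simp
  moreover have "(- 1 :: complex) ^ v = 1 \<or> (- 1 :: complex) ^ v = - 1" by (cases "even v") simp_all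
  ultimately show ?thesis by blast
qed

lemma conjugate_ratio_congruences:
  assumes B: "B \<in> O\<^sub>K" "B - of_int c \<in> P 2" "\<not> int p dvd c"
    and \<alpha>: "\<alpha> \<in> K" "\<alpha> \<noteq> 0" and \<eta>: "\<eta> \<in> O\<^sub>K" "\<eta>' \<in> O\<^sub>K" "\<eta> * \<eta>' = 1"
    and \<sigma>B: "\<sigma> B = \<alpha> ^ p * B ^ \<mu> * \<eta>"
  shows "B / cnj B \<in> R" "B / cnj B - 1 \<in> P 2" "\<sigma> (B / cnj B) - (B / cnj B) ^ \<mu> \<in> P p"
proof -
  define C where "C = B / cnj B"
  have B_unit: "B \<in> O\<^sub>K - pi_ideal \<zeta>"
  proof -
    have "B \<notin> P 1"
    proof
      assume "B \<in> P 1"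
      moreover have "B - of_int c \<in> P 1" using B(2) by (rule P_mono) simp
      ultimately have "B - (B - of_int c) \<in> P 1" by (rule P_diff)
      then have "of_int c \<in> P 1" by simp
      then show False using B(3) by (simp only: int_mem_P1_iff)
    qed
    then show ?thesis using O_mem_P1_iff[OF B(1)] B(1) by simp
  qed
  have cB: "cnj B \<in> O\<^sub>K - pi_ideal \<zeta>" by (rule cnj'.f_notin_pi_ideal[OF B_unit])
  then have B0: "B \<noteq> 0" "cnj B \<noteq> 0" using zero_mem_pi_ideal by auto
  show CR: "B / cnj B \<in> R" by (rule R_I[OF B(1) cB])
  \<comment> \<open>As \<open>c\<close> is real, subtracting it from both \<open>B\<close> and
    \<open>cnj B\<close> preserves their difference.\<close>
  have "((B - of_int c) - cnj (B - of_int c)) * inverse (cnj B) \<in> P 2"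
    by (intro P_mult_R P_diff cnj'.f_P inverse_mem_R cB B(2))
  moreover have "((B - of_int c) - cnj (B - of_int c)) * inverse (cnj B) = B / cnj B - 1"
    using B0 by (simp add: field_simps)
  ultimately show C1: "B / cnj B - 1 \<in> P 2" by (simp only:)
  define \<epsilon> where "\<epsilon> = \<eta> * cnj \<eta>'"
  have "\<epsilon> \<in> O\<^sub>K" using \<eta> by (simp add: \<epsilon>_def)
  moreover have "\<epsilon> * cnj \<epsilon> = 1"
  proof -
    have "\<epsilon> * cnj \<epsilon> = (\<eta> * \<eta>') * cnj (\<eta> * \<eta>')" by (simp add: \<epsilon>_def)
    then show ?thesis by (simp add: \<eta>(3))
  qed
  ultimately obtain s k where s: "s = 1 \<or> s = -1" "\<epsilon> = s * \<zeta> ^ k"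
    using unit_quotient_root_of_unity by blast
  define \<gamma> where "\<gamma> = \<alpha> / cnj \<alpha>"
  obtain t where t: "t = 1 \<or> t = -1" "\<gamma> - t \<in> P 1"
    using conjugate_ratio[OF \<alpha>] unfolding \<gamma>_def by blast
  have tR: "t \<in> R" "s \<in> R" using t(1) s(1) by auto
  have "t ^ p = t" using t(1) odd_p by auto
  then have \<gamma>p: "\<gamma> ^ p - t \<in> P p" using P_power_p[OF tR(1) t(2)] by simp
  have \<sigma>C: "\<sigma> C = \<gamma> ^ p * (C ^ \<mu> * (s * \<zeta> ^ k))"
  proof -
    have "cnj \<eta> * cnj \<eta>' = 1" using arg_cong[OF \<eta>(3), of cnj] by simp
    then have "\<eta> / cnj \<eta> = \<epsilon>" unfolding \<epsilon>_def
      by (metis divide_inverse inverse_unique)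
    moreover have "\<sigma> C = \<sigma> B / cnj (\<sigma> B)" using B(1) by (simp add: C_def sigma_cnj)
    moreover have "\<sigma> B / cnj (\<sigma> B) = \<gamma> ^ p * (C ^ \<mu> * (\<eta> / cnj \<eta>))"
      by (simp add: \<sigma>B \<gamma>_def C_def power_divide mult.assoc)
    ultimately show ?thesis by (simp only: s(2))
  qed
  define w where "w = s * t * \<zeta> ^ k"
  have CR': "C \<in> R" using CR by (simp add: C_def)
  have 1: "\<sigma> C - w * C ^ \<mu> \<in> P p"
  proof -
    have "(\<gamma> ^ p - t) * (C ^ \<mu> * (s * \<zeta> ^ k)) \<in> P p"
      using CR' tR by (intro P_mult_R \<gamma>p) simp
    moreover have "(\<gamma> ^ p - t) * (C ^ \<mu> * (s * \<zeta> ^ k)) = \<sigma> C - w * C ^ \<mu>"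
      unfolding \<sigma>C w_def by (simp add: algebra_simps)
    ultimately show ?thesis by (simp only:)
  qed
  \<comment> \<open>Both \<open>\<sigma> C\<close> and \<open>C ^ \<mu>\<close> are 1 modulo the
    square of the prime, hence so is the unknown factor \<open>w\<close> between them.\<close>
  have w2: "w - 1 \<in> P 2"
  proof -
    have a: "\<sigma> (C - 1) \<in> P 2" using C1 unfolding C_def by (rule \<sigma>'.f_P)
    have b: "w * (C ^ \<mu> - 1 ^ \<mu>) \<in> P 2"
      using C1 CR tR unfolding C_def w_def by (intro R_mult_P P_power_diff) simp_all
    have c: "\<sigma> C - w * C ^ \<mu> \<in> P 2" using 1 by (rule P_mono) (use p_ge_3 in simp)
    have "\<sigma> (C - 1) - w * (C ^ \<mu> - 1 ^ \<mu>) - (\<sigma> C - w * C ^ \<mu>) \<in> P 2"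
      by (rule P_diff[OF P_diff[OF a b] c])
    moreover have "\<sigma> (C - 1) - w * (C ^ \<mu> - 1 ^ \<mu>) - (\<sigma> C - w * C ^ \<mu>) = w - 1"
      using CR' by (simp add: algebra_simps)
    ultimately show ?thesis by (simp only:)
  qed
  obtain e e' where e: "1 - \<zeta> ^ k = \<pi> * e" "e \<in> O\<^sub>K" "e = of_nat k + \<pi> * e'" "e' \<in> O\<^sub>K"
    using pi_dvd_1_minus_zeta_power[of k] by blast
  \<comment> \<open>Modulo \<open>\<pi>\<close> the factor \<open>w\<close> is the sign
    \<open>s * t\<close>; the value \<open>- 1\<close> would make \<open>p\<close> divide 2.\<close>
  have "s * t = 1"
  proof (rule ccontr)
    assume "s * t \<noteq> 1"
    then have st: "s * t = - 1" using s(1) t(1) by auto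
    have "w - 1 \<in> P 1" using w2 by (rule P_mono) simp
    moreover have "\<pi> ^ 1 * e \<in> P 1" using e(2) by (intro P_I) simp
    ultimately have "(w - 1) - \<pi> ^ 1 * e \<in> P 1" by (rule P_diff)
    then have "of_int (-2) \<in> P 1" unfolding w_def st power_one_right e(1)[symmetric] by simp
    then have "int p dvd -2" by (simp only: int_mem_P1_iff)
    then have "p dvd 2" by (metis dvd_minus_iff int_dvd_int_iff of_nat_numeral)
    then show False using p_ge_3 by (auto dest: dvd_imp_le)
  qed
  \<comment> \<open>Now \<open>w\<close> is \<open>\<zeta> ^ k\<close>, and
    \<open>1 - \<zeta> ^ k\<close> is \<open>k * \<pi>\<close> modulo the square of the
    prime.\<close>
  have "p dvd k"
  proof -
    have "- (w - 1) \<in> P 2" by (rule P_uminus[OF w2])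
    then have "\<pi> ^ 1 * e \<in> P (1 + 1)" using \<open>s * t = 1\<close> e(1) by (simp add: w_def numeral_2_eq_2)
    then have "e \<in> P 1" unfolding pi_power_mult_mem_P_iff .
    moreover have "\<pi> ^ 1 * e' \<in> P 1" using e(4) by (intro P_I) simp
    ultimately have "e - \<pi> ^ 1 * e' \<in> P 1" by (rule P_diff)
    then have "of_int (int k) \<in> P 1" by (simp add: e(3))
    then have "int p dvd int k" by (simp only: int_mem_P1_iff)
    then show ?thesis by simp
  qed
  then have "w = 1" using \<open>s * t = 1\<close> by (simp add: w_def zeta_power_eq_1_iff)
  then show "\<sigma> (B / cnj B) - (B / cnj B) ^ \<mu> \<in> P p" using 1 by (simp add: C_def)
qed

text \<open>Torsion-freeness of the ideal group without unique factorisation: elements of \<open>J\<close> are \<open>p\<close>-th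
  roots of elements of the ring, hence integral.\<close>

lemma ideal_power_eq_one_imp:
  assumes "J \<in> carrier F" "J [^]\<^bsub>F\<^esub> p = O\<^sub>K"
  shows "J = O\<^sub>K"
proof -
  have J: "fractional_ideal \<zeta> J" using assms(1) by (simp add: frac_ideals_simps)
  have pow: "x ^ n \<in> J [^]\<^bsub>F\<^esub> n" if "x \<in> J" for x and n :: nat
  proof (induction n)
    case 0
    show ?case by (simp add: frac_ideals_simps)
  next
    case (Suc n)
    then show ?case using ideal_prod_CC_prod[OF Suc that]
      by (simp only: Group.nat_pow_Suc frac_ideals_simps power_Suc2)
  qed
  have sub: "J \<subseteq> O\<^sub>K"
  proof
    fix x assume x: "x \<in> J"
    show "x \<in> O\<^sub>K"
    proof (rule p_root_integral)
      show "x \<in> K" using fractional_idealD(1)[OF J] x by (rule subsetD)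
      show "x ^ p \<in> O\<^sub>K" using pow[OF x, of p] unfolding assms(2) .
    qed
  qed
  have powsub: "J [^]\<^bsub>F\<^esub> (n::nat) \<subseteq> O\<^sub>K" for n
  proof (induction n)
    case 0
    show ?case by (simp add: frac_ideals_simps)
  next
    case (Suc n)
    show ?case unfolding Group.nat_pow_Suc frac_ideals_simps
      by (rule ideal_prod_CC_subset) (use Suc sub in \<open>auto intro!: cyc_int.mult_mem\<close>)
  qed
  have "p = Suc (p - 1)" using p_ge_3 by simp
  then have "O\<^sub>K = ideal_prod CC (J [^]\<^bsub>F\<^esub> (p - 1)) J"
    using assms(2) Group.nat_pow_Suc[of F J "p - 1"] by (simp only: frac_ideals_simps)
  also have "\<dots> \<subseteq> J"
    by (rule ideal_prod_CC_subset) (use powsub fractional_idealD(2,3)[OF J] in blast)+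
  finally show ?thesis using sub by blast
qed

lemma mem_ideal_classE:
  assumes "I \<in> ideal_class \<zeta> J"
  obtains x where "x \<in> K" "x \<noteq> 0" "I = principal \<zeta> x \<otimes>\<^bsub>F\<^esub> J"
proof -
  obtain h where h: "h \<in> principal_ideals \<zeta>" "I = h \<otimes>\<^bsub>F\<^esub> J"
    using assms unfolding ideal_class_def principal_ideals.mem_coset_iff by (rule bexE)
  from h(1) obtain x where "x \<in> K - {0}" "h = principal \<zeta> x"
    unfolding principal_ideals_def by (elim imageE)
  then show thesis using that[of x] h(2) by simp
qed

context
  fixes B :: complex and \<bb> :: "complex set"
  assumes B: "B \<in> K" "B \<noteq> 0" and \<bb>: "\<bb> \<in> carrier F" "principal \<zeta> B = \<bb> [^]\<^bsub>F\<^esub> p"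
begin

lemma image_mem_class_map: "f ` \<bb> \<in> class_map f (ideal_class \<zeta> \<bb>)"
  unfolding class_map_def ideal_class_def by (intro imageI principal_ideals.self_mem_coset \<bb>)

text \<open>An explicit inverse allows \<open>inv\<close> in the class group to be evaluated on
  representatives, which turns membership in the minus part into an equation between ideals.\<close>

lemma ideal_inverse:
  "\<bb> [^]\<^bsub>F\<^esub> (p - 1) \<otimes>\<^bsub>F\<^esub> principal \<zeta> (inverse B) \<in> carrier F"
  "\<bb> \<otimes>\<^bsub>F\<^esub> (\<bb> [^]\<^bsub>F\<^esub> (p - 1) \<otimes>\<^bsub>F\<^esub> principal \<zeta> (inverse B)) = \<one>\<^bsub>F\<^esub>"
proof -
  show "\<bb> [^]\<^bsub>F\<^esub> (p - 1) \<otimes>\<^bsub>F\<^esub> principal \<zeta> (inverse B) \<in> carrier F"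
    using B by (intro frac_ideals.m_closed frac_ideals.nat_pow_closed \<bb> principal_carrier) simp_all
  have "\<bb> \<otimes>\<^bsub>F\<^esub> (\<bb> [^]\<^bsub>F\<^esub> (p - 1) \<otimes>\<^bsub>F\<^esub> principal \<zeta> (inverse B))
      = (\<bb> \<otimes>\<^bsub>F\<^esub> \<bb> [^]\<^bsub>F\<^esub> (p - 1)) \<otimes>\<^bsub>F\<^esub> principal \<zeta> (inverse B)"
    using B by (intro frac_ideals.m_assoc[symmetric] frac_ideals.nat_pow_closed \<bb> principal_carrier) simp_all
  also have "\<bb> \<otimes>\<^bsub>F\<^esub> \<bb> [^]\<^bsub>F\<^esub> (p - 1) = principal \<zeta> B"
    using frac_ideals.nat_pow_Suc2[OF \<bb>(1), of "p - 1"] p_ge_3 \<bb>(2) by simp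
  finally show "\<bb> \<otimes>\<^bsub>F\<^esub> (\<bb> [^]\<^bsub>F\<^esub> (p - 1) \<otimes>\<^bsub>F\<^esub> principal \<zeta> (inverse B)) = \<one>\<^bsub>F\<^esub>"
    using B by (simp add: frac_ideals_simps principal_mult principal_one)
qed

text \<open>Since conjugation inverts the class, \<open>\<bb>\<close> times its conjugate is
  generated by some \<open>\<beta>\<close>; now take \<open>p\<close>-th powers. The purpose is to
  exhibit the ideal of \<open>B / cnj B = B ^ 2 / (B * cnj B)\<close> as the \<open>p\<close>-th
  power of \<open>\<bb> ^ 2 / \<beta>\<close>.\<close>

lemma relative_norm_principal:
  assumes "ideal_class \<zeta> \<bb> \<in> class_torsion_minus p \<zeta>"
  shows "\<exists>\<beta>\<in>K. \<beta> \<noteq> 0 \<and> principal \<zeta> (cnj B * B) = principal \<zeta> (\<beta> ^ p)"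
proof -
  define b' where "b' = \<bb> [^]\<^bsub>F\<^esub> (p - 1) \<otimes>\<^bsub>F\<^esub> principal \<zeta> (inverse B)"
  have b': "b' \<in> carrier F" "\<bb> \<otimes>\<^bsub>F\<^esub> b' = \<one>\<^bsub>F\<^esub>" unfolding b'_def by (rule ideal_inverse)+
  have "class_map cnj (ideal_class \<zeta> \<bb>) = inv\<^bsub>class_group \<zeta>\<^esub> (ideal_class \<zeta> \<bb>)"
    using assms by (simp add: class_torsion_minus_def)
  also have "\<dots> = ideal_class \<zeta> b'"
    unfolding class_group_def ideal_class_def by (rule principal_ideals.inv_coset[OF \<bb>(1) b'])
  finally have "cnj ` \<bb> \<in> ideal_class \<zeta> b'" using image_mem_class_map by blast
  then obtain \<beta> where \<beta>: "\<beta> \<in> K" "\<beta> \<noteq> 0" "cnj ` \<bb> = principal \<zeta> \<beta> \<otimes>\<^bsub>F\<^esub> b'"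
    by (rule mem_ideal_classE)
  have pc: "principal \<zeta> \<beta> \<in> carrier F" using \<beta> by simp
  have cc: "cnj ` \<bb> \<in> carrier F" unfolding \<beta>(3) by (intro frac_ideals.m_closed pc b')
  have "cnj ` \<bb> \<otimes>\<^bsub>F\<^esub> \<bb> = principal \<zeta> \<beta>"
    unfolding \<beta>(3) frac_ideals.m_assoc[OF pc b'(1) \<bb>(1)] frac_ideals.m_comm[OF b'(1) \<bb>(1)] b'(2)
    using pc by (rule frac_ideals.r_one)
  then have "principal \<zeta> (\<beta> ^ p) = (cnj ` \<bb> \<otimes>\<^bsub>F\<^esub> \<bb>) [^]\<^bsub>F\<^esub> p" by (simp only: principal_power)
  also have "\<dots> = (cnj ` \<bb>) [^]\<^bsub>F\<^esub> p \<otimes>\<^bsub>F\<^esub> \<bb> [^]\<^bsub>F\<^esub> p"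
    by (rule frac_ideals.nat_pow_distrib[OF cc \<bb>(1)])
  also have "(cnj ` \<bb>) [^]\<^bsub>F\<^esub> p = principal \<zeta> (cnj B)"
    using cnj.image_ideal_power[OF cnj_image_cyc_int \<bb>(1), of p]
      cnj.image_principal[OF cnj_image_cyc_int B(1)] by (simp only: \<bb>(2)[symmetric])
  also have "principal \<zeta> (cnj B) \<otimes>\<^bsub>F\<^esub> \<bb> [^]\<^bsub>F\<^esub> p = principal \<zeta> (cnj B * B)"
    unfolding \<bb>(2)[symmetric] frac_ideals_simps principal_mult ..
  finally show ?thesis using \<beta>(1,2) by metis
qed

lemma principal_sigma_singular:
  assumes "class_map \<sigma> (ideal_class \<zeta> \<bb>) = ideal_class \<zeta> \<bb> [^]\<^bsub>class_group \<zeta>\<^esub> (\<mu>::nat)"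
  shows "\<exists>\<alpha>\<in>K. \<alpha> \<noteq> 0 \<and> principal \<zeta> (\<sigma> B) = principal \<zeta> (\<alpha> ^ p * B ^ \<mu>)"
proof -
  have "\<sigma> ` \<bb> \<in> ideal_class \<zeta> (\<bb> [^]\<^bsub>F\<^esub> \<mu>)"
    using image_mem_class_map[of \<sigma>] principal_ideals.coset_pow[OF \<bb>(1), of \<mu>]
    unfolding assms by (simp only: class_group_def ideal_class_def)
  then obtain \<alpha> where \<alpha>: "\<alpha> \<in> K" "\<alpha> \<noteq> 0" "\<sigma> ` \<bb> = principal \<zeta> \<alpha> \<otimes>\<^bsub>F\<^esub> \<bb> [^]\<^bsub>F\<^esub> \<mu>"
    by (rule mem_ideal_classE)
  have pc: "principal \<zeta> \<alpha> \<in> carrier F" using \<alpha> by simp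
  have "principal \<zeta> (\<sigma> B) = (\<sigma> ` \<bb>) [^]\<^bsub>F\<^esub> p"
    using \<sigma>.image_ideal_power[OF sigma_image_cyc_int \<bb>(1), of p]
      \<sigma>.image_principal[OF sigma_image_cyc_int B(1)] by (simp only: \<bb>(2)[symmetric])
  also have "\<dots> = principal \<zeta> \<alpha> [^]\<^bsub>F\<^esub> p \<otimes>\<^bsub>F\<^esub> (\<bb> [^]\<^bsub>F\<^esub> \<mu>) [^]\<^bsub>F\<^esub> p"
    unfolding \<alpha>(3) by (rule frac_ideals.nat_pow_distrib[OF pc frac_ideals.nat_pow_closed[OF \<bb>(1)]])
  also have "(\<bb> [^]\<^bsub>F\<^esub> \<mu>) [^]\<^bsub>F\<^esub> p = (\<bb> [^]\<^bsub>F\<^esub> p) [^]\<^bsub>F\<^esub> \<mu>"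
    unfolding frac_ideals.nat_pow_pow[OF \<bb>(1)] mult.commute[of \<mu>] ..
  also have "principal \<zeta> \<alpha> [^]\<^bsub>F\<^esub> p \<otimes>\<^bsub>F\<^esub> (\<bb> [^]\<^bsub>F\<^esub> p) [^]\<^bsub>F\<^esub> \<mu> = principal \<zeta> (\<alpha> ^ p * B ^ \<mu>)"
    unfolding \<bb>(2)[symmetric] principal_power frac_ideals_simps principal_mult ..
  finally show ?thesis using \<alpha>(1,2) by blast
qed

text \<open>If \<open>B / cnj B\<close> were \<open>x ^ p\<close>, the ideal
  \<open>\<bb> ^ 2 / (\<beta> * x)\<close> would have trivial \<open>p\<close>-th power and so be
  trivial. The class of \<open>\<bb>\<close> would then be killed by 2, against its order
  \<open>p > 2\<close>.\<close>

lemma singular_conjugate_ratio: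
  assumes minus: "ideal_class \<zeta> \<bb> \<in> class_torsion_minus p \<zeta>"
    and order: "has_order (class_group \<zeta>) (ideal_class \<zeta> \<bb>) p"
  shows "singular p \<zeta> (B / cnj B)"
proof -
  obtain \<beta> where \<beta>: "\<beta> \<in> K" "\<beta> \<noteq> 0" "principal \<zeta> (cnj B * B) = principal \<zeta> (\<beta> ^ p)"
    using relative_norm_principal[OF minus] by blast
  define C where "C = B / cnj B"
  have C: "C \<in> K" "C \<noteq> 0" using B by (simp_all add: C_def)
  \<comment> \<open>One family serves both halves: \<open>J (inverse \<beta>)\<close> is the
    \<open>p\<close>-th root of the ideal of \<open>C\<close>, and \<open>J y\<close> with
    \<open>y = inverse (\<beta> * x)\<close> gives the contradiction.\<close>
  define J where "J x = (\<bb> \<otimes>\<^bsub>F\<^esub> \<bb>) \<otimes>\<^bsub>F\<^esub> principal \<zeta> x" for x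
  have bb: "\<bb> \<otimes>\<^bsub>F\<^esub> \<bb> \<in> carrier F" by (intro frac_ideals.m_closed \<bb>)
  have Jc: "J x \<in> carrier F" if "x \<in> K" "x \<noteq> 0" for x
    unfolding J_def using that by (intro frac_ideals.m_closed bb principal_carrier)
  have Jp: "J x [^]\<^bsub>F\<^esub> p = principal \<zeta> (C * \<beta> ^ p * x ^ p)" if "x \<in> K" "x \<noteq> 0" for x
  proof -
    have "J x [^]\<^bsub>F\<^esub> p = (\<bb> [^]\<^bsub>F\<^esub> p \<otimes>\<^bsub>F\<^esub> \<bb> [^]\<^bsub>F\<^esub> p) \<otimes>\<^bsub>F\<^esub> principal \<zeta> x [^]\<^bsub>F\<^esub> p"
      unfolding J_def frac_ideals.nat_pow_distrib[OF bb principal_carrier[OF that]]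
        frac_ideals.nat_pow_distrib[OF \<bb>(1) \<bb>(1)] ..
    also have "\<dots> = principal \<zeta> (B * B * x ^ p)"
      unfolding \<bb>(2)[symmetric] principal_power frac_ideals_simps principal_mult ..
    also have "B * B = C * (cnj B * B)" using B by (simp add: C_def)
    also have "principal \<zeta> (C * (cnj B * B) * x ^ p) =
        ideal_prod CC (ideal_prod CC (principal \<zeta> C) (principal \<zeta> (cnj B * B))) (principal \<zeta> (x ^ p))"
      by (simp only: principal_mult)
    also have "\<dots> = principal \<zeta> (C * \<beta> ^ p * x ^ p)"
      unfolding \<beta>(3) by (simp only: principal_mult)
    finally show ?thesis .
  qed
  have "C \<noteq> x ^ p" if x: "x \<in> K" for x
  proof
    assume Cx: "C = x ^ p"
    then have x0: "x \<noteq> 0" using C p_ge_3 by auto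
    define y where "y = inverse (\<beta> * x)"
    have y: "y \<in> K" "y \<noteq> 0" using x x0 \<beta> by (simp_all add: y_def)
    have "C * \<beta> ^ p * y ^ p = (\<beta> * x * y) ^ p" unfolding Cx by (simp add: power_mult_distrib)
    also have "\<beta> * x * y = 1" unfolding y_def using x0 \<beta>(2) by (intro right_inverse) simp
    finally have "J y [^]\<^bsub>F\<^esub> p = O\<^sub>K" using Jp[OF y] by (simp only: power_one principal_one)
    then have "J y = O\<^sub>K" by (rule ideal_power_eq_one_imp[OF Jc[OF y]])
    have iy: "inverse y \<in> K" "inverse y \<noteq> 0" using y by simp_all
    have "\<bb> \<otimes>\<^bsub>F\<^esub> \<bb> = (\<bb> \<otimes>\<^bsub>F\<^esub> \<bb>) \<otimes>\<^bsub>F\<^esub> principal \<zeta> (y * inverse y)"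
      using y frac_ideals.r_one[OF bb] by (simp add: principal_one frac_ideals_simps(2))
    also have "\<dots> = J y \<otimes>\<^bsub>F\<^esub> principal \<zeta> (inverse y)"
      unfolding J_def frac_ideals.m_assoc[OF bb principal_carrier[OF y] principal_carrier[OF iy]]
      unfolding frac_ideals_simps principal_mult ..
    also have "\<dots> = principal \<zeta> (inverse y)"
      using frac_ideals.l_one[OF principal_carrier[OF iy]] unfolding \<open>J y = O\<^sub>K\<close> frac_ideals_simps(2) .
    finally have "\<bb> \<otimes>\<^bsub>F\<^esub> \<bb> \<in> principal_ideals \<zeta>"
      using iy unfolding principal_ideals_def by blast
    then have "ideal_class \<zeta> (\<bb> \<otimes>\<^bsub>F\<^esub> \<bb>) = principal_ideals \<zeta>"
      unfolding ideal_class_def by (rule principal_ideals.coset_eq_H)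
    moreover have "\<bb> [^]\<^bsub>F\<^esub> (2::nat) = \<bb> \<otimes>\<^bsub>F\<^esub> \<bb>"
      using frac_ideals.l_one[OF \<bb>(1)] by (simp add: numeral_2_eq_2)
    ultimately have "ideal_class \<zeta> \<bb> [^]\<^bsub>class_group \<zeta>\<^esub> (2::nat) = \<one>\<^bsub>class_group \<zeta>\<^esub>"
      using principal_ideals.coset_pow[OF \<bb>(1), of 2]
      by (simp only: class_group_def ideal_class_def principal_ideals.FactGroup_simps(2))
    moreover have "0 < (2::nat)" "2 < p" using p_ge_3 by simp_all
    ultimately show False using order unfolding has_order_def by blast
  qed
  moreover have "principal \<zeta> C = J (inverse \<beta>) [^]\<^bsub>F\<^esub> p"
  proof -
    have "C * \<beta> ^ p * inverse \<beta> ^ p = C" using \<beta>(2) by (simp add: power_inverse)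
    moreover have "J (inverse \<beta>) [^]\<^bsub>F\<^esub> p = principal \<zeta> (C * \<beta> ^ p * inverse \<beta> ^ p)"
      by (rule Jp) (use \<beta>(1,2) in simp_all)
    ultimately show ?thesis by (simp only:)
  qed
  moreover have "J (inverse \<beta>) \<in> carrier F" using Jc[of "inverse \<beta>"] \<beta>(1,2) by simp
  ultimately show ?thesis unfolding singular_def C_def[symmetric] using C(1) by blast
qed

end

end

theorem theorem2p6:
  fixes p u m \<mu> :: nat and \<zeta> B C :: complex
    and \<sigma> :: "complex \<Rightarrow> complex" and \<bb> :: "complex set"
  assumes "Factorial_Ring.prime p" and "odd p"
    and "primitive_root_of_unity p \<zeta>"
    and "residue_primroot p u"
    and "\<sigma> \<in> Gal \<zeta>" and "\<sigma> \<zeta> = \<zeta> ^ u"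
    and "1 \<le> m" and "m \<le> (p - 3) div 2"
    and "\<mu> = upow p u (2 * m + 1)"
    and "B \<in> cyc_int \<zeta>" and "semi_primary p \<zeta> B"
    and "\<bb> \<in> carrier (frac_ideals \<zeta>)"
    and "principal \<zeta> B = \<bb> [^]\<^bsub>frac_ideals \<zeta>\<^esub> p"
    and "ideal_class \<zeta> \<bb> \<in> class_torsion_minus p \<zeta>"
    and "has_order (class_group \<zeta>) (ideal_class \<zeta> \<bb>) p"
    and "class_map \<sigma> (ideal_class \<zeta> \<bb>) = ideal_class \<zeta> \<bb> [^]\<^bsub>class_group \<zeta>\<^esub> \<mu>"
    and "C = B / cnj B"
    and "2 * m + 1 > (p - 1) div 2"
  shows "singular p \<zeta> C \<and>
    (\<exists>\<delta>::int.
       pi_cong \<zeta> (p - 1) C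
         (1 - of_int \<delta> * (\<Sum>i = 0..p - 2. \<zeta> ^ upow p u i / of_nat \<mu> ^ i)) \<and>
       (\<not> primary p \<zeta> C \<longrightarrow> coprime \<delta> (int p)))"
proof -
  interpret cyclotomic_galois p \<zeta> u \<sigma>
    using assms(1-6) by unfold_locales
  obtain c :: int where c: "\<not> int p dvd c" "B - of_int c \<in> P 2"
    using assms(11) unfolding semi_primary_def pi_cong_iff cong_0_iff by blast
  have "singular p \<zeta> B" using assms(11) by (simp add: semi_primary_def)
  \<comment> \<open>This excludes \<open>B = 0\<close>, since a singular number is not a
    \<open>p\<close>-th power.\<close>
  moreover have "(0::complex) = 0 ^ p" using p_ge_3 by simp
  ultimately have B: "B \<in> K" "B \<noteq> 0" unfolding singular_def by (auto intro: cyc_field.zero_mem)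
  obtain \<alpha> where \<alpha>: "\<alpha> \<in> K" "\<alpha> \<noteq> 0" "principal \<zeta> (\<sigma> B) = principal \<zeta> (\<alpha> ^ p * B ^ \<mu>)"
    using principal_sigma_singular[OF B assms(12,13,16)] by blast
  have "\<alpha> ^ p * B ^ \<mu> \<noteq> 0" using \<alpha>(2) B(2) by simp
  from principal_eq_imp_associated[OF \<alpha>(3) this] obtain \<eta> \<eta>' where
    \<eta>: "\<eta> \<in> O\<^sub>K" "\<eta>' \<in> O\<^sub>K" "\<eta> * \<eta>' = 1" "\<sigma> B = \<alpha> ^ p * B ^ \<mu> * \<eta>" by blast
  note C = conjugate_ratio_congruences[OF assms(10) c(2,1) \<alpha>(1,2) \<eta>, folded assms(17)]
  have sing: "singular p \<zeta> C"
    unfolding assms(17) by (rule singular_conjugate_ratio[OF B assms(12-15)])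
  obtain \<delta> :: int where \<delta>: "C - (1 - of_int \<delta> * eigen_sum \<mu>) \<in> P (p - 1)"
    "int p dvd \<delta> \<Longrightarrow> C - 1 \<in> P p"
    using eigen_expansion[OF C assms(9) assms(7,8,18)] by blast
  \<comment> \<open>A congruence also asks that its right-hand side be integral at the prime; here
    it is \<open>C\<close> minus an element of \<open>P (p - 1)\<close>.\<close>
  have "C - (C - (1 - of_int \<delta> * eigen_sum \<mu>)) \<in> R"
    using C(1) P_imp_R[OF \<delta>(1)] by (rule R.diff_mem)
  then have "pi_cong \<zeta> (p - 1) C (1 - of_int \<delta> * eigen_sum \<mu>)"
    unfolding pi_cong_iff using C(1) \<delta>(1) by simp
  moreover have "coprime \<delta> (int p)" if "\<not> primary p \<zeta> C"
  proof -
    have "\<not> int p dvd \<delta>"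
    proof
      assume "int p dvd \<delta>"
      \<comment> \<open>The integer 1 is the witness that makes \<open>C\<close> primary.\<close>
      then have "pi_cong \<zeta> p C (of_int 1 ^ p)"
        unfolding pi_cong_iff using \<delta>(2) C(1) by simp
      moreover have "\<not> [1 = 0] (mod int p)" using p_ge_3 by (simp add: cong_0_iff)
      ultimately show False using that sing unfolding primary_def by blast
    qed
    then show ?thesis
      using prime_p prime_imp_coprime[of "int p" \<delta>] by (simp add: coprime_commute)
  qed
  ultimately show ?thesis using sing unfolding eigen_sum_def by blast
qed

end
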